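(* Let $n\ge1$ and let $E$ be a genuine $C_n$-spectrum. The homotopy groups of the $\mathbb Z$-homotopy fixed points $E^{h\mathbb Z}$ are the $\mathbb Z$-graded piece of the $RO(C_n)$-graded homotopy groups of $E^{hn\mathbb Z}$; that is, for every $k\in\mathbb Z$, $$\pi_k\big(E^{h\mathbb Z}\big)\cong \pi_k^{C_n}\big(E^{hn\mathbb Z}\big).$$
   Context: $C_n=\langle\gamma\rangle$ is cyclic of order $n$. The choice of generator gives a surjection $\mathbb Z\to C_n$; through it the underlying spectrum of $E$ has a $\mathbb Z$-action, and $E^{h\mathbb Z}$ denotes the ordinary homotopy fixed points. Let $\lambda(1)$ be $\mathbb C$ as a real $C_n$-representation with $\gamma\cdot z=e^{2\pi i/n}z$, and $S(\lambda(1))$ its unit circle. $E^{hn\mathbb Z}$ denotes the genuine $C_n$-spectrum $F\big(S(\lambda(1))_+,E\big)$. For $V\in RO(C_n)$, $\pi_V^{C_n}(X)=[S^V,X]^{C_n}$; the $\mathbb Z$-graded piece consists of the groups with $V=k$ a trivial virtual representation. *)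

theory Defs
  imports
    "HOL-Analysis.Analysis"
    "HOL-Algebra.Elementary_Groups"
begin

text \<open>
  Genuine \<open>G\<close>-spectra (\<open>G\<close> a finite group) are modelled by orthogonal \<open>G\<close>-spectra: sequences of
  pointed spaces \<open>X\<^sub>k\<close> with commuting actions of \<open>O(k)\<close> and \<open>G\<close> and equivariant structure maps.
  The value at a \<open>k\<close>-dimensional representation \<open>V\<close> is \<open>X\<^sub>k\<close> with the action of \<open>G\<close> twisted by
  \<open>V : G \<rightarrow> O(k)\<close>, and homotopy groups are colimits along the multiples of the regular
  representation, as in Schwede's lectures on equivariant stable homotopy theory.
\<close>

section \<open>Linear algebra in variable dimension\<close>

text \<open>
  A vector of dimension \<open>d\<close> is a point of \<open>Euclidean_space d\<close>, and a \<open>d \<times> d\<close> matrix is a function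
  vanishing outside \<open>{..<d} \<times> {..<d}\<close>.
\<close>

type_synonym rvec = "nat \<Rightarrow> real"
type_synonym rmat = "nat \<Rightarrow> nat \<Rightarrow> real"

definition mat_id :: "nat \<Rightarrow> rmat" where
  "mat_id d = (\<lambda>i j. if i = j \<and> i < d then 1 else 0)"

definition mat_mult :: "nat \<Rightarrow> rmat \<Rightarrow> rmat \<Rightarrow> rmat" where
  "mat_mult d A B = (\<lambda>i j. \<Sum>l<d. A i l * B l j)"

definition mat_sum :: "nat \<Rightarrow> rmat \<Rightarrow> rmat \<Rightarrow> rmat" where
  "mat_sum d A B = (\<lambda>i j. if i < d \<and> j < d then A i j
     else if d \<le> i \<and> d \<le> j then B (i - d) (j - d) else 0)"

definition mat_vec :: "nat \<Rightarrow> rmat \<Rightarrow> rvec \<Rightarrow> rvec" where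
  "mat_vec d A x = (\<lambda>i. \<Sum>j<d. A i j * x j)"

definition orthogonal_group :: "nat \<Rightarrow> rmat monoid" where
  "orthogonal_group d = \<lparr>carrier =
      {A. (\<forall>i j. d \<le> i \<or> d \<le> j \<longrightarrow> A i j = 0) \<and>
          (\<forall>i<d. \<forall>j<d. (\<Sum>l<d. A l i * A l j) = (if i = j then 1 else 0))},
     monoid.mult = mat_mult d, one = mat_id d\<rparr>"

definition orthogonal_topology :: "nat \<Rightarrow> rmat topology" where
  "orthogonal_topology d =
     subtopology (product_topology (\<lambda>_. powertop_real UNIV) UNIV) (carrier (orthogonal_group d))"

definition vec_append :: "nat \<Rightarrow> rvec \<Rightarrow> rvec \<Rightarrow> rvec" where
  "vec_append d x y = (\<lambda>i. if i < d then x i else y (i - d))"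

definition vec_take :: "nat \<Rightarrow> rvec \<Rightarrow> rvec" where
  "vec_take d x = (\<lambda>i. if i < d then x i else 0)"

definition vec_drop :: "nat \<Rightarrow> rvec \<Rightarrow> rvec" where
  "vec_drop d x = (\<lambda>i. x (d + i))"

section \<open>Representation spheres\<close>

text \<open>\<open>S\<^sup>d\<close> is the one-point compactification of \<open>\<real>\<^sup>d\<close>, with base point \<open>None\<close>.\<close>

type_synonym sphere_pt = "rvec option"

definition rep_sphere :: "nat \<Rightarrow> sphere_pt topology" where
  "rep_sphere d = Alexandroff_compactification (Euclidean_space d)"

definition sphere_act :: "nat \<Rightarrow> rmat \<Rightarrow> sphere_pt \<Rightarrow> sphere_pt" where
  "sphere_act d A = map_option (mat_vec d A)"

text \<open>The homeomorphism \<open>S\<^sup>d \<and> S\<^sup>e \<cong> S\<^sup>d\<^sup>+\<^sup>e\<close>, as a map out of \<open>S\<^sup>d \<times> S\<^sup>e\<close>.\<close>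

definition sphere_smash :: "nat \<Rightarrow> sphere_pt \<Rightarrow> sphere_pt \<Rightarrow> sphere_pt" where
  "sphere_smash d v w = (case (v, w) of (Some x, Some y) \<Rightarrow> Some (vec_append d x y) | _ \<Rightarrow> None)"

section \<open>Orthogonal representations\<close>

text \<open>A representation is given by its dimension and a homomorphism into the orthogonal group.\<close>

type_synonym 'g rep = "nat \<times> ('g \<Rightarrow> rmat)"

definition orthogonal_rep :: "('g, 'b) monoid_scheme \<Rightarrow> 'g rep \<Rightarrow> bool" where
  "orthogonal_rep G V \<longleftrightarrow> snd V \<in> hom G (orthogonal_group (fst V))"

definition trivial_rep :: "nat \<Rightarrow> 'g rep" where
  "trivial_rep d = (d, \<lambda>_. mat_id d)"

definition rep_sum :: "'g rep \<Rightarrow> 'g rep \<Rightarrow> 'g rep" where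
  "rep_sum V W = (fst V + fst W, \<lambda>g. mat_sum (fst V) (snd V g) (snd W g))"

fun rep_multiple :: "nat \<Rightarrow> 'g rep \<Rightarrow> 'g rep" where
  "rep_multiple 0 V = trivial_rep 0"
| "rep_multiple (Suc m) V = rep_sum (rep_multiple m V) V"

text \<open>
  The basis \<open>G\<close> of the regular representation is put in some order; \<open>g\<close> sends the basis vector of
  \<open>h\<close> to that of \<open>g h\<close>.
\<close>

definition group_enum :: "('g, 'b) monoid_scheme \<Rightarrow> nat \<Rightarrow> 'g" where
  "group_enum G = (SOME e. bij_betw e {..<order G} (carrier G))"

definition regular_rep :: "('g, 'b) monoid_scheme \<Rightarrow> 'g rep" where
  "regular_rep G = (order G, \<lambda>g i j.
     if i < order G \<and> j < order G \<and> group_enum G i = g \<otimes>\<^bsub>G\<^esub> group_enum G j then 1 else 0)"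

section \<open>Orthogonal spectra\<close>

text \<open>
  \<open>structure_map X k m\<close> is the map \<open>X\<^sub>k \<and> S\<^sup>m \<rightarrow> X\<^sub>k\<^sub>+\<^sub>m\<close>, given on \<open>X\<^sub>k \<times> S\<^sup>m\<close>; since the smash product
  is a quotient of the product, continuity may be tested there.
\<close>

record 'a spectrum =
  level :: "nat \<Rightarrow> 'a topology"
  base_pt :: "nat \<Rightarrow> 'a"
  orth_act :: "nat \<Rightarrow> rmat \<Rightarrow> 'a \<Rightarrow> 'a"
  structure_map :: "nat \<Rightarrow> nat \<Rightarrow> 'a \<Rightarrow> sphere_pt \<Rightarrow> 'a"

record ('g, 'a) gspectrum = "'a spectrum" +
  group_act :: "nat \<Rightarrow> 'g \<Rightarrow> 'a \<Rightarrow> 'a"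

definition orthogonal_spectrum :: "('a, 'c) spectrum_scheme \<Rightarrow> bool" where
  "orthogonal_spectrum X \<longleftrightarrow>
     (\<forall>k. base_pt X k \<in> topspace (level X k)) \<and>
     \<comment> \<open>continuous pointed actions of the orthogonal groups\<close>
     (\<forall>k. continuous_map (prod_topology (orthogonal_topology k) (level X k)) (level X k)
            (\<lambda>(A, x). orth_act X k A x)) \<and>
     (\<forall>k. \<forall>A \<in> carrier (orthogonal_group k). orth_act X k A (base_pt X k) = base_pt X k) \<and>
     (\<forall>k. \<forall>x \<in> topspace (level X k). orth_act X k (mat_id k) x = x) \<and>
     (\<forall>k. \<forall>A \<in> carrier (orthogonal_group k). \<forall>B \<in> carrier (orthogonal_group k).
        \<forall>x \<in> topspace (level X k).
          orth_act X k (mat_mult k A B) x = orth_act X k A (orth_act X k B x)) \<and>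
     \<comment> \<open>structure maps: continuous and pointed\<close>
     (\<forall>k m. continuous_map (prod_topology (level X k) (rep_sphere m)) (level X (k + m))
              (\<lambda>(x, v). structure_map X k m x v)) \<and>
     (\<forall>k m. \<forall>v \<in> topspace (rep_sphere m).
        structure_map X k m (base_pt X k) v = base_pt X (k + m)) \<and>
     (\<forall>k m. \<forall>x \<in> topspace (level X k). structure_map X k m x None = base_pt X (k + m)) \<and>
     \<comment> \<open>unital and associative\<close>
     (\<forall>k. \<forall>x \<in> topspace (level X k). structure_map X k 0 x (Some (\<lambda>_. 0)) = x) \<and>
     (\<forall>k l m. \<forall>x \<in> topspace (level X k).
        \<forall>v \<in> topspace (rep_sphere l). \<forall>w \<in> topspace (rep_sphere m).
          structure_map X k (l + m) x (sphere_smash l v w) =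
          structure_map X (k + l) m (structure_map X k l x v) w) \<and>
     \<comment> \<open>\<open>O(k) \<times> O(m)\<close>-equivariant\<close>
     (\<forall>k m. \<forall>A \<in> carrier (orthogonal_group k). \<forall>B \<in> carrier (orthogonal_group m).
        \<forall>x \<in> topspace (level X k). \<forall>v \<in> topspace (rep_sphere m).
          structure_map X k m (orth_act X k A x) (sphere_act m B v) =
          orth_act X (k + m) (mat_sum k A B) (structure_map X k m x v))"

definition orthogonal_gspectrum ::
    "('g, 'b) monoid_scheme \<Rightarrow> ('g, 'a) gspectrum \<Rightarrow> bool" where
  "orthogonal_gspectrum G X \<longleftrightarrow>
     orthogonal_spectrum X \<and>
     (\<forall>k. \<forall>g \<in> carrier G. continuous_map (level X k) (level X k) (group_act X k g)) \<and>
     (\<forall>k. \<forall>g \<in> carrier G. group_act X k g (base_pt X k) = base_pt X k) \<and>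
     (\<forall>k. \<forall>x \<in> topspace (level X k). group_act X k \<one>\<^bsub>G\<^esub> x = x) \<and>
     (\<forall>k. \<forall>g \<in> carrier G. \<forall>h \<in> carrier G. \<forall>x \<in> topspace (level X k).
        group_act X k (g \<otimes>\<^bsub>G\<^esub> h) x = group_act X k g (group_act X k h x)) \<and>
     (\<forall>k. \<forall>g \<in> carrier G. \<forall>A \<in> carrier (orthogonal_group k). \<forall>x \<in> topspace (level X k).
        group_act X k g (orth_act X k A x) = orth_act X k A (group_act X k g x)) \<and>
     (\<forall>k m. \<forall>g \<in> carrier G. \<forall>x \<in> topspace (level X k). \<forall>v \<in> topspace (rep_sphere m).
        group_act X (k + m) g (structure_map X k m x v) =
        structure_map X k m (group_act X k g x) v)"

section \<open>\<open>RO(G)\<close>-graded homotopy groups\<close>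

text \<open>Pointed \<open>G\<close>-maps \<open>S\<^sup>V \<rightarrow> X(W)\<close>.\<close>

definition equivariant_pointed ::
    "('g, 'b) monoid_scheme \<Rightarrow> ('g, 'a) gspectrum \<Rightarrow> 'g rep \<Rightarrow> 'g rep \<Rightarrow>
     (sphere_pt \<Rightarrow> 'a) \<Rightarrow> bool" where
  "equivariant_pointed G X V W f \<longleftrightarrow>
     f None = base_pt X (fst W) \<and>
     (\<forall>g \<in> carrier G. \<forall>v \<in> topspace (rep_sphere (fst V)).
        f (sphere_act (fst V) (snd V g) v) =
        orth_act X (fst W) (snd W g) (group_act X (fst W) g (f v)))"

definition gmaps ::
    "('g, 'b) monoid_scheme \<Rightarrow> ('g, 'a) gspectrum \<Rightarrow> 'g rep \<Rightarrow> 'g rep \<Rightarrow>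
     (sphere_pt \<Rightarrow> 'a) set" where
  "gmaps G X V W = {f. continuous_map (rep_sphere (fst V)) (level X (fst W)) f \<and>
                       equivariant_pointed G X V W f}"

definition ghomotopic ::
    "('g, 'b) monoid_scheme \<Rightarrow> ('g, 'a) gspectrum \<Rightarrow> 'g rep \<Rightarrow> 'g rep \<Rightarrow>
     (sphere_pt \<Rightarrow> 'a) \<Rightarrow> (sphere_pt \<Rightarrow> 'a) \<Rightarrow> bool" where
  "ghomotopic G X V W =
     homotopic_with (equivariant_pointed G X V W) (rep_sphere (fst V)) (level X (fst W))"

text \<open>
  For \<open>f : S\<^sup>d \<rightarrow> X\<^sub>e\<close>, the composite \<open>S\<^sup>d\<^sup>+\<^sup>N \<cong> S\<^sup>d \<and> S\<^sup>N \<rightarrow> X\<^sub>e \<and> S\<^sup>N \<rightarrow> X\<^sub>e\<^sub>+\<^sub>N\<close>.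
\<close>

definition stabilize ::
    "('g, 'a) gspectrum \<Rightarrow> nat \<Rightarrow> nat \<Rightarrow> nat \<Rightarrow> (sphere_pt \<Rightarrow> 'a) \<Rightarrow> sphere_pt \<Rightarrow> 'a" where
  "stabilize X d e N f v = (case v of None \<Rightarrow> base_pt X (e + N)
     | Some x \<Rightarrow> structure_map X e N (f (Some (vec_take d x))) (Some (vec_drop d x)))"

text \<open>
  A pair \<open>(W, U)\<close> of representations stands for the virtual representation \<open>W - U\<close>, and
  \<open>\<pi>\<^sub>W\<^sub>-\<^sub>U(X) = colim\<^sub>m [S\<^bsup>W + m\<rho>\<^esup>, X(U + m\<rho>)]\<^sup>G\<close>, where \<open>\<rho>\<close> is the regular representation.
  An element of the colimit is represented by a pair \<open>(m, f)\<close> with \<open>f\<close> a map at stage \<open>m\<close>.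
\<close>

type_synonym 'g virtual_rep = "'g rep \<times> 'g rep"

abbreviation stage_rep :: "('g, 'b) monoid_scheme \<Rightarrow> 'g rep \<Rightarrow> nat \<Rightarrow> 'g rep" where
  "stage_rep G V m \<equiv> rep_sum V (rep_multiple m (regular_rep G))"

definition stable_maps ::
    "('g, 'b) monoid_scheme \<Rightarrow> 'g virtual_rep \<Rightarrow> ('g, 'a) gspectrum \<Rightarrow>
     (nat \<times> (sphere_pt \<Rightarrow> 'a)) set" where
  "stable_maps G V X =
     {(m, f). f \<in> gmaps G X (stage_rep G (fst V) m) (stage_rep G (snd V) m)}"

definition stably_homotopic ::
    "('g, 'b) monoid_scheme \<Rightarrow> 'g virtual_rep \<Rightarrow> ('g, 'a) gspectrum \<Rightarrow>
     ((nat \<times> (sphere_pt \<Rightarrow> 'a)) \<times> (nat \<times> (sphere_pt \<Rightarrow> 'a))) set" where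
  "stably_homotopic G V X =
     {((m, f), (m', f')). (m, f) \<in> stable_maps G V X \<and> (m', f') \<in> stable_maps G V X \<and>
        (\<exists>j j'. m + j = m' + j' \<and>
           ghomotopic G X (stage_rep G (fst V) (m + j)) (stage_rep G (snd V) (m + j))
             (stabilize X (fst (stage_rep G (fst V) m)) (fst (stage_rep G (snd V) m))
                (j * order G) f)
             (stabilize X (fst (stage_rep G (fst V) m')) (fst (stage_rep G (snd V) m'))
                (j' * order G) f'))}"

text \<open>
  For \<open>m \<ge> 1\<close> let \<open>u\<close> be the sum of the basis vectors of the first copy of \<open>\<rho>\<close> in \<open>W + m\<rho>\<close>; it is
  fixed by \<open>G\<close>. Let \<open>s = \<langle>x, u\<rangle>\<close>. The map \<open>x \<mapsto> x - u/s\<close> identifies each of the half spaces \<open>s < 0\<close>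
  and \<open>s > 0\<close> equivariantly with the whole of \<open>W + m\<rho>\<close>, so that collapsing \<open>s = 0\<close> is the pinch map
  \<open>S\<^bsup>W + m\<rho>\<^esup> \<rightarrow> S\<^bsup>W + m\<rho>\<^esup> \<or> S\<^bsup>W + m\<rho>\<^esup>\<close>. Below, \<open>d\<close> is the dimension of \<open>W\<close>, \<open>n\<close> is the order of \<open>G\<close>
  and \<open>b\<close> is the base point of the target.
\<close>

definition pinch_sum ::
    "nat \<Rightarrow> nat \<Rightarrow> 'a \<Rightarrow> (sphere_pt \<Rightarrow> 'a) \<Rightarrow> (sphere_pt \<Rightarrow> 'a) \<Rightarrow> sphere_pt \<Rightarrow> 'a" where
  "pinch_sum d n b f h v = (case v of None \<Rightarrow> b
     | Some x \<Rightarrow>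
         let s = (\<Sum>i\<in>{d..<d + n}. x i);
             y = (\<lambda>i. if i \<in> {d..<d + n} then x i - 1 / s else x i)
         in if s < 0 then f (Some y) else if s > 0 then h (Some y) else b)"

definition RO_homotopy_group ::
    "('g, 'b) monoid_scheme \<Rightarrow> 'g virtual_rep \<Rightarrow> ('g, 'a) gspectrum \<Rightarrow>
     (nat \<times> (sphere_pt \<Rightarrow> 'a)) set monoid" where
  "RO_homotopy_group G V X = \<lparr>
     carrier = stable_maps G V X // stably_homotopic G V X,
     monoid.mult = (\<lambda>a b. \<Union>{stably_homotopic G V X ``
         {(m, pinch_sum (fst (fst V)) (order G) (base_pt X (fst (stage_rep G (snd V) m))) f h)}
       |m f h. 1 \<le> m \<and> (m, f) \<in> a \<and> (m, h) \<in> b}),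
     one = stably_homotopic G V X `` {(0, \<lambda>_. base_pt X (fst (stage_rep G (snd V) 0)))}\<rparr>"

text \<open>The integer \<open>k\<close> as a trivial virtual representation.\<close>

definition trivial_virtual_rep :: "int \<Rightarrow> 'g virtual_rep" where
  "trivial_virtual_rep k = (trivial_rep (nat k), trivial_rep (nat (- k)))"

text \<open>
  Nonequivariant homotopy groups are the case of the trivial group, whose regular representation
  is \<open>\<real>\<close>: \<open>\<pi>\<^sub>k(Y) = colim\<^sub>m [S\<^bsup>k+m\<^esup>, Y\<^sub>m]\<close> for \<open>k \<ge> 0\<close> and \<open>colim\<^sub>m [S\<^sup>m, Y\<^bsub>m-k\<^esub>]\<close> for \<open>k < 0\<close>.
\<close>

definition with_trivial_action :: "'a spectrum \<Rightarrow> (unit, 'a) gspectrum" where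
  "with_trivial_action Y = spectrum.extend Y (gspectrum.fields (\<lambda>k g x. x))"

definition homotopy_group :: "int \<Rightarrow> 'a spectrum \<Rightarrow> (nat \<times> (sphere_pt \<Rightarrow> 'a)) set monoid" where
  "homotopy_group k Y =
     RO_homotopy_group (singleton_group ()) (trivial_virtual_rep k) (with_trivial_action Y)"

section \<open>Function spectra and homotopy fixed points\<close>

text \<open>
  The space of continuous maps with the compact-open topology. Every continuous map is a point of
  it, because of the subbasic set with \<open>K = {}\<close>.
\<close>

definition mapping_space :: "'s topology \<Rightarrow> 'a topology \<Rightarrow> ('s \<Rightarrow> 'a) topology" where
  "mapping_space A Y =
     (let C = {f. continuous_map A Y f \<and> f \<in> extensional (topspace A)}
      in topology_generated_by {{f \<in> C. f ` K \<subseteq> U} |K U. compactin A K \<and> openin Y U})"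

text \<open>
  The spectrum \<open>F(A\<^sub>+, X)\<close> for a \<open>G\<close>-space \<open>A\<close> with action \<open>\<alpha>\<close>, with \<open>G\<close> acting by conjugation.
\<close>

definition function_spectrum ::
    "('g, 'b) monoid_scheme \<Rightarrow> 's topology \<Rightarrow> ('g \<Rightarrow> 's \<Rightarrow> 's) \<Rightarrow> ('g, 'a) gspectrum \<Rightarrow>
     ('g, 's \<Rightarrow> 'a) gspectrum" where
  "function_spectrum G A \<alpha> X = \<lparr>
     level = (\<lambda>k. mapping_space A (level X k)),
     base_pt = (\<lambda>k. \<lambda>s \<in> topspace A. base_pt X k),
     orth_act = (\<lambda>k B p. \<lambda>s \<in> topspace A. orth_act X k B (p s)),
     structure_map = (\<lambda>k m p v. \<lambda>s \<in> topspace A. structure_map X k m (p s) v),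
     group_act = (\<lambda>k g p. \<lambda>s \<in> topspace A. group_act X k g (p (\<alpha> (inv\<^bsub>G\<^esub> g) s)))\<rparr>"

text \<open>Levelwise fixed points of a spectrum with an action of a discrete group.\<close>

definition fixed_point_spectrum ::
    "('g, 'b) monoid_scheme \<Rightarrow> ('g, 'a) gspectrum \<Rightarrow> 'a spectrum" where
  "fixed_point_spectrum G X = \<lparr>
     level = (\<lambda>k. subtopology (level X k) {x. \<forall>g \<in> carrier G. group_act X k g x = x}),
     base_pt = base_pt X, orth_act = orth_act X, structure_map = structure_map X\<rparr>"

definition pullback_action :: "('h \<Rightarrow> 'g) \<Rightarrow> ('g, 'a) gspectrum \<Rightarrow> ('h, 'a) gspectrum" where
  "pullback_action \<phi> X =
     spectrum.extend (spectrum.truncate X) (gspectrum.fields (\<lambda>k h. group_act X k (\<phi> h)))"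

text \<open>
  For a spectrum \<open>X\<close> with \<open>\<int>\<close>-action, \<open>X\<^bsup>h\<int>\<^esup> = F(E\<int>\<^sub>+, X)\<^sup>\<int>\<close> with \<open>E\<int> = \<real>\<close>, on which \<open>\<int>\<close> acts by
  translation. Levelwise this is the homotopy equalizer of the identity and the generator; being a
  finite homotopy limit, it has the right homotopy type without any fibrancy condition on \<open>X\<close>.
\<close>

definition homotopy_fixed_points_Z :: "(int, 'a) gspectrum \<Rightarrow> (real \<Rightarrow> 'a) spectrum" where
  "homotopy_fixed_points_Z X = fixed_point_spectrum integer_group
     (function_spectrum integer_group euclideanreal (\<lambda>z t. t + of_int z) X)"

text \<open>\<open>E\<^bsup>h\<int>\<^esup>\<close>, where \<open>\<int>\<close> acts on the underlying spectrum of \<open>E\<close> through \<open>1 \<mapsto> \<gamma>\<close>.\<close>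

definition spectrum_hZ ::
    "('g, 'b) monoid_scheme \<Rightarrow> 'g \<Rightarrow> ('g, 'a) gspectrum \<Rightarrow> (real \<Rightarrow> 'a) spectrum" where
  "spectrum_hZ G \<gamma> E =
     homotopy_fixed_points_Z (pullback_action (\<lambda>z::int. \<gamma> [^]\<^bsub>G\<^esub> z) E)"

text \<open>
  The representation \<open>\<lambda>(1)\<close> of the cyclic group \<open>G\<close> generated by \<open>\<gamma>\<close>: \<open>\<gamma>\<^sup>j z = exp(2\<pi>ij/n) z\<close> with
  \<open>n\<close> the order of \<open>G\<close>; this does not depend on the exponent \<open>j\<close> chosen.
\<close>

definition lambda1 :: "('g, 'b) monoid_scheme \<Rightarrow> 'g \<Rightarrow> 'g \<Rightarrow> complex \<Rightarrow> complex" where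
  "lambda1 G \<gamma> g z =
     cis (2 * pi * real (LEAST j::nat. \<gamma> [^]\<^bsub>G\<^esub> j = g) / real (order G)) * z"

text \<open>\<open>E\<^bsup>hn\<int>\<^esup> = F(S(\<lambda>(1))\<^sub>+, E)\<close>\<close>

definition spectrum_hnZ ::
    "('g, 'b) monoid_scheme \<Rightarrow> 'g \<Rightarrow> ('g, 'a) gspectrum \<Rightarrow> ('g, complex \<Rightarrow> 'a) gspectrum" where
  "spectrum_hnZ G \<gamma> E =
     function_spectrum G (top_of_set (sphere 0 1)) (lambda1 G \<gamma>) E"

end

theory Submission
  imports Defs "HOL-Algebra.Multiplicative_Group"
begin

text \<open>
  Pulling a \<open>G\<close>-map \<open>S\<^sup>V \<times> S(\<lambda>(1)) \<rightarrow> E(W)\<close> back along \<open>\<real> \<rightarrow> S(\<lambda>(1))\<close>, \<open>t \<mapsto> exp(2\<pi>it/n)\<close>, gives a map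
  \<open>F\<close> on \<open>S\<^sup>V \<times> \<real>\<close> with \<open>F(\<gamma>v, t + 1) = \<gamma>F(v, t)\<close>. If \<open>A\<close> and \<open>B\<close> are paths of orthogonal matrices with
  \<open>A(t + 1) = V(\<gamma>)A(t)\<close> and \<open>B(t + 1) = W(\<gamma>)B(t)\<close>, then \<open>B(t)\<^sup>-\<^sup>1 F(A(t)v, t)\<close> is a nonequivariant map from
  the sphere to the homotopy fixed points, and this is a bijection. Such paths exist for even
  multiples of the regular representation, which are cofinal among the stages of the colimit: on
  \<open>\<rho> \<oplus> \<rho> = \<rho> \<otimes> \<complex>\<close> take the discrete Fourier transform followed by the rotation of frequency \<open>k\<close> at
  speed \<open>k\<close>. These paths are compatible with stabilization, and they carry the coordinate used to
  pinch spheres nonequivariantly to the invariant vector used to pinch them equivariantly, so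
  the bijection is additive.
\<close>

section \<open>Mapping spaces and quotient maps\<close>

text \<open>A path with \<open>A(t + 1) = V(\<gamma>) A(t)\<close> forces
  \<open>det V(\<gamma>) = 1\<close>, because the determinant is constant along it. The generator
  permutes the basis of the regular representation in one cycle of length n, of sign (-1)^(n-1), so
  for even n no such path exists on an odd multiple. Doubling removes this obstruction and supplies
  the complex structure on which the rotations act. Trivial summands carry the constant path. Two
  further difficulties shape the file. The levels of a spectrum are arbitrary spaces, and a quotient
  map need not remain one after a product with such a space; continuity is pushed down only along
  surjections from a compact to a Hausdorff space, which do remain quotient maps. And products of
  classes are given by pinch sums; the correspondence is set up for all pointed functions and both
  respects and reflects being a stable map, so sums match on both sides, with empty classes
  corresponding to empty classes.\<close>

lemma topspace_mapping_space:
  "topspace (mapping_space A Y) = {f. continuous_map A Y f \<and> f \<in> extensional (topspace A)}"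
  (is "_ = ?C")
proof -
  have "f \<in> \<Union> {{f \<in> ?C. f ` K \<subseteq> U} |K U. compactin A K \<and> openin Y U}" if "f \<in> ?C" for f
    using that by (intro UnionI[of "{f \<in> ?C. f ` {} \<subseteq> {}}"]) auto
  then show ?thesis
    unfolding mapping_space_def Let_def topology_generated_by_topspace by blast
qed

lemma openin_mapping_space_basic:
  assumes "compactin A K" "openin Y U"
  shows "openin (mapping_space A Y) {f \<in> topspace (mapping_space A Y). f ` K \<subseteq> U}"
  unfolding topspace_mapping_space unfolding mapping_space_def Let_def
  by (rule topology_generated_by_Basis) (use assms in blast)

text \<open>By the tube lemma, an open set around \<open>{x} \<times> K\<close> with
  \<open>K\<close> compact contains a product neighbourhood, so the condition that
  \<open>f x\<close> maps \<open>K\<close> into \<open>U\<close> is open in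
  \<open>x\<close>.\<close>

lemma continuous_map_mapping_space_curry:
  assumes ext: "\<And>x. x \<in> topspace X \<Longrightarrow> f x \<in> extensional (topspace A)"
    and cont: "continuous_map (prod_topology X A) Y (\<lambda>(x, a). f x a)"
  shows "continuous_map X (mapping_space A Y) f"
proof -
  have slice: "continuous_map A Y (f x)" if "x \<in> topspace X" for x
  proof -
    have "continuous_map A (prod_topology X A) (\<lambda>a. (x, a))"
      by (intro continuous_intros) (auto simp: that)
    from continuous_map_compose[OF this cont] show ?thesis
      by (simp add: o_def)
  qed
  let ?C = "{f. continuous_map A Y f \<and> f \<in> extensional (topspace A)}"
  have "openin X (f -` {f \<in> ?C. f ` K \<subseteq> U} \<inter> topspace X)"
    if K: "compactin A K" and U: "openin Y U" for K U
  proof (subst openin_subopen, intro ballI)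
    fix x assume x: "x \<in> f -` {f \<in> ?C. f ` K \<subseteq> U} \<inter> topspace X"
    let ?W = "{z \<in> topspace (prod_topology X A). (\<lambda>(x, a). f x a) z \<in> U}"
    have W: "openin (prod_topology X A) ?W"
      using cont U by (rule openin_continuous_map_preimage)
    have "{x} \<times> K \<subseteq> ?W"
      using x compactin_subset_topspace[OF K] by auto
    then have "\<exists>P Q. openin X P \<and> openin A Q \<and> x \<in> P \<and> K \<subseteq> Q \<and> P \<times> Q \<subseteq> ?W"
      using x by (intro tube_lemma_right[OF W K]) auto
    then obtain P Q where PQ: "openin X P" "openin A Q" "x \<in> P" "K \<subseteq> Q" "P \<times> Q \<subseteq> ?W"
      by (elim exE conjE)
    have "P \<subseteq> f -` {f \<in> ?C. f ` K \<subseteq> U} \<inter> topspace X"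
    proof
      fix y assume y: "y \<in> P"
      then have "y \<in> topspace X" using openin_subset[OF PQ(1)] by blast
      moreover have "f y a \<in> U" if "a \<in> K" for a
        using y PQ(4) subsetD[OF PQ(5), of "(y, a)"] that by auto
      then have "f y ` K \<subseteq> U" by blast
      ultimately show "y \<in> f -` {f \<in> ?C. f ` K \<subseteq> U} \<inter> topspace X"
        using slice ext by simp
    qed
    then show "\<exists>T. openin X T \<and> x \<in> T \<and> T \<subseteq> f -` {f \<in> ?C. f ` K \<subseteq> U} \<inter> topspace X"
      using PQ by blast
  qed
  moreover have "f ` topspace X \<subseteq> topspace (mapping_space A Y)"
    using slice ext by (auto simp: topspace_mapping_space)
  ultimately show ?thesis
    unfolding mapping_space_def Let_def
    by (intro continuous_on_generated_topo) (auto simp flip: topology_generated_by_topspace)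
qed

text \<open>A point \<open>a\<close> has a compact neighbourhood inside the preimage of
  \<open>U\<close> under \<open>f\<close>, and the maps sending that neighbourhood into
  \<open>U\<close> form a subbasic open set. Local compactness enters here; the circle and the line
  have it.\<close>

lemma continuous_map_mapping_space_eval:
  assumes "locally_compact_space A" "Hausdorff_space A"
  shows "continuous_map (prod_topology (mapping_space A Y) A) Y (\<lambda>(f, a). f a)"
proof -
  have "openin (prod_topology (mapping_space A Y) A)
      {z \<in> topspace (prod_topology (mapping_space A Y) A). (\<lambda>(f, a). f a) z \<in> U}"
    if U: "openin Y U" for U
  proof (subst openin_subopen, intro ballI)
    fix z assume z: "z \<in> {z \<in> topspace (prod_topology (mapping_space A Y) A). (\<lambda>(f, a). f a) z \<in> U}"
    obtain f a where fa: "z = (f, a)" "f \<in> topspace (mapping_space A Y)" "a \<in> topspace A" "f a \<in> U"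
      using z by auto
    have f: "continuous_map A Y f"
      using fa by (simp add: topspace_mapping_space)
    have "neighbourhood_base_of (\<lambda>C. compactin A C \<and> closedin A C) A"
      using assms locally_compact_Hausdorff_imp_regular_space locally_compact_regular_space_neighbourhood_base
      by blast
    moreover have "openin A {x \<in> topspace A. f x \<in> U}"
      using f U by (rule openin_continuous_map_preimage)
    ultimately obtain O' K where OK: "openin A O'" "compactin A K" "a \<in> O'" "O' \<subseteq> K"
        "K \<subseteq> {x \<in> topspace A. f x \<in> U}"
      unfolding neighbourhood_base_of using fa by (metis (mono_tags, lifting) mem_Collect_eq)
    let ?P = "{f \<in> topspace (mapping_space A Y). f ` K \<subseteq> U}"
    have "openin (prod_topology (mapping_space A Y) A) (?P \<times> O')"
      using openin_mapping_space_basic[OF OK(2) U] OK(1) by (simp add: openin_prod_Times_iff)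
    moreover have "z \<in> ?P \<times> O'" using fa OK by auto
    moreover have "?P \<times> O' \<subseteq> {z \<in> topspace (prod_topology (mapping_space A Y) A). (\<lambda>(f, a). f a) z \<in> U}"
      using OK by auto
    ultimately show "\<exists>T. openin (prod_topology (mapping_space A Y) A) T \<and> z \<in> T \<and>
        T \<subseteq> {z \<in> topspace (prod_topology (mapping_space A Y) A). (\<lambda>(f, a). f a) z \<in> U}"
      by blast
  qed
  moreover have "(\<lambda>(f, a). f a) \<in> topspace (prod_topology (mapping_space A Y) A) \<rightarrow> topspace Y"
    by (auto simp: topspace_mapping_space continuous_map_def)
  ultimately show ?thesis
    unfolding continuous_map_def by blast
qed

text \<open>A continuous map from a compact to a Hausdorff space is proper, and properness survives
  the product with any \<open>X\<close>; so the product map is closed and again a quotient map. This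
  serves for \<open>sphere_smash\<close> and for wrapping an interval around the circle.\<close>

lemma continuous_map_prod_descend:
  assumes "compact_space K" "Hausdorff_space H" "continuous_map K H q" "q ` topspace K = topspace H"
    and f: "continuous_map (prod_topology X K) Y (\<lambda>(x, k). f (x, q k))"
  shows "continuous_map (prod_topology X H) Y f"
proof -
  let ?Q = "\<lambda>(x, k). (x, q k)"
  have "proper_map K H q"
    using assms(1-3) Hausdorff_imp_kc_space continuous_imp_proper_map by blast
  then have "proper_map (prod_topology X K) (prod_topology X H) ?Q"
    using proper_map_prod[of X K X H "\<lambda>x. x" q] proper_map_id[of X] by (simp add: id_def)
  then have "closed_map (prod_topology X K) (prod_topology X H) ?Q"
    by (rule proper_imp_closed_map)
  moreover have "continuous_map (prod_topology X K) (prod_topology X H) ?Q"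
    using assms(3) by (simp add: continuous_map_prod_top)
  moreover have "?Q ` topspace (prod_topology X K) = topspace (prod_topology X H)"
    using assms(4) by (force simp: image_iff)
  ultimately have "quotient_map (prod_topology X K) (prod_topology X H) ?Q"
    by (intro continuous_closed_imp_quotient_map)
  moreover have "continuous_map (prod_topology X K) Y (f \<circ> ?Q)"
    using f by (simp add: o_def case_prod_beta')
  ultimately show ?thesis
    by (rule continuous_compose_quotient_map)
qed

section \<open>Representation spheres\<close>

definition norm_sq :: "nat \<Rightarrow> rvec \<Rightarrow> real" where
  "norm_sq d x = (\<Sum>i<d. (x i)\<^sup>2)"

lemma continuous_map_coordinate:
  "continuous_map (Euclidean_space d) euclideanreal (\<lambda>x. x i)"
  unfolding Euclidean_space_def
  by (intro continuous_map_from_subtopology continuous_map_product_projection) auto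

lemma continuous_map_into_Euclidean_space:
  assumes "\<And>i. i < d \<Longrightarrow> continuous_map X euclideanreal (\<lambda>x. f x i)"
    and "\<And>x i. x \<in> topspace X \<Longrightarrow> d \<le> i \<Longrightarrow> f x i = 0"
  shows "continuous_map X (Euclidean_space d) f"
proof (rule continuous_map_eq)
  show "continuous_map X (Euclidean_space d) (\<lambda>x i. if i < d then f x i else 0)"
    using assms(1) by (simp add: continuous_map_componentwise_Euclidean_space)
qed (use assms(2) in auto)

lemma continuous_map_norm_sq:
  "continuous_map (Euclidean_space d) euclideanreal (norm_sq d)"
  unfolding norm_sq_def by (intro continuous_intros continuous_map_coordinate) auto

lemma Hausdorff_Euclidean_space: "Hausdorff_space (Euclidean_space d)"
  unfolding Euclidean_space_def
  by (intro Hausdorff_space_subtopology) (simp add: Hausdorff_space_product_topology)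

lemma locally_compact_Euclidean_space: "locally_compact_space (Euclidean_space d)"
proof -
  have "locally_compact_space (product_topology (\<lambda>i. euclideanreal) {..<d})"
    by (simp add: locally_compact_space_product_topology locally_compact_space_euclidean)
  then show ?thesis
    using homeomorphic_Euclidean_space_product_topology homeomorphic_locally_compact_space by blast
qed

text \<open>The ball is closed in a cube that is compact by Tychonoff's theorem. Coordinates from
  \<open>d\<close> on are confined to \<open>{0}\<close> so that the cube lies in
  \<open>Euclidean_space d\<close>.\<close>

lemma compactin_Euclidean_ball:
  "compactin (Euclidean_space d) {x \<in> topspace (Euclidean_space d). norm_sq d x \<le> r}"
proof -
  let ?B = "PiE UNIV (\<lambda>i::nat. if i < d then {- sqrt r..sqrt r} else {0::real})"
  have "compactin (powertop_real UNIV) ?B"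
    by (subst compactin_PiE) auto
  moreover have "?B \<subseteq> topspace (Euclidean_space d)"
    by (auto simp: topspace_Euclidean_space PiE_iff split: if_splits)
  ultimately have B: "compactin (Euclidean_space d) ?B"
    unfolding Euclidean_space_def by (simp add: compactin_subtopology)
  have C: "closedin (Euclidean_space d) {x \<in> topspace (Euclidean_space d). norm_sq d x \<in> {..r}}"
    by (rule closedin_continuous_map_preimage[OF continuous_map_norm_sq]) auto
  have "{x \<in> topspace (Euclidean_space d). norm_sq d x \<in> {..r}} \<subseteq> ?B"
  proof
    fix x assume x: "x \<in> {x \<in> topspace (Euclidean_space d). norm_sq d x \<in> {..r}}"
    have "x i \<in> (if i < d then {- sqrt r..sqrt r} else {0})" for i
    proof (cases "i < d")
      case True
      have "(x i)\<^sup>2 \<le> norm_sq d x"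
        unfolding norm_sq_def using True
        by (intro member_le_sum[of i "{..<d}" "\<lambda>i. (x i)\<^sup>2"]) auto
      then have "(x i)\<^sup>2 \<le> r" using x by auto
      then have "\<bar>x i\<bar> \<le> sqrt r" by (rule real_le_rsqrt[of "\<bar>x i\<bar>", simplified])
      then show ?thesis using True by auto
    qed (use x in \<open>auto simp: topspace_Euclidean_space\<close>)
    then show "x \<in> ?B" by auto
  qed
  from closed_compactin[OF B this C] show ?thesis by simp
qed

lemma topspace_rep_sphere: "topspace (rep_sphere d) = insert None (Some ` topspace (Euclidean_space d))"
  by (simp add: rep_sphere_def)

lemma Some_in_rep_sphere: "Some x \<in> topspace (rep_sphere d) \<longleftrightarrow> (\<forall>i\<ge>d. x i = 0)"
  by (auto simp: topspace_rep_sphere topspace_Euclidean_space)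

lemma None_in_rep_sphere [simp]: "None \<in> topspace (rep_sphere d)"
  by (simp add: topspace_rep_sphere)

lemma compact_rep_sphere: "compact_space (rep_sphere d)"
  by (simp add: rep_sphere_def)

lemma Hausdorff_rep_sphere: "Hausdorff_space (rep_sphere d)"
  by (simp add: rep_sphere_def Hausdorff_space_Alexandroff_compactification
      Hausdorff_Euclidean_space locally_compact_Euclidean_space)

text \<open>These sets form a neighbourhood base at the point at infinity; \<open>None\<close>
  belongs to each of them vacuously.\<close>

definition far_points :: "nat \<Rightarrow> real \<Rightarrow> sphere_pt set" where
  "far_points d r = {v \<in> topspace (rep_sphere d). \<forall>x. v = Some x \<longrightarrow> r < norm_sq d x}"

lemma openin_far_points: "openin (rep_sphere d) (far_points d r)"
proof -
  let ?C = "{x \<in> topspace (Euclidean_space d). norm_sq d x \<le> r}"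
  have "far_points d r = insert None (Some ` (topspace (Euclidean_space d) - ?C))"
    by (force simp: far_points_def topspace_rep_sphere)
  moreover have "closedin (Euclidean_space d) ?C"
    using compactin_Euclidean_ball compactin_imp_closedin[OF Hausdorff_Euclidean_space] by simp
  ultimately show ?thesis
    unfolding rep_sphere_def openin_Alexandroff_compactification
    using compactin_Euclidean_ball by metis
qed

lemma openin_finite_points: "openin (rep_sphere d) (Some ` topspace (Euclidean_space d))"
  unfolding rep_sphere_def by simp

lemma continuous_map_the_rep_sphere:
  "continuous_map (subtopology (rep_sphere d) (Some ` topspace (Euclidean_space d))) (Euclidean_space d) the"
proof -
  have "openin (rep_sphere d) {v \<in> Some ` topspace (Euclidean_space d). the v \<in> U}"
    if "openin (Euclidean_space d) U" for U
  proof -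
    have "{v \<in> Some ` topspace (Euclidean_space d). the v \<in> U} = Some ` U"
      using openin_subset[OF that] by force
    then show ?thesis using that unfolding rep_sphere_def by simp
  qed
  moreover have "topspace (subtopology (rep_sphere d) (Some ` topspace (Euclidean_space d)))
      = Some ` topspace (Euclidean_space d)"
    by (auto simp: topspace_rep_sphere)
  moreover have "{v \<in> Some ` topspace (Euclidean_space d). the v \<in> U} \<subseteq> Some ` topspace (Euclidean_space d)" for U
    by blast
  ultimately show ?thesis
    unfolding continuous_map_def openin_open_subtopology[OF openin_finite_points] by auto
qed

lemma openin_rep_sphere_at_infinity:
  assumes "openin (rep_sphere d) U" "None \<in> U"
  obtains r where "far_points d r \<subseteq> U"
proof -
  obtain C where C: "compactin (Euclidean_space d) C" "U = insert None (Some ` (topspace (Euclidean_space d) - C))"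
    using assms unfolding rep_sphere_def openin_Alexandroff_compactification by blast
  have "compactin euclideanreal (norm_sq d ` C)"
    using C(1) continuous_map_norm_sq by (rule image_compactin)
  then have "bounded (norm_sq d ` C)"
    by (simp add: compact_imp_bounded)
  then obtain r where "\<And>y. y \<in> norm_sq d ` C \<Longrightarrow> \<bar>y\<bar> \<le> r"
    unfolding bounded_iff by auto
  then have "norm_sq d x \<le> r" if "x \<in> C" for x
    using that by force
  then have "far_points d r \<subseteq> U"
    unfolding C(2) far_points_def topspace_rep_sphere by force
  then show thesis by (rule that)
qed

text \<open>An open set of the sphere is an open set of \<open>Euclidean_space d\<close> or, if it
  contains infinity, the union of one with some \<open>far_points\<close> set. The hypotheses test
  these two kinds.\<close>

lemma continuous_map_into_rep_sphere:
  assumes f: "f \<in> topspace X \<rightarrow> topspace (rep_sphere d)"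
    and fin: "openin X {x \<in> topspace X. f x \<noteq> None}"
    and cont: "continuous_map (subtopology X {x \<in> topspace X. f x \<noteq> None}) (Euclidean_space d) (\<lambda>x. the (f x))"
    and far: "\<And>r. openin X {x \<in> topspace X. f x \<in> far_points d r}"
  shows "continuous_map X (rep_sphere d) f"
proof -
  have *: "openin X {x \<in> topspace X. f x \<in> Some ` U}" if "openin (Euclidean_space d) U" for U
  proof -
    have "openin (subtopology X {x \<in> topspace X. f x \<noteq> None})
        {x \<in> topspace (subtopology X {x \<in> topspace X. f x \<noteq> None}). the (f x) \<in> U}"
      using cont that by (rule openin_continuous_map_preimage)
    then have "openin X {x \<in> topspace (subtopology X {x \<in> topspace X. f x \<noteq> None}). the (f x) \<in> U}"
      using fin by (simp add: openin_open_subtopology)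
    moreover have "{x \<in> topspace (subtopology X {x \<in> topspace X. f x \<noteq> None}). the (f x) \<in> U}
        = {x \<in> topspace X. f x \<in> Some ` U}"
      by (auto simp: image_iff)
    ultimately show ?thesis by simp
  qed
  have "openin X {x \<in> topspace X. f x \<in> U}" if U: "openin (rep_sphere d) U" for U
  proof (cases "None \<in> U")
    case False
    then obtain V where "openin (Euclidean_space d) V" "U = Some ` V"
      using U unfolding rep_sphere_def openin_Alexandroff_compactification by blast
    then show ?thesis using * by simp
  next
    case True
    then obtain C where C: "closedin (Euclidean_space d) C" "U = insert None (Some ` (topspace (Euclidean_space d) - C))"
      using U unfolding rep_sphere_def openin_Alexandroff_compactification by blast
    obtain r where r: "far_points d r \<subseteq> U"
      using openin_rep_sphere_at_infinity[OF U True] .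
    have "{x \<in> topspace X. f x \<in> U} = {x \<in> topspace X. f x \<in> far_points d r} \<union>
        {x \<in> topspace X. f x \<in> Some ` (topspace (Euclidean_space d) - C)}"
      using r C(2) by (auto simp: far_points_def)
    moreover have "openin (Euclidean_space d) (topspace (Euclidean_space d) - C)"
      using C(1) by auto
    ultimately show ?thesis using far * by (simp add: openin_Un)
  qed
  then show ?thesis using f unfolding continuous_map_def by blast
qed

section \<open>Concatenation of vectors and smash products of spheres\<close>

lemma vec_take_in: "vec_take d x \<in> topspace (Euclidean_space d)"
  by (auto simp: vec_take_def topspace_Euclidean_space)

lemma vec_drop_in:
  "x \<in> topspace (Euclidean_space (d + e)) \<Longrightarrow> vec_drop d x \<in> topspace (Euclidean_space e)"
  by (auto simp: vec_drop_def topspace_Euclidean_space)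

lemma vec_append_in:
  "y \<in> topspace (Euclidean_space e) \<Longrightarrow> vec_append d x y \<in> topspace (Euclidean_space (d + e))"
  by (auto simp: vec_append_def topspace_Euclidean_space)

lemma vec_append_take_drop: "vec_append d (vec_take d x) (vec_drop d x) = x"
  by (auto simp: vec_append_def vec_take_def vec_drop_def)

lemma vec_take_append: "x \<in> topspace (Euclidean_space d) \<Longrightarrow> vec_take d (vec_append d x y) = x"
  by (auto simp: vec_append_def vec_take_def topspace_Euclidean_space)

lemma vec_drop_append: "vec_drop d (vec_append d x y) = y"
  by (auto simp: vec_append_def vec_drop_def)

lemma norm_sq_append: "norm_sq (d + e) (vec_append d x y) = norm_sq d x + norm_sq e y"
  by (induction e) (auto simp: norm_sq_def vec_append_def)

lemma norm_sq_nonneg: "0 \<le> norm_sq d x"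
  by (simp add: norm_sq_def sum_nonneg)

lemma sphere_smash_None [simp]: "sphere_smash d v None = None" "sphere_smash d None w = None"
  by (auto simp: sphere_smash_def split: option.splits)

lemma sphere_smash_Some [simp]: "sphere_smash d (Some x) (Some y) = Some (vec_append d x y)"
  by (simp add: sphere_smash_def)

lemma sphere_smash_eq_None: "sphere_smash d v w = None \<longleftrightarrow> v = None \<or> w = None"
  by (auto simp: sphere_smash_def split: option.splits)

lemma sphere_smash_in:
  "v \<in> topspace (rep_sphere d) \<Longrightarrow> w \<in> topspace (rep_sphere e) \<Longrightarrow>
    sphere_smash d v w \<in> topspace (rep_sphere (d + e))"
  by (auto simp: topspace_rep_sphere vec_append_in)

lemma continuous_map_the_of_rep_sphere:
  assumes "continuous_map X (rep_sphere d) f" "\<And>x. x \<in> topspace X \<Longrightarrow> f x \<noteq> None"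
  shows "continuous_map X (Euclidean_space d) (\<lambda>x. the (f x))"
proof -
  have "continuous_map X (subtopology (rep_sphere d) (Some ` topspace (Euclidean_space d))) f"
    unfolding continuous_map_in_subtopology
  proof
    have "f x \<in> Some ` topspace (Euclidean_space d)" if "x \<in> topspace X" for x
      using that assms(2) continuous_map_image_subset_topspace[OF assms(1)] unfolding topspace_rep_sphere
      by blast
    then show "f \<in> topspace X \<rightarrow> Some ` topspace (Euclidean_space d)" by blast
  qed (rule assms(1))
  from continuous_map_compose[OF this continuous_map_the_rep_sphere] show ?thesis
    by (simp add: o_def)
qed

text \<open>Continuity at infinity comes from additivity of the squared norm under concatenation: if
  one factor is far out, so is the smash point. The remaining far points lie over the open part
  where both factors are finite.\<close>

lemma continuous_map_sphere_smash:
  "continuous_map (prod_topology (rep_sphere d) (rep_sphere e)) (rep_sphere (d + e))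
     (\<lambda>(v, w). sphere_smash d v w)"
proof (rule continuous_map_into_rep_sphere)
  let ?P = "prod_topology (rep_sphere d) (rep_sphere e)"
  let ?s = "\<lambda>(v, w). sphere_smash d v w"
  let ?F = "{z \<in> topspace ?P. ?s z \<noteq> None}"
  let ?E = "\<lambda>d. Some ` topspace (Euclidean_space d)"
  show "?s \<in> topspace ?P \<rightarrow> topspace (rep_sphere (d + e))"
    by (auto simp: sphere_smash_in)
  have F: "?F = ?E d \<times> ?E e"
    by (auto simp: topspace_rep_sphere)
  show openF: "openin ?P ?F"
    unfolding F by (simp add: openin_prod_Times_iff openin_finite_points)
  have c1: "continuous_map (subtopology ?P ?F) (Euclidean_space d) (\<lambda>z. the (fst z))"
    by (intro continuous_map_the_of_rep_sphere continuous_map_from_subtopology continuous_map_fst)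
       (auto simp: sphere_smash_def split: option.splits)
  have c2: "continuous_map (subtopology ?P ?F) (Euclidean_space e) (\<lambda>z. the (snd z))"
    by (intro continuous_map_the_of_rep_sphere continuous_map_from_subtopology continuous_map_snd)
       (auto simp: sphere_smash_def split: option.splits)
  have the_s: "the (?s z) = vec_append d (the (fst z)) (the (snd z))" if "z \<in> ?F" for z
    using that unfolding F by auto
  have cont: "continuous_map (subtopology ?P ?F) (Euclidean_space (d + e))
      (\<lambda>z. vec_append d (the (fst z)) (the (snd z)))"
  proof (rule continuous_map_into_Euclidean_space)
    fix i show "continuous_map (subtopology ?P ?F) euclideanreal
        (\<lambda>z. vec_append d (the (fst z)) (the (snd z)) i)"
      using continuous_map_compose[OF c1 continuous_map_coordinate]
        continuous_map_compose[OF c2 continuous_map_coordinate]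
      by (simp add: vec_append_def o_def)
  next
    fix z i assume z: "z \<in> topspace (subtopology ?P ?F)" and "d + e \<le> i"
    have "z \<in> ?F" using z by simp
    then have "vec_append d (the (fst z)) (the (snd z)) \<in> topspace (Euclidean_space (d + e))"
      unfolding F by (auto intro!: vec_append_in)
    then show "vec_append d (the (fst z)) (the (snd z)) i = 0"
      using \<open>d + e \<le> i\<close> by (simp add: topspace_Euclidean_space)
  qed
  show cont': "continuous_map (subtopology ?P ?F) (Euclidean_space (d + e)) (\<lambda>z. the (?s z))"
    by (rule continuous_map_eq[OF cont]) (use the_s in auto)
  fix r
  have ne: "{z \<in> topspace (subtopology ?P ?F). norm_sq (d + e) (the (?s z)) \<in> {r<..}}
      = {z \<in> ?F. r < norm_sq (d + e) (the (?s z))}"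
    by auto
  have "openin (subtopology ?P ?F) {z \<in> topspace (subtopology ?P ?F). norm_sq (d + e) (the (?s z)) \<in> {r<..}}"
    using continuous_map_compose[OF cont' continuous_map_norm_sq]
    by (intro openin_continuous_map_preimage[of _ euclideanreal]) (auto simp: o_def)
  then have fin: "openin ?P {z \<in> ?F. r < norm_sq (d + e) (the (?s z))}"
    unfolding ne using openF by (simp only: openin_open_subtopology)
  have "{z \<in> topspace ?P. ?s z \<in> far_points (d + e) r} =
      far_points d r \<times> topspace (rep_sphere e) \<union> topspace (rep_sphere d) \<times> far_points e r \<union>
      {z \<in> ?F. r < norm_sq (d + e) (the (?s z))}" (is "?L = ?R")
  proof -
    have "sphere_smash d v w \<in> far_points (d + e) r \<longleftrightarrow> v \<in> far_points d r \<or> w \<in> far_points e r \<or>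
        sphere_smash d v w \<noteq> None \<and> r < norm_sq (d + e) (the (sphere_smash d v w))"
      if vw: "v \<in> topspace (rep_sphere d)" "w \<in> topspace (rep_sphere e)" for v w
    proof (cases "v = None \<or> w = None")
      case True
      then have "sphere_smash d v w = None" "v \<in> far_points d r \<or> w \<in> far_points e r"
        using vw by (auto simp: sphere_smash_eq_None far_points_def)
      then show ?thesis by (auto simp: far_points_def)
    next
      case False
      then obtain x y where xy: "v = Some x" "w = Some y" by auto
      have "r < norm_sq d x + norm_sq e y" if "r < norm_sq d x \<or> r < norm_sq e y"
        using that norm_sq_nonneg[of d x] norm_sq_nonneg[of e y] by linarith
      then show ?thesis
        using sphere_smash_in[OF vw] unfolding xy by (auto simp: far_points_def norm_sq_append)
    qed
    then show ?thesis by (auto simp: far_points_def)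
  qed
  then show "openin ?P {z \<in> topspace ?P. ?s z \<in> far_points (d + e) r}"
    using fin openin_far_points by (auto simp: openin_prod_Times_iff intro!: openin_Un)
qed

lemma sphere_smash_surj:
  "(\<lambda>(v, w). sphere_smash d v w) ` topspace (prod_topology (rep_sphere d) (rep_sphere e))
    = topspace (rep_sphere (d + e))" (is "?f ` ?P = ?S")
proof
  show "?f ` ?P \<subseteq> ?S" by (auto simp: sphere_smash_in)
  have "v \<in> ?f ` ?P" if v: "v \<in> ?S" for v
  proof (cases v)
    case None
    then show ?thesis by (auto intro!: rev_image_eqI[of "(None, None)"])
  next
    case (Some x)
    then have "x \<in> topspace (Euclidean_space (d + e))"
      using v by (auto simp: topspace_rep_sphere)
    then show ?thesis
      using Some vec_take_in[of d x] vec_drop_in[of x d e]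
      by (auto intro!: rev_image_eqI[of "(Some (vec_take d x), Some (vec_drop d x))"]
          simp: vec_append_take_drop topspace_rep_sphere)
  qed
  then show "?S \<subseteq> ?f ` ?P" by blast
qed

section \<open>Orthogonal matrices\<close>

lemma orthogonal_group_carrier:
  "A \<in> carrier (orthogonal_group d) \<longleftrightarrow> (\<forall>i j. d \<le> i \<or> d \<le> j \<longrightarrow> A i j = 0) \<and>
     (\<forall>i<d. \<forall>j<d. (\<Sum>l<d. A l i * A l j) = (if i = j then 1 else 0))"
  by (simp add: orthogonal_group_def)

lemma orthogonal_vanishes:
  "A \<in> carrier (orthogonal_group d) \<Longrightarrow> d \<le> i \<or> d \<le> j \<Longrightarrow> A i j = 0"
  by (auto simp: orthogonal_group_carrier)

lemma mat_vec_mult: "mat_vec d (mat_mult d A B) x = mat_vec d A (mat_vec d B x)"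
proof
  fix i
  have "mat_vec d (mat_mult d A B) x i = (\<Sum>j<d. \<Sum>l<d. A i l * B l j * x j)"
    by (simp add: mat_vec_def mat_mult_def sum_distrib_right)
  also have "\<dots> = (\<Sum>l<d. \<Sum>j<d. A i l * B l j * x j)"
    by (rule sum.swap)
  also have "\<dots> = mat_vec d A (mat_vec d B x) i"
    by (simp add: mat_vec_def sum_distrib_left mult.assoc)
  finally show "mat_vec d (mat_mult d A B) x i = mat_vec d A (mat_vec d B x) i" .
qed

lemma mat_vec_id_nth: "mat_vec d (mat_id d) x i = (if i < d then x i else 0)"
proof -
  have "mat_vec d (mat_id d) x i = (\<Sum>j<d. if j = i then x j else 0)"
    unfolding mat_vec_def mat_id_def by (rule sum.cong) auto
  then show ?thesis by auto
qed

lemma mat_vec_id: "x \<in> topspace (Euclidean_space d) \<Longrightarrow> mat_vec d (mat_id d) x = x"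
  by (auto simp: mat_vec_id_nth topspace_Euclidean_space)

lemma mat_vec_in:
  "A \<in> carrier (orthogonal_group d) \<Longrightarrow> mat_vec d A x \<in> topspace (Euclidean_space d)"
  by (auto simp: mat_vec_def topspace_Euclidean_space orthogonal_vanishes)

text \<open>\<open>orthogonal_group\<close> asks for orthonormal columns, which makes the transpose
  a left inverse. Where an inverse on both sides matters, membership of the transpose is carried as
  a condition of its own.\<close>

definition mat_transpose :: "rmat \<Rightarrow> rmat" where
  "mat_transpose A = (\<lambda>i j. A j i)"

lemma mat_transpose_mult: "mat_transpose (mat_mult d A B) = mat_mult d (mat_transpose B) (mat_transpose A)"
  by (simp add: mat_transpose_def mat_mult_def mult.commute)

lemma mat_transpose_transpose [simp]: "mat_transpose (mat_transpose A) = A"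
  by (simp add: mat_transpose_def)

lemma mat_mult_transpose:
  "A \<in> carrier (orthogonal_group d) \<Longrightarrow> mat_mult d (mat_transpose A) A = mat_id d"
proof (intro ext)
  fix i j
  assume A: "A \<in> carrier (orthogonal_group d)"
  show "mat_mult d (mat_transpose A) A i j = mat_id d i j"
  proof (cases "i < d \<and> j < d")
    case True
    then show ?thesis
      using A by (auto simp: mat_mult_def mat_transpose_def mat_id_def orthogonal_group_carrier)
  next
    case False
    then show ?thesis
      using orthogonal_vanishes[OF A] by (auto simp: mat_mult_def mat_transpose_def mat_id_def not_less)
  qed
qed

lemma mat_mult_id_left:
  assumes "\<And>i j. d \<le> i \<Longrightarrow> A i j = 0"
  shows "mat_mult d (mat_id d) A = A"
proof (intro ext)
  fix i j
  have "mat_mult d (mat_id d) A i j = (\<Sum>l<d. if l = i then A l j else 0)"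
    unfolding mat_mult_def mat_id_def by (rule sum.cong) auto
  then show "mat_mult d (mat_id d) A i j = A i j"
    using assms by auto
qed

lemma mat_mult_assoc: "mat_mult d (mat_mult d A B) C = mat_mult d A (mat_mult d B C)"
proof (intro ext)
  fix i j
  show "mat_mult d (mat_mult d A B) C i j = mat_mult d A (mat_mult d B C) i j"
    using fun_cong[OF mat_vec_mult[of d A B "\<lambda>l. C l j"], of i]
    by (simp add: mat_mult_def mat_vec_def)
qed

lemma norm_sq_mat_vec:
  assumes "A \<in> carrier (orthogonal_group d)"
  shows "norm_sq d (mat_vec d A x) = norm_sq d x"
proof -
  have sq: "norm_sq d y = (\<Sum>i<d. y i * y i)" for y
    by (simp add: norm_sq_def power2_eq_square)
  have "norm_sq d (mat_vec d A x) = (\<Sum>i<d. \<Sum>j<d. (A i j * x j) * mat_vec d A x i)"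
    by (simp add: sq mat_vec_def sum_distrib_right)
  also have "\<dots> = (\<Sum>j<d. \<Sum>i<d. (A i j * x j) * mat_vec d A x i)"
    by (rule sum.swap)
  also have "\<dots> = (\<Sum>j<d. x j * mat_vec d (mat_transpose A) (mat_vec d A x) j)"
    unfolding mat_transpose_def mat_vec_def[of d "\<lambda>i j. A j i"] sum_distrib_left
    by (simp add: mult_ac)
  also have "mat_vec d (mat_transpose A) (mat_vec d A x) = mat_vec d (mat_id d) x"
    using mat_mult_transpose[OF assms] mat_vec_mult by metis
  also have "(\<Sum>j<d. x j * mat_vec d (mat_id d) x j) = norm_sq d x"
    unfolding sq by (simp add: mat_vec_id_nth)
  finally show ?thesis .
qed

lemma sphere_act_simps [simp]:
  "sphere_act d A None = None" "sphere_act d A (Some x) = Some (mat_vec d A x)"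
  by (auto simp: sphere_act_def)

lemma sphere_act_in:
  "A \<in> carrier (orthogonal_group d) \<Longrightarrow> sphere_act d A v \<in> topspace (rep_sphere d)"
  by (cases v) (auto simp: topspace_rep_sphere mat_vec_in)

lemma sphere_act_mult: "sphere_act d (mat_mult d A B) v = sphere_act d A (sphere_act d B v)"
  by (cases v) (auto simp: mat_vec_mult)

lemma sphere_act_id: "v \<in> topspace (rep_sphere d) \<Longrightarrow> sphere_act d (mat_id d) v = v"
  by (auto simp: topspace_rep_sphere mat_vec_id)

lemma topspace_orthogonal_topology [simp]:
  "topspace (orthogonal_topology d) = carrier (orthogonal_group d)"
  by (auto simp: orthogonal_topology_def)

lemma continuous_map_orthogonal_entry:
  "continuous_map (orthogonal_topology d) euclideanreal (\<lambda>A. A i j)"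
proof -
  have "continuous_map (product_topology (\<lambda>_. powertop_real UNIV) UNIV) euclideanreal ((\<lambda>r. r j) \<circ> (\<lambda>A. A i))"
    by (intro continuous_map_compose[of _ "powertop_real UNIV"] continuous_map_product_projection) auto
  then show ?thesis
    unfolding orthogonal_topology_def by (intro continuous_map_from_subtopology) (simp add: o_def)
qed

lemma continuous_map_into_orthogonal:
  assumes "\<And>x. x \<in> topspace X \<Longrightarrow> f x \<in> carrier (orthogonal_group d)"
    and "\<And>i j. continuous_map X euclideanreal (\<lambda>x. f x i j)"
  shows "continuous_map X (orthogonal_topology d) f"
  unfolding orthogonal_topology_def continuous_map_in_subtopology
  using assms by (auto simp: continuous_map_componentwise_UNIV)

text \<open>Orthogonal matrices preserve the norm, so far points correspond to far points uniformly
  in the matrix; this gives continuity at infinity jointly in \<open>A\<close> and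
  \<open>f\<close>.\<close>

lemma continuous_map_sphere_act:
  assumes A: "continuous_map X (orthogonal_topology d) A" and f: "continuous_map X (rep_sphere d) f"
  shows "continuous_map X (rep_sphere d) (\<lambda>x. sphere_act d (A x) (f x))"
proof (rule continuous_map_into_rep_sphere)
  have Ain: "A x \<in> carrier (orthogonal_group d)" if "x \<in> topspace X" for x
    using continuous_map_image_subset_topspace[OF A] that by auto
  have fin: "f x \<in> topspace (rep_sphere d)" if "x \<in> topspace X" for x
    using continuous_map_image_subset_topspace[OF f] that by auto
  show "(\<lambda>x. sphere_act d (A x) (f x)) \<in> topspace X \<rightarrow> topspace (rep_sphere d)"
    using Ain by (auto intro: sphere_act_in)
  have "{x \<in> topspace X. sphere_act d (A x) (f x) \<noteq> None}
      = {x \<in> topspace X. f x \<in> Some ` topspace (Euclidean_space d)}"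
    using fin by (fastforce simp: sphere_act_def topspace_rep_sphere)
  then show "openin X {x \<in> topspace X. sphere_act d (A x) (f x) \<noteq> None}"
    using openin_continuous_map_preimage[OF f openin_finite_points] by simp
  let ?F = "{x \<in> topspace X. sphere_act d (A x) (f x) \<noteq> None}"
  have cf: "continuous_map (subtopology X ?F) (Euclidean_space d) (\<lambda>x. the (f x))"
    by (intro continuous_map_the_of_rep_sphere continuous_map_from_subtopology f)
       (auto simp: sphere_act_def)
  have "continuous_map (subtopology X ?F) (Euclidean_space d) (\<lambda>x. mat_vec d (A x) (the (f x)))"
  proof (rule continuous_map_into_Euclidean_space)
    fix i
    have cA: "continuous_map (subtopology X ?F) euclideanreal (\<lambda>x. A x i j)" for j
      using continuous_map_compose[OF A continuous_map_orthogonal_entry]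
      by (intro continuous_map_from_subtopology) (simp add: o_def)
    have cfj: "continuous_map (subtopology X ?F) euclideanreal (\<lambda>x. the (f x) j)" for j
      using continuous_map_compose[OF cf continuous_map_coordinate] by (simp add: o_def)
    show "continuous_map (subtopology X ?F) euclideanreal (\<lambda>x. mat_vec d (A x) (the (f x)) i)"
      unfolding mat_vec_def by (intro continuous_map_sum continuous_map_real_mult cA cfj) auto
  next
    fix x i assume "x \<in> topspace (subtopology X ?F)" "d \<le> i"
    then show "mat_vec d (A x) (the (f x)) i = 0"
      using mat_vec_in[OF Ain, of x] by (auto simp: topspace_Euclidean_space)
  qed
  then show "continuous_map (subtopology X ?F) (Euclidean_space d) (\<lambda>x. the (sphere_act d (A x) (f x)))"
    by (rule continuous_map_eq) (auto simp: sphere_act_def option.map_sel)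
  fix r
  have "sphere_act d (A x) (f x) \<in> far_points d r \<longleftrightarrow> f x \<in> far_points d r" if "x \<in> topspace X" for x
    using fin[OF that] sphere_act_in[OF Ain[OF that], of "f x"] norm_sq_mat_vec[OF Ain[OF that]]
    by (cases "f x") (auto simp: far_points_def)
  then have "{x \<in> topspace X. sphere_act d (A x) (f x) \<in> far_points d r} = {x \<in> topspace X. f x \<in> far_points d r}"
    by auto
  then show "openin X {x \<in> topspace X. sphere_act d (A x) (f x) \<in> far_points d r}"
    using openin_continuous_map_preimage[OF f openin_far_points] by simp
qed

section \<open>Spectra\<close>

lemma orthogonal_spectrumD:
  assumes "orthogonal_spectrum X"
  shows base_pt_in: "base_pt X k \<in> topspace (level X k)"
    and orth_act_continuous:
      "continuous_map (prod_topology (orthogonal_topology k) (level X k)) (level X k) (\<lambda>(A, x). orth_act X k A x)"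
    and orth_act_base: "A \<in> carrier (orthogonal_group k) \<Longrightarrow> orth_act X k A (base_pt X k) = base_pt X k"
    and orth_act_id: "x \<in> topspace (level X k) \<Longrightarrow> orth_act X k (mat_id k) x = x"
    and orth_act_mult: "A \<in> carrier (orthogonal_group k) \<Longrightarrow> B \<in> carrier (orthogonal_group k) \<Longrightarrow>
        x \<in> topspace (level X k) \<Longrightarrow> orth_act X k (mat_mult k A B) x = orth_act X k A (orth_act X k B x)"
    and structure_map_continuous:
      "continuous_map (prod_topology (level X k) (rep_sphere m)) (level X (k + m)) (\<lambda>(x, v). structure_map X k m x v)"
    and structure_map_base:
      "v \<in> topspace (rep_sphere m) \<Longrightarrow> structure_map X k m (base_pt X k) v = base_pt X (k + m)"
    and structure_map_None: "x \<in> topspace (level X k) \<Longrightarrow> structure_map X k m x None = base_pt X (k + m)"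
    and structure_map_unit: "x \<in> topspace (level X k) \<Longrightarrow> structure_map X k 0 x (Some (\<lambda>_. 0)) = x"
    and structure_map_assoc: "x \<in> topspace (level X k) \<Longrightarrow> v \<in> topspace (rep_sphere l) \<Longrightarrow>
        w \<in> topspace (rep_sphere m) \<Longrightarrow> structure_map X k (l + m) x (sphere_smash l v w) =
          structure_map X (k + l) m (structure_map X k l x v) w"
    and structure_map_equivariant: "A \<in> carrier (orthogonal_group k) \<Longrightarrow> B \<in> carrier (orthogonal_group m) \<Longrightarrow>
        x \<in> topspace (level X k) \<Longrightarrow> v \<in> topspace (rep_sphere m) \<Longrightarrow>
        structure_map X k m (orth_act X k A x) (sphere_act m B v) =
          orth_act X (k + m) (mat_sum k A B) (structure_map X k m x v)"
  using assms unfolding orthogonal_spectrum_def by simp_all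

lemma structure_map_in:
  assumes "orthogonal_spectrum X" "x \<in> topspace (level X k)" "v \<in> topspace (rep_sphere m)"
  shows "structure_map X k m x v \<in> topspace (level X (k + m))"
  using continuous_map_image_subset_topspace[OF structure_map_continuous[OF assms(1), of k m]] assms(2,3) by auto

lemma orth_act_inverse:
  assumes "orthogonal_spectrum X" "A \<in> carrier (orthogonal_group k)" "mat_transpose A \<in> carrier (orthogonal_group k)"
    "x \<in> topspace (level X k)"
  shows "orth_act X k (mat_transpose A) (orth_act X k A x) = x"
    and "orth_act X k A (orth_act X k (mat_transpose A) x) = x"
  using orth_act_mult[OF assms(1) assms(3,2,4)] orth_act_mult[OF assms(1) assms(2,3,4)]
    mat_mult_transpose[OF assms(2)] mat_mult_transpose[OF assms(3)] orth_act_id[OF assms(1,4)]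
  by simp_all

lemma continuous_map_orth_act:
  assumes "orthogonal_spectrum X" "continuous_map Z (orthogonal_topology k) A" "continuous_map Z (level X k) f"
  shows "continuous_map Z (level X k) (\<lambda>z. orth_act X k (A z) (f z))"
proof -
  have "continuous_map Z (prod_topology (orthogonal_topology k) (level X k)) (\<lambda>z. (A z, f z))"
    using assms(2,3) by (simp add: continuous_map_pairedI)
  from continuous_map_compose[OF this orth_act_continuous[OF assms(1)]] show ?thesis
    by (simp add: o_def)
qed

lemma continuous_map_structure_map:
  assumes "orthogonal_spectrum X" "continuous_map Z (level X k) f" "continuous_map Z (rep_sphere m) v"
  shows "continuous_map Z (level X (k + m)) (\<lambda>z. structure_map X k m (f z) (v z))"
proof -
  have "continuous_map Z (prod_topology (level X k) (rep_sphere m)) (\<lambda>z. (f z, v z))"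
    using assms(2,3) by (simp add: continuous_map_pairedI)
  from continuous_map_compose[OF this structure_map_continuous[OF assms(1)]] show ?thesis
    by (simp add: o_def)
qed

lemma orthogonal_gspectrumD:
  assumes "orthogonal_gspectrum G X"
  shows gspectrum_spectrum: "orthogonal_spectrum X"
    and group_act_continuous: "g \<in> carrier G \<Longrightarrow> continuous_map (level X k) (level X k) (group_act X k g)"
    and group_act_base: "g \<in> carrier G \<Longrightarrow> group_act X k g (base_pt X k) = base_pt X k"
    and group_act_one: "x \<in> topspace (level X k) \<Longrightarrow> group_act X k \<one>\<^bsub>G\<^esub> x = x"
    and group_act_mult: "g \<in> carrier G \<Longrightarrow> h \<in> carrier G \<Longrightarrow> x \<in> topspace (level X k) \<Longrightarrow>
        group_act X k (g \<otimes>\<^bsub>G\<^esub> h) x = group_act X k g (group_act X k h x)"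
    and group_act_orth_act: "g \<in> carrier G \<Longrightarrow> A \<in> carrier (orthogonal_group k) \<Longrightarrow> x \<in> topspace (level X k) \<Longrightarrow>
        group_act X k g (orth_act X k A x) = orth_act X k A (group_act X k g x)"
    and group_act_structure_map: "g \<in> carrier G \<Longrightarrow> x \<in> topspace (level X k) \<Longrightarrow> v \<in> topspace (rep_sphere m) \<Longrightarrow>
        group_act X (k + m) g (structure_map X k m x v) = structure_map X k m (group_act X k g x) v"
  using assms unfolding orthogonal_gspectrum_def by simp_all

lemma group_act_in:
  assumes "orthogonal_gspectrum G X" "g \<in> carrier G" "x \<in> topspace (level X k)"
  shows "group_act X k g x \<in> topspace (level X k)"
  using continuous_map_image_subset_topspace[OF group_act_continuous[OF assms(1,2)]] assms(3) by auto

section \<open>Trivial actions, pullbacks, fixed points and function spectra\<close>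

lemma with_trivial_action_simps [simp]:
  "level (with_trivial_action Y) = level Y" "base_pt (with_trivial_action Y) = base_pt Y"
  "orth_act (with_trivial_action Y) = orth_act Y" "structure_map (with_trivial_action Y) = structure_map Y"
  "group_act (with_trivial_action Y) k g x = x"
  by (simp_all add: with_trivial_action_def spectrum.defs gspectrum.defs)

lemma orthogonal_spectrum_cong:
  assumes "level X = level Y" "base_pt X = base_pt Y" "orth_act X = orth_act Y"
    "structure_map X = structure_map Y"
  shows "orthogonal_spectrum X \<longleftrightarrow> orthogonal_spectrum Y"
  unfolding orthogonal_spectrum_def assms ..

lemma orthogonal_gspectrum_with_trivial_action:
  fixes Y :: "'a spectrum"
  assumes "orthogonal_spectrum Y"
  shows "orthogonal_gspectrum (singleton_group ()) (with_trivial_action Y)"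
proof -
  have "orthogonal_spectrum (with_trivial_action Y)"
    using assms orthogonal_spectrum_cong[of "with_trivial_action Y" Y] by simp
  moreover have "group_act (with_trivial_action Y) k g = (\<lambda>x. x)" for k g
    by (rule ext) simp
  ultimately show ?thesis
    unfolding orthogonal_gspectrum_def by simp
qed

lemma pullback_action_simps [simp]:
  "level (pullback_action \<phi> X) = level X" "base_pt (pullback_action \<phi> X) = base_pt X"
  "orth_act (pullback_action \<phi> X) = orth_act X" "structure_map (pullback_action \<phi> X) = structure_map X"
  "group_act (pullback_action \<phi> X) k h = group_act X k (\<phi> h)"
  by (simp_all add: pullback_action_def spectrum.defs gspectrum.defs)

lemma orthogonal_gspectrum_pullback_action:
  assumes X: "orthogonal_gspectrum G X" and \<phi>: "\<phi> \<in> hom H G" "\<phi> \<one>\<^bsub>H\<^esub> = \<one>\<^bsub>G\<^esub>"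
  shows "orthogonal_gspectrum H (pullback_action \<phi> X)"
proof -
  have "orthogonal_spectrum (pullback_action \<phi> X)"
    using gspectrum_spectrum[OF X] orthogonal_spectrum_cong[of "pullback_action \<phi> X" X] by simp
  moreover have "\<phi> h \<in> carrier G" if "h \<in> carrier H" for h
    using \<phi>(1) that by (rule hom_in_carrier)
  moreover have "\<phi> (g \<otimes>\<^bsub>H\<^esub> h) = \<phi> g \<otimes>\<^bsub>G\<^esub> \<phi> h" if "g \<in> carrier H" "h \<in> carrier H" for g h
    using \<phi>(1) that by (rule hom_mult)
  ultimately show ?thesis
    using X \<phi>(2) unfolding orthogonal_gspectrum_def by simp
qed

lemma fixed_point_spectrum_simps [simp]:
  "level (fixed_point_spectrum G X) k = subtopology (level X k) {x. \<forall>g \<in> carrier G. group_act X k g x = x}"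
  "base_pt (fixed_point_spectrum G X) = base_pt X" "orth_act (fixed_point_spectrum G X) = orth_act X"
  "structure_map (fixed_point_spectrum G X) = structure_map X"
  by (simp_all add: fixed_point_spectrum_def)

text \<open>The group action commutes with \<open>orth_act\<close> and with the structure maps, so
  both restrict to fixed points.\<close>

lemma orthogonal_spectrum_fixed_points:
  assumes "orthogonal_gspectrum G X"
  shows "orthogonal_spectrum (fixed_point_spectrum G X)"
proof -
  note X = gspectrum_spectrum[OF assms]
  let ?F = "\<lambda>k. {x. \<forall>g \<in> carrier G. group_act X k g x = x}"
  have o: "continuous_map (prod_topology (orthogonal_topology k) (subtopology (level X k) (?F k)))
      (subtopology (level X k) (?F k)) (\<lambda>(A, x). orth_act X k A x)" for k
  proof (rule continuous_map_into_subtopology)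
    show "continuous_map (prod_topology (orthogonal_topology k) (subtopology (level X k) (?F k))) (level X k)
        (\<lambda>(A, x). orth_act X k A x)"
      unfolding prod_topology_subtopology
      by (rule continuous_map_from_subtopology[OF orth_act_continuous[OF X]])
  qed (auto simp: group_act_orth_act[OF assms])
  have s: "continuous_map (prod_topology (subtopology (level X k) (?F k)) (rep_sphere m))
      (subtopology (level X (k + m)) (?F (k + m))) (\<lambda>(x, v). structure_map X k m x v)" for k m
  proof (rule continuous_map_into_subtopology)
    show "continuous_map (prod_topology (subtopology (level X k) (?F k)) (rep_sphere m)) (level X (k + m))
        (\<lambda>(x, v). structure_map X k m x v)"
      unfolding prod_topology_subtopology
      by (rule continuous_map_from_subtopology[OF structure_map_continuous[OF X]])
  qed (auto simp: group_act_structure_map[OF assms])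
  show ?thesis
    unfolding orthogonal_spectrum_def
    using o s orthogonal_spectrumD[OF X] group_act_base[OF assms] by simp
qed

lemma continuous_map_mapping_space_restrict:
  assumes "continuous_map (prod_topology X A) Y (\<lambda>(x, a). f x a)"
  shows "continuous_map X (mapping_space A Y) (\<lambda>x. \<lambda>a\<in>topspace A. f x a)"
proof (rule continuous_map_mapping_space_curry)
  show "continuous_map (prod_topology X A) Y (\<lambda>(x, a). (\<lambda>a\<in>topspace A. f x a) a)"
    by (rule continuous_map_eq[OF assms]) auto
qed auto

lemma continuous_map_mapping_space_apply:
  assumes "locally_compact_space A" "Hausdorff_space A"
    and "continuous_map Z (mapping_space A Y) p" "continuous_map Z A s"
  shows "continuous_map Z Y (\<lambda>z. p z (s z))"
proof -
  have "continuous_map Z (prod_topology (mapping_space A Y) A) (\<lambda>z. (p z, s z))"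
    using assms(3,4) by (simp add: continuous_map_pairedI)
  from continuous_map_compose[OF this continuous_map_mapping_space_eval[OF assms(1,2)]] show ?thesis
    by (simp add: o_def)
qed

lemma mapping_space_apply_in:
  "p \<in> topspace (mapping_space A Y) \<Longrightarrow> a \<in> topspace A \<Longrightarrow> p a \<in> topspace Y"
  by (auto simp: topspace_mapping_space continuous_map_def)

lemma mapping_space_eqI:
  "p \<in> topspace (mapping_space A Y) \<Longrightarrow> (\<And>a. a \<in> topspace A \<Longrightarrow> q a = p a) \<Longrightarrow>
    restrict q (topspace A) = p"
  by (auto simp: topspace_mapping_space extensional_def restrict_def)

lemma function_spectrum_simps [simp]:
  "level (function_spectrum G A \<alpha> X) k = mapping_space A (level X k)"
  "base_pt (function_spectrum G A \<alpha> X) k = (\<lambda>s\<in>topspace A. base_pt X k)"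
  "orth_act (function_spectrum G A \<alpha> X) k B p = (\<lambda>s\<in>topspace A. orth_act X k B (p s))"
  "structure_map (function_spectrum G A \<alpha> X) k m p v = (\<lambda>s\<in>topspace A. structure_map X k m (p s) v)"
  "group_act (function_spectrum G A \<alpha> X) k g p = (\<lambda>s\<in>topspace A. group_act X k g (p (\<alpha> (inv\<^bsub>G\<^esub> g) s)))"
  by (simp_all add: function_spectrum_def)

text \<open>Every operation acts pointwise; its continuity is obtained by evaluating, applying the
  operation of \<open>X\<close> and currying back. Evaluation is where local compactness of
  \<open>A\<close> enters.\<close>

lemma orthogonal_gspectrum_function_spectrum:
  assumes G: "group G" and X: "orthogonal_gspectrum G X"
    and A: "locally_compact_space A" "Hausdorff_space A"
    and \<alpha>: "\<And>g. g \<in> carrier G \<Longrightarrow> continuous_map A A (\<alpha> g)"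
    and \<alpha>1: "\<And>a. a \<in> topspace A \<Longrightarrow> \<alpha> \<one>\<^bsub>G\<^esub> a = a"
    and \<alpha>m: "\<And>g h a. g \<in> carrier G \<Longrightarrow> h \<in> carrier G \<Longrightarrow> a \<in> topspace A \<Longrightarrow> \<alpha> (g \<otimes>\<^bsub>G\<^esub> h) a = \<alpha> g (\<alpha> h a)"
  shows "orthogonal_gspectrum G (function_spectrum G A \<alpha> X)"
proof -
  interpret group G by (rule G)
  note S = gspectrum_spectrum[OF X]
  note D = orthogonal_spectrumD[OF S]
  note ev = continuous_map_mapping_space_apply[OF A]
  note ap = mapping_space_apply_in
  have \<alpha>in: "\<alpha> g a \<in> topspace A" if "g \<in> carrier G" "a \<in> topspace A" for g a
    using continuous_map_image_subset_topspace[OF \<alpha>[OF that(1)]] that(2) by auto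
  have fst_fst: "continuous_map (prod_topology (prod_topology P Q) R) P (\<lambda>z. fst (fst z))"
    and snd_fst: "continuous_map (prod_topology (prod_topology P Q) R) Q (\<lambda>z. snd (fst z))"
    for P :: "'p topology" and Q :: "'q topology" and R :: "'r topology"
    using continuous_map_compose[OF continuous_map_fst continuous_map_fst, of P Q R]
      continuous_map_compose[OF continuous_map_fst continuous_map_snd, of P Q R] by (simp_all add: o_def)
  have base: "(\<lambda>s\<in>topspace A. base_pt X k) \<in> topspace (mapping_space A (level X k))" for k
    by (auto simp: topspace_mapping_space base_pt_in[OF S] intro!: continuous_map_eq[of A _ "\<lambda>_. base_pt X k"])
  have o: "continuous_map (prod_topology (orthogonal_topology k) (mapping_space A (level X k)))
      (mapping_space A (level X k)) (\<lambda>(B, p). \<lambda>s\<in>topspace A. orth_act X k B (p s))" for k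
    unfolding case_prod_beta'
  proof (rule continuous_map_mapping_space_restrict)
    show "continuous_map (prod_topology (prod_topology (orthogonal_topology k) (mapping_space A (level X k))) A)
        (level X k) (\<lambda>(z, s). orth_act X k (fst z) (snd z s))"
      unfolding case_prod_beta'
      by (rule continuous_map_orth_act[OF S fst_fst ev[OF snd_fst continuous_map_snd]])
  qed
  have s: "continuous_map (prod_topology (mapping_space A (level X k)) (rep_sphere m))
      (mapping_space A (level X (k + m))) (\<lambda>(p, v). \<lambda>s\<in>topspace A. structure_map X k m (p s) v)" for k m
    unfolding case_prod_beta'
  proof (rule continuous_map_mapping_space_restrict)
    show "continuous_map (prod_topology (prod_topology (mapping_space A (level X k)) (rep_sphere m)) A)
        (level X (k + m)) (\<lambda>(z, s). structure_map X k m (fst z s) (snd z))"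
      unfolding case_prod_beta'
      by (rule continuous_map_structure_map[OF S ev[OF fst_fst continuous_map_snd] snd_fst])
  qed
  have g: "continuous_map (mapping_space A (level X k)) (mapping_space A (level X k))
      (\<lambda>p. \<lambda>s\<in>topspace A. group_act X k g (p (\<alpha> (inv\<^bsub>G\<^esub> g) s)))" if "g \<in> carrier G" for k g
  proof (rule continuous_map_mapping_space_restrict)
    have "continuous_map (prod_topology (mapping_space A (level X k)) A) (level X k)
        (\<lambda>z. fst z (\<alpha> (inv\<^bsub>G\<^esub> g) (snd z)))"
      by (rule ev[OF continuous_map_fst continuous_map_compose[OF continuous_map_snd \<alpha>, unfolded o_def]])
         (use that in simp)
    from continuous_map_compose[OF this group_act_continuous[OF X that]]
    show "continuous_map (prod_topology (mapping_space A (level X k)) A) (level X k)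
        (\<lambda>(p, s). group_act X k g (p (\<alpha> (inv\<^bsub>G\<^esub> g) s)))"
      by (simp add: o_def case_prod_beta')
  qed
  let ?F = "function_spectrum G A \<alpha> X"
  have "orthogonal_spectrum ?F"
    unfolding orthogonal_spectrum_def function_spectrum_simps
    by (intro conjI allI ballI base o s)
       (auto simp: orth_act_base[OF S] structure_map_base[OF S] structure_map_None[OF S]
          structure_map_unit[OF S] structure_map_assoc[OF S] structure_map_equivariant[OF S]
          orth_act_id[OF S] orth_act_mult[OF S] ap intro!: mapping_space_eqI restrict_ext)
  moreover have "\<forall>k. \<forall>g \<in> carrier G. \<forall>h \<in> carrier G. \<forall>p \<in> topspace (level ?F k).
      group_act ?F k (g \<otimes>\<^bsub>G\<^esub> h) p = group_act ?F k g (group_act ?F k h p)"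
    using \<alpha>in \<alpha>m by (auto simp: inv_mult_group group_act_mult[OF X] ap intro!: restrict_ext)
  ultimately show ?thesis
    unfolding orthogonal_gspectrum_def function_spectrum_simps
    using g \<alpha>in \<alpha>1
    by (auto simp: group_act_base[OF X] group_act_one[OF X] group_act_orth_act[OF X]
        group_act_structure_map[OF X] ap intro!: mapping_space_eqI restrict_ext)
qed

section \<open>Sums of representations\<close>

lemma fst_rep_sum [simp]: "fst (rep_sum V W) = fst V + fst W"
  by (simp add: rep_sum_def)

lemma snd_rep_sum [simp]: "snd (rep_sum V W) = (\<lambda>g. mat_sum (fst V) (snd V g) (snd W g))"
  by (simp add: rep_sum_def)

lemma trivial_rep_simps [simp]: "fst (trivial_rep d) = d" "snd (trivial_rep d) = (\<lambda>g. mat_id d)"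
  by (simp_all add: trivial_rep_def)

lemma fst_rep_multiple [simp]: "fst (rep_multiple m V) = m * fst V"
  by (induction m) auto

lemma fst_regular_rep [simp]: "fst (regular_rep G) = order G"
  by (simp add: regular_rep_def)

lemma rep_sum_assoc: "rep_sum (rep_sum U V) W = rep_sum U (rep_sum V W)"
  by (auto simp: rep_sum_def mat_sum_def fun_eq_iff)

lemma sum_lessThan_add:
  fixes f :: "nat \<Rightarrow> 'b::comm_monoid_add"
  shows "(\<Sum>l<d + e. f l) = (\<Sum>l<d. f l) + (\<Sum>l<e. f (d + l))"
  by (induction e) (auto simp: add.assoc)

lemma mat_sum_in:
  assumes A: "A \<in> carrier (orthogonal_group d)" and B: "B \<in> carrier (orthogonal_group e)"
  shows "mat_sum d A B \<in> carrier (orthogonal_group (d + e))"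
proof -
  have "(\<Sum>l<d + e. mat_sum d A B l i * mat_sum d A B l j) = (if i = j then 1 else 0)"
    if "i < d + e" "j < d + e" for i j
  proof -
    have "(\<Sum>l<d + e. mat_sum d A B l i * mat_sum d A B l j) =
        (if i < d \<and> j < d then \<Sum>l<d. A l i * A l j else 0) +
        (if d \<le> i \<and> d \<le> j then \<Sum>l<e. B l (i - d) * B l (j - d) else 0)"
      unfolding sum_lessThan_add by (auto simp: mat_sum_def intro!: sum.neutral)
    then show ?thesis
      using A B that by (auto simp: orthogonal_group_carrier)
  qed
  moreover have "mat_sum d A B i j = 0" if "d + e \<le> i \<or> d + e \<le> j" for i j
  proof -
    have "e \<le> i - d \<or> e \<le> j - d" using that by linarith
    then show ?thesis
      using that orthogonal_vanishes[OF B, of "i - d" "j - d"] by (auto simp: mat_sum_def)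
  qed
  ultimately show ?thesis by (simp add: orthogonal_group_carrier)
qed

lemma mat_id_in: "mat_id d \<in> carrier (orthogonal_group d)"
proof -
  have "(\<Sum>l<d. mat_id d l i * mat_id d l j) = (if i = j then 1 else 0)" if "i < d" "j < d" for i j
  proof -
    have "(\<Sum>l<d. mat_id d l i * mat_id d l j) = (\<Sum>l<d. if l = i then mat_id d l j else 0)"
      by (rule sum.cong) (auto simp: mat_id_def)
    then show ?thesis using that by (simp add: mat_id_def)
  qed
  then show ?thesis by (auto simp: orthogonal_group_carrier mat_id_def)
qed

lemma mat_vec_sum:
  "mat_vec (d + e) (mat_sum d A B) (vec_append d x y) = vec_append d (mat_vec d A x) (mat_vec e B y)"
  by (rule ext) (simp add: mat_vec_def sum_lessThan_add vec_append_def mat_sum_def)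

lemma sphere_act_smash:
  "sphere_act (d + e) (mat_sum d A B) (sphere_smash d v w) =
    sphere_smash d (sphere_act d A v) (sphere_act e B w)"
  by (cases v; cases w) (simp_all add: mat_vec_sum)

lemma sphere_smash_assoc:
  "sphere_smash (d + e) (sphere_smash d u v) w = sphere_smash d u (sphere_smash e v w)"
  by (cases u; cases v; cases w) (auto simp: vec_append_def fun_eq_iff)

lemma sphere_smash_cases:
  assumes "u \<in> topspace (rep_sphere (d + e))"
  obtains v w where "v \<in> topspace (rep_sphere d)" "w \<in> topspace (rep_sphere e)" "u = sphere_smash d v w"
  using assms unfolding sphere_smash_surj[symmetric] by auto

text \<open>Matrices are functions on all pairs of indices, and \<open>rep_sum\<close> keeps only
  the block of its left summand. Vanishing outside the block, for every \<open>g\<close> of the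
  type, makes \<open>rep_sum_trivial_0\<close> and its consequences true as equalities of
  functions.\<close>

definition rep_supported :: "'g rep \<Rightarrow> bool" where
  "rep_supported V \<longleftrightarrow> (\<forall>g i j. fst V \<le> i \<or> fst V \<le> j \<longrightarrow> snd V g i j = 0)"

lemma rep_sum_trivial_0: "rep_supported V \<Longrightarrow> rep_sum V (trivial_rep 0) = V"
  by (cases V) (auto simp: rep_supported_def rep_sum_def trivial_rep_def mat_sum_def mat_id_def fun_eq_iff not_less)

lemma rep_supported_sum: "rep_supported V \<Longrightarrow> rep_supported W \<Longrightarrow> rep_supported (rep_sum V W)"
  by (auto simp: rep_supported_def mat_sum_def)

lemma rep_supported_multiple: "rep_supported V \<Longrightarrow> rep_supported (rep_multiple m V)"
proof (induction m)
  case (Suc m)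
  then show ?case using rep_supported_sum by simp
qed (simp add: rep_supported_def mat_id_def)

lemma rep_supported_regular: "rep_supported (regular_rep G)"
  by (auto simp: rep_supported_def regular_rep_def)

lemma rep_multiple_add:
  "rep_supported V \<Longrightarrow> rep_multiple (m + j) V = rep_sum (rep_multiple m V) (rep_multiple j V)"
  by (induction j) (simp_all add: rep_sum_assoc rep_sum_trivial_0 rep_supported_multiple)

lemma rep_matrices_sum:
  "snd V \<in> S \<rightarrow> carrier (orthogonal_group (fst V)) \<Longrightarrow> snd W \<in> S \<rightarrow> carrier (orthogonal_group (fst W)) \<Longrightarrow>
    snd (rep_sum V W) \<in> S \<rightarrow> carrier (orthogonal_group (fst (rep_sum V W)))"
  by (auto intro!: mat_sum_in)

lemma rep_matrices_multiple:
  assumes "snd V \<in> S \<rightarrow> carrier (orthogonal_group (fst V))"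
  shows "snd (rep_multiple m V) \<in> S \<rightarrow> carrier (orthogonal_group (fst (rep_multiple m V)))"
proof (induction m)
  case (Suc m)
  then show ?case using rep_matrices_sum[OF Suc assms] by simp
qed (auto simp: mat_id_in)

lemma bij_betw_group_enum:
  assumes "finite (carrier G)"
  shows "bij_betw (group_enum G) {..<order G} (carrier G)"
proof -
  have "\<exists>e. bij_betw e {..<order G} (carrier G)"
    using ex_bij_betw_nat_finite[OF assms] by (simp add: order_def lessThan_atLeast0)
  then show ?thesis
    unfolding group_enum_def by (rule someI_ex)
qed

lemma regular_rep_in:
  assumes "group G" "finite (carrier G)"
  shows "snd (regular_rep G) \<in> carrier G \<rightarrow> carrier (orthogonal_group (fst (regular_rep G)))"
proof
  interpret group G by fact
  let ?e = "group_enum G" and ?n = "order G"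
  note e = bij_betw_group_enum[OF assms(2)]
  fix g assume g: "g \<in> carrier G"
  have "(\<Sum>l<?n. snd (regular_rep G) g l i * snd (regular_rep G) g l j) = (if i = j then 1 else 0)"
    if ij: "i < ?n" "j < ?n" for i j
  proof -
    have ec: "?e i \<in> carrier G" "?e j \<in> carrier G"
      using e ij by (auto simp: bij_betw_def)
    then have "g \<otimes>\<^bsub>G\<^esub> ?e i \<in> ?e ` {..<?n}"
      using e g by (auto simp: bij_betw_def)
    \<comment> \<open>\<open>l0\<close> is the row in which column \<open>i\<close> of the
      permutation matrix of \<open>g\<close> has its entry 1.\<close>
    then obtain l0 where l0: "l0 < ?n" "?e l0 = g \<otimes>\<^bsub>G\<^esub> ?e i" by force
    have "(\<Sum>l<?n. snd (regular_rep G) g l i * snd (regular_rep G) g l j) =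
        (\<Sum>l<?n. if l = l0 then if i = j then 1 else 0 else 0)"
    proof (rule sum.cong[OF refl])
      fix l assume l: "l \<in> {..<?n}"
      have 1: "?e l = g \<otimes>\<^bsub>G\<^esub> ?e i \<longleftrightarrow> l = l0"
        using e l l0 by (auto simp: bij_betw_def inj_on_def)
      have 2: "g \<otimes>\<^bsub>G\<^esub> ?e i = g \<otimes>\<^bsub>G\<^esub> ?e j \<longleftrightarrow> i = j"
        using e ij g ec by (auto simp: bij_betw_def inj_on_def)
      show "snd (regular_rep G) g l i * snd (regular_rep G) g l j = (if l = l0 then if i = j then 1 else 0 else 0)"
        using l ij 1 2 l0 by (auto simp: regular_rep_def)
    qed
    then show ?thesis using l0 by simp
  qed
  then show "snd (regular_rep G) g \<in> carrier (orthogonal_group (fst (regular_rep G)))"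
    using rep_supported_regular[of G] by (auto simp: orthogonal_group_carrier rep_supported_def)
qed

text \<open>Being a literal equality, this lets a stabilized map be a map at stage
  \<open>m + j\<close> without any identification of representations.\<close>

lemma stage_rep_add:
  "stage_rep G V (m + j) = rep_sum (stage_rep G V m) (rep_multiple j (regular_rep G))"
  by (simp add: rep_multiple_add rep_supported_regular rep_sum_assoc)

section \<open>Stabilization\<close>

text \<open>\<open>homotopic_with\<close> can be unfolded to an explicit homotopy only if the
  property depends on the values at points of the sphere alone.\<close>

lemma equivariant_pointed_cong:
  assumes "snd V \<in> carrier G \<rightarrow> carrier (orthogonal_group (fst V))"
    and "\<And>v. v \<in> topspace (rep_sphere (fst V)) \<Longrightarrow> f v = f' v"
  shows "equivariant_pointed G X V W f \<longleftrightarrow> equivariant_pointed G X V W f'"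
  using assms(2) sphere_act_in[OF funcset_mem[OF assms(1)]]
  unfolding equivariant_pointed_def by simp

lemma ghomotopic_iff:
  assumes "snd V \<in> carrier G \<rightarrow> carrier (orthogonal_group (fst V))"
  shows "ghomotopic G X V W f g \<longleftrightarrow>
    (\<exists>h. continuous_map (prod_topology (top_of_set {0..1::real}) (rep_sphere (fst V))) (level X (fst W)) h \<and>
      (\<forall>v\<in>topspace (rep_sphere (fst V)). h (0, v) = f v) \<and>
      (\<forall>v\<in>topspace (rep_sphere (fst V)). h (1, v) = g v) \<and>
      (\<forall>t\<in>{0..1}. equivariant_pointed G X V W (\<lambda>v. h (t, v))))"
  unfolding ghomotopic_def by (rule homotopic_with) (rule equivariant_pointed_cong[OF assms])

text \<open>Every point of the larger sphere is a smash of two points, and on these the case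
  distinction of \<open>stabilize\<close> disappears: base points are absorbed by pointedness of
  \<open>f\<close> and of the structure map. Later arguments use this formula in place of the
  definition.\<close>

lemma stabilize_smash:
  assumes "orthogonal_spectrum X" "f None = base_pt X e" "f v \<in> topspace (level X e)"
    "v \<in> topspace (rep_sphere d)" "w \<in> topspace (rep_sphere N)"
  shows "stabilize X d e N f (sphere_smash d v w) = structure_map X e N (f v) w"
proof (cases v)
  case None
  then show ?thesis
    using assms by (simp add: stabilize_def structure_map_base[OF assms(1)])
next
  case (Some x)
  then have x: "x \<in> topspace (Euclidean_space d)"
    using assms(4) by (auto simp: topspace_rep_sphere)
  show ?thesis
  proof (cases w)
    case None
    then show ?thesis
      using assms by (simp add: stabilize_def structure_map_None[OF assms(1)])
  next
    case (Some y)
    with \<open>v = Some x\<close> show ?thesis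
      by (simp add: stabilize_def vec_take_append[OF x] vec_drop_append)
  qed
qed

lemma stabilize_None [simp]: "stabilize X d e N f None = base_pt X (e + N)"
  by (simp add: stabilize_def)

lemma stabilize_in:
  assumes "orthogonal_spectrum X" "f None = base_pt X e"
    "\<And>v. v \<in> topspace (rep_sphere d) \<Longrightarrow> f v \<in> topspace (level X e)" "u \<in> topspace (rep_sphere (d + N))"
  shows "stabilize X d e N f u \<in> topspace (level X (e + N))"
proof -
  obtain v w where "v \<in> topspace (rep_sphere d)" "w \<in> topspace (rep_sphere N)" "u = sphere_smash d v w"
    using assms(4) by (rule sphere_smash_cases)
  then show ?thesis
    using stabilize_smash[of X f e, OF assms(1,2) assms(3)] structure_map_in[OF assms(1) assms(3)] by simp
qed

lemma stabilize_stabilize: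
  assumes X: "orthogonal_spectrum X" "f None = base_pt X e"
    "\<And>v. v \<in> topspace (rep_sphere d) \<Longrightarrow> f v \<in> topspace (level X e)"
    and u: "u \<in> topspace (rep_sphere (d + N + N'))"
  shows "stabilize X (d + N) (e + N) N' (stabilize X d e N f) u = stabilize X d e (N + N') f u"
proof -
  obtain v' w' where v': "v' \<in> topspace (rep_sphere (d + N))" "w' \<in> topspace (rep_sphere N')"
      "u = sphere_smash (d + N) v' w'"
    using u by (rule sphere_smash_cases)
  obtain v w where v: "v \<in> topspace (rep_sphere d)" "w \<in> topspace (rep_sphere N)" "v' = sphere_smash d v w"
    using v'(1) by (rule sphere_smash_cases)
  have "stabilize X (d + N) (e + N) N' (stabilize X d e N f) u
      = structure_map X (e + N) N' (stabilize X d e N f v') w'"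
    unfolding v'(3)
    by (rule stabilize_smash) (use X v' stabilize_in[of X f e d v' N] in auto)
  also have "\<dots> = structure_map X (e + N) N' (structure_map X e N (f v) w) w'"
    unfolding v(3) by (simp add: stabilize_smash[of X f e, OF X(1,2) X(3)[OF v(1)] v(1,2)])
  also have "\<dots> = structure_map X e (N + N') (f v) (sphere_smash N w w')"
    by (rule structure_map_assoc[OF X(1) X(3)[OF v(1)] v(2) v'(2), symmetric])
  also have "\<dots> = stabilize X d e (N + N') f (sphere_smash d v (sphere_smash N w w'))"
    by (rule stabilize_smash[of X f e, OF X(1,2) X(3)[OF v(1)] v(1) sphere_smash_in[OF v(2) v'(2)], symmetric])
  also have "sphere_smash d v (sphere_smash N w w') = u"
    unfolding v'(3) v(3) by (rule sphere_smash_assoc[symmetric])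
  finally show ?thesis .
qed

lemma stabilize_0:
  assumes X: "orthogonal_spectrum X" "f None = base_pt X e"
    "\<And>v. v \<in> topspace (rep_sphere d) \<Longrightarrow> f v \<in> topspace (level X e)"
    and u: "u \<in> topspace (rep_sphere d)"
  shows "stabilize X d e 0 f u = f u"
proof (cases u)
  case None
  then show ?thesis using X(2) by (simp add: stabilize_def)
next
  case (Some x)
  then have "\<forall>i\<ge>d. x i = 0" using u by (simp add: Some_in_rep_sphere)
  then have "vec_take d x = x" "vec_drop d x = (\<lambda>_. 0)"
    by (auto simp: vec_take_def vec_drop_def fun_eq_iff not_less)
  then show ?thesis
    using Some u X structure_map_unit[OF X(1)] by (simp add: stabilize_def)
qed

lemma stabilize_cong:
  assumes "\<And>v. v \<in> topspace (rep_sphere d) \<Longrightarrow> f v = f' v"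
  shows "stabilize X d e N f u = stabilize X d e N f' u"
proof -
  have "f (Some (vec_take d x)) = f' (Some (vec_take d x))" for x
    using vec_take_in by (intro assms) (auto simp: topspace_rep_sphere)
  then show ?thesis by (simp add: stabilize_def split: option.split)
qed

lemma stabilize_equivariant:
  assumes X: "orthogonal_gspectrum G X"
    and R: "snd R \<in> carrier G \<rightarrow> carrier (orthogonal_group (fst R))"
    and V: "snd V \<in> carrier G \<rightarrow> carrier (orthogonal_group (fst V))"
    and W: "snd W \<in> carrier G \<rightarrow> carrier (orthogonal_group (fst W))"
    and f: "equivariant_pointed G X V W f"
      "\<And>v. v \<in> topspace (rep_sphere (fst V)) \<Longrightarrow> f v \<in> topspace (level X (fst W))"
  shows "equivariant_pointed G X (rep_sum V R) (rep_sum W R) (stabilize X (fst V) (fst W) (fst R) f)"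
  unfolding equivariant_pointed_def
proof (intro conjI ballI)
  note S = gspectrum_spectrum[OF X]
  let ?st = "stabilize X (fst V) (fst W) (fst R) f"
  have f0: "f None = base_pt X (fst W)" using f(1) by (simp add: equivariant_pointed_def)
  show "?st None = base_pt X (fst (rep_sum W R))" by simp
  fix g u assume g: "g \<in> carrier G" and "u \<in> topspace (rep_sphere (fst (rep_sum V R)))"
  then obtain v w where vw: "v \<in> topspace (rep_sphere (fst V))" "w \<in> topspace (rep_sphere (fst R))"
      "u = sphere_smash (fst V) v w"
    by (auto elim: sphere_smash_cases)
  note Rg = funcset_mem[OF R g] and Vg = funcset_mem[OF V g] and Wg = funcset_mem[OF W g]
  have "?st (sphere_act (fst (rep_sum V R)) (snd (rep_sum V R) g) u)
      = ?st (sphere_smash (fst V) (sphere_act (fst V) (snd V g) v) (sphere_act (fst R) (snd R g) w))"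
    by (simp add: vw(3) sphere_act_smash)
  also have "\<dots> = structure_map X (fst W) (fst R) (f (sphere_act (fst V) (snd V g) v)) (sphere_act (fst R) (snd R g) w)"
    by (rule stabilize_smash[of X f, OF S f0 f(2)[OF sphere_act_in[OF Vg]] sphere_act_in[OF Vg] sphere_act_in[OF Rg]])
  also have "f (sphere_act (fst V) (snd V g) v) = orth_act X (fst W) (snd W g) (group_act X (fst W) g (f v))"
    using f(1) g vw(1) by (simp add: equivariant_pointed_def)
  also have "structure_map X (fst W) (fst R) \<dots> (sphere_act (fst R) (snd R g) w) =
      orth_act X (fst W + fst R) (mat_sum (fst W) (snd W g) (snd R g))
        (structure_map X (fst W) (fst R) (group_act X (fst W) g (f v)) w)"
    by (rule structure_map_equivariant[OF S Wg Rg group_act_in[OF X g f(2)[OF vw(1)]] vw(2)])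
  also have "structure_map X (fst W) (fst R) (group_act X (fst W) g (f v)) w =
      group_act X (fst W + fst R) g (structure_map X (fst W) (fst R) (f v) w)"
    by (rule group_act_structure_map[OF X g f(2)[OF vw(1)] vw(2), symmetric])
  also have "structure_map X (fst W) (fst R) (f v) w = ?st u"
    unfolding vw(3) by (rule stabilize_smash[of X f, OF S f0 f(2)[OF vw(1)] vw(1,2), symmetric])
  finally show "?st (sphere_act (fst (rep_sum V R)) (snd (rep_sum V R) g) u) =
      orth_act X (fst (rep_sum W R)) (snd (rep_sum W R) g) (group_act X (fst (rep_sum W R)) g (?st u))"
    by simp
qed

lemma ghomotopic_stabilize:
  assumes X: "orthogonal_gspectrum G X"
    and R: "snd R \<in> carrier G \<rightarrow> carrier (orthogonal_group (fst R))"
    and V: "snd V \<in> carrier G \<rightarrow> carrier (orthogonal_group (fst V))"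
    and W: "snd W \<in> carrier G \<rightarrow> carrier (orthogonal_group (fst W))"
    and "ghomotopic G X V W f g"
  shows "ghomotopic G X (rep_sum V R) (rep_sum W R)
    (stabilize X (fst V) (fst W) (fst R) f) (stabilize X (fst V) (fst W) (fst R) g)"
proof -
  let ?d = "fst V" and ?e = "fst W" and ?N = "fst R" and ?I = "top_of_set {0..1::real}"
  note S = gspectrum_spectrum[OF X]
  obtain h where h: "continuous_map (prod_topology ?I (rep_sphere ?d)) (level X ?e) h"
      "\<And>v. v\<in>topspace (rep_sphere ?d) \<Longrightarrow> h (0, v) = f v"
      "\<And>v. v\<in>topspace (rep_sphere ?d) \<Longrightarrow> h (1, v) = g v"
      "\<And>t. t\<in>{0..1} \<Longrightarrow> equivariant_pointed G X V W (\<lambda>v. h (t, v))"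
    using assms(5) unfolding ghomotopic_iff[OF V] by auto
  have hin: "h (t, v) \<in> topspace (level X ?e)" if "t \<in> {0..1}" "v \<in> topspace (rep_sphere ?d)" for t v
    using continuous_map_image_subset_topspace[OF h(1)] that by auto
  have h0: "h (t, None) = base_pt X ?e" if "t \<in> {0..1}" for t
    using h(4)[OF that] by (simp add: equivariant_pointed_def)
  let ?h = "\<lambda>(t, u). stabilize X ?d ?e ?N (\<lambda>v. h (t, v)) u"
  have cont: "continuous_map (prod_topology ?I (rep_sphere (?d + ?N))) (level X (?e + ?N)) ?h"
  \<comment> \<open>On the product of the two spheres the map is built from \<open>h\<close> and a
    structure map, hence continuous; it is then pushed down along the smash quotient, crossed with
    the interval.\<close>
  proof (rule continuous_map_prod_descend[OF _ Hausdorff_rep_sphere continuous_map_sphere_smash sphere_smash_surj])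
    let ?Z = "prod_topology ?I (prod_topology (rep_sphere ?d) (rep_sphere ?N))"
    have c1: "continuous_map ?Z (rep_sphere ?d) (\<lambda>z. fst (snd z))"
      and c2: "continuous_map ?Z (rep_sphere ?N) (\<lambda>z. snd (snd z))"
      using continuous_map_compose[OF continuous_map_snd continuous_map_fst, of ?I "rep_sphere ?d" "rep_sphere ?N"]
        continuous_map_compose[OF continuous_map_snd continuous_map_snd, of ?I "rep_sphere ?d" "rep_sphere ?N"]
      by (simp_all add: o_def)
    have "continuous_map ?Z (level X ?e) (\<lambda>z. h (fst z, fst (snd z)))"
      using continuous_map_compose[OF continuous_map_pairedI[OF continuous_map_fst c1] h(1)] by (simp add: o_def)
    from continuous_map_structure_map[OF S this c2]
    show "continuous_map ?Z (level X (?e + ?N))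
        (\<lambda>(t, k). ?h (t, case k of (v, w) \<Rightarrow> sphere_smash ?d v w))"
      by (rule continuous_map_eq) (auto simp: stabilize_smash[OF S] h0 hin)
  qed (simp add: compact_space_prod_topology compact_rep_sphere)
  have VR: "snd (rep_sum V R) \<in> carrier G \<rightarrow> carrier (orthogonal_group (fst (rep_sum V R)))"
    using V R by (rule rep_matrices_sum)
  show ?thesis
    unfolding ghomotopic_iff[OF VR]
  proof (intro exI[of _ ?h] conjI ballI)
    show "continuous_map (prod_topology ?I (rep_sphere (fst (rep_sum V R)))) (level X (fst (rep_sum W R))) ?h"
      using cont by simp
    fix t :: real assume t: "t \<in> {0..1}"
    show "equivariant_pointed G X (rep_sum V R) (rep_sum W R) (\<lambda>v. ?h (t, v))"
      using stabilize_equivariant[OF X R V W h(4)[OF t] hin[OF t]] by simp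
  qed (use stabilize_cong[OF h(2)] stabilize_cong[OF h(3)] in auto)
qed

section \<open>Homotopy groups as quotients\<close>

locale RO_graded = group G for G :: "('g, 'b) monoid_scheme" (structure) +
  fixes X :: "('g, 'a) gspectrum" and V :: "'g virtual_rep"
  assumes finite_carrier: "finite (carrier G)"
    and gspectrum: "orthogonal_gspectrum G X"
    and fst_rep: "snd (fst V) \<in> carrier G \<rightarrow> carrier (orthogonal_group (fst (fst V)))"
    and snd_rep: "snd (snd V) \<in> carrier G \<rightarrow> carrier (orthogonal_group (fst (snd V)))"
begin

abbreviation "src m \<equiv> stage_rep G (fst V) m"
abbreviation "tgt m \<equiv> stage_rep G (snd V) m"
abbreviation "stage_homotopic m \<equiv> ghomotopic G X (src m) (tgt m)"
abbreviation "stab m j \<equiv> stabilize X (fst (src m)) (fst (tgt m)) (j * order G)"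
abbreviation "pinch m \<equiv> pinch_sum (fst (fst V)) (order G) (base_pt X (fst (tgt m)))"
abbreviation "rel \<equiv> stably_homotopic G V X"

text \<open>Records what the algebra of stabilization uses, leaving aside continuity and
  equivariance. Pinch sums visibly inherit it, so that arbitrary pointed functions can serve as
  representatives later.\<close>

definition stage_pointed :: "nat \<Rightarrow> (sphere_pt \<Rightarrow> 'a) \<Rightarrow> bool" where
  "stage_pointed m f \<longleftrightarrow> f None = base_pt X (fst (tgt m)) \<and>
     (\<forall>v\<in>topspace (rep_sphere (fst (src m))). f v \<in> topspace (level X (fst (tgt m))))"

lemmas spectrum = gspectrum_spectrum[OF gspectrum]

lemma regular_multiple:
  "snd (rep_multiple j (regular_rep G)) \<in> carrier G \<rightarrow> carrier (orthogonal_group (fst (rep_multiple j (regular_rep G))))"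
  by (rule rep_matrices_multiple[OF regular_rep_in[OF is_group finite_carrier]])

lemma src_matrices: "snd (src m) \<in> carrier G \<rightarrow> carrier (orthogonal_group (fst (src m)))"
  by (rule rep_matrices_sum[OF fst_rep regular_multiple])

lemma tgt_matrices: "snd (tgt m) \<in> carrier G \<rightarrow> carrier (orthogonal_group (fst (tgt m)))"
  by (rule rep_matrices_sum[OF snd_rep regular_multiple])

lemma dim_add:
  "fst (stage_rep G W (m + j)) = fst (stage_rep G W m) + j * order G"
  by (simp add: algebra_simps)

lemma stage_homotopic_cong:
  assumes "\<And>v. v \<in> topspace (rep_sphere (fst (src m))) \<Longrightarrow> f v = f' v"
    "\<And>v. v \<in> topspace (rep_sphere (fst (src m))) \<Longrightarrow> g v = g' v"
  shows "stage_homotopic m f g \<longleftrightarrow> stage_homotopic m f' g'"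
  unfolding ghomotopic_iff[OF src_matrices] using assms by simp

lemma stage_homotopic_sym: "stage_homotopic m f g \<Longrightarrow> stage_homotopic m g f"
  unfolding ghomotopic_def by (rule homotopic_with_symD)

lemma stage_homotopic_trans: "stage_homotopic m f g \<Longrightarrow> stage_homotopic m g h \<Longrightarrow> stage_homotopic m f h"
  unfolding ghomotopic_def by (rule homotopic_with_trans)

text \<open>Homotopic to itself means continuous and equivariant, so each statement about homotopies
  specializes to one about membership.\<close>

lemma stable_maps_iff: "(m, f) \<in> stable_maps G V X \<longleftrightarrow> stage_homotopic m f f"
  by (simp add: stable_maps_def gmaps_def ghomotopic_def)

lemma stable_maps_pointed: "(m, f) \<in> stable_maps G V X \<Longrightarrow> stage_pointed m f"
  by (auto simp: stable_maps_def gmaps_def equivariant_pointed_def stage_pointed_def continuous_map_def)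

lemma stable_maps_cong:
  assumes "\<And>v. v \<in> topspace (rep_sphere (fst (src m))) \<Longrightarrow> f v = f' v"
  shows "(m, f) \<in> stable_maps G V X \<longleftrightarrow> (m, f') \<in> stable_maps G V X"
  unfolding stable_maps_iff by (rule stage_homotopic_cong) (use assms in auto)

lemma stage_homotopic_stab:
  assumes "stage_homotopic m f g"
  shows "stage_homotopic (m + j) (stab m j f) (stab m j g)"
  using ghomotopic_stabilize[OF gspectrum regular_multiple[of j] src_matrices tgt_matrices assms]
  unfolding stage_rep_add by simp

lemma stab_stable: "(m, f) \<in> stable_maps G V X \<Longrightarrow> (m + j, stab m j f) \<in> stable_maps G V X"
  unfolding stable_maps_iff by (rule stage_homotopic_stab)

lemma stab_pointed:
  assumes "stage_pointed m f"
  shows "stage_pointed (m + j) (stab m j f)"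
  using assms stabilize_in[OF spectrum, of f "fst (tgt m)" "fst (src m)" _ "j * order G"]
  unfolding stage_pointed_def dim_add by auto

lemma stab_stab:
  assumes "stage_pointed m f" "v \<in> topspace (rep_sphere (fst (src (m + j + i))))"
  shows "stab (m + j) i (stab m j f) v = stab m (j + i) f v"
  using assms stabilize_stabilize[OF spectrum, of f "fst (tgt m)" "fst (src m)" v "j * order G" "i * order G"]
  unfolding stage_pointed_def dim_add by (simp add: algebra_simps)

lemma stab_0:
  assumes "stage_pointed m f" "v \<in> topspace (rep_sphere (fst (src m)))"
  shows "stab m 0 f v = f v"
  using assms stabilize_0[OF spectrum, of f "fst (tgt m)" "fst (src m)" v]
  unfolding stage_pointed_def by simp

lemma rel_iff:
  "((m, f), (m', f')) \<in> rel \<longleftrightarrow> (m, f) \<in> stable_maps G V X \<and> (m', f') \<in> stable_maps G V X \<and>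
    (\<exists>j j'. m + j = m' + j' \<and> stage_homotopic (m + j) (stab m j f) (stab m' j' f'))"
  by (simp add: stably_homotopic_def)

lemma stage_homotopic_stab_add:
  assumes "stage_pointed m f" "stage_pointed m' f'" "m + j = m' + j'"
    and "stage_homotopic (m + j) (stab m j f) (stab m' j' f')"
  shows "stage_homotopic (m + (j + i)) (stab m (j + i) f) (stab m' (j' + i) f')"
proof -
  have "stage_homotopic (m + j + i) (stab (m + j) i (stab m j f)) (stab (m' + j') i (stab m' j' f'))"
    using stage_homotopic_stab[OF assms(4), of i] assms(3) by simp
  then have "stage_homotopic (m + j + i) (stab m (j + i) f) (stab m' (j' + i) f')"
    using stage_homotopic_cong[of "m + j + i" "stab (m + j) i (stab m j f)" "stab m (j + i) f"
        "stab (m' + j') i (stab m' j' f')" "stab m' (j' + i) f'"]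
      stab_stab[OF assms(1)] stab_stab[OF assms(2), of _ j'] assms(3) by metis
  then show ?thesis by (simp add: add.assoc)
qed

lemma stage_homotopic_rel:
  assumes "stage_homotopic m f g"
  shows "((m, f), (m, g)) \<in> rel"
proof -
  have st: "(m, f) \<in> stable_maps G V X" "(m, g) \<in> stable_maps G V X"
    unfolding stable_maps_iff using assms stage_homotopic_sym stage_homotopic_trans by blast+
  moreover have "stage_homotopic (m + 0) (stab m 0 f) (stab m 0 g)"
    by (rule stage_homotopic_stab[OF assms])
  ultimately show ?thesis unfolding rel_iff by blast
qed

lemma equiv_rel: "equiv (stable_maps G V X) rel"
proof (rule equivI)
  show "rel \<subseteq> stable_maps G V X \<times> stable_maps G V X"
    by (auto simp: stably_homotopic_def)
  show "refl_on (stable_maps G V X) rel"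
    by (auto intro!: refl_onI stage_homotopic_rel simp: stable_maps_iff)
  show "sym rel"
  proof (rule symI)
    fix x y assume "(x, y) \<in> rel"
    then show "(y, x) \<in> rel"
      by (cases x; cases y) (auto simp: rel_iff intro: stage_homotopic_sym, metis stage_homotopic_sym)
  qed
  show "trans rel"
  proof (rule transI)
    fix x y z assume xy: "(x, y) \<in> rel" and yz: "(y, z) \<in> rel"
    obtain m f m' f' m'' f'' where e: "x = (m, f)" "y = (m', f')" "z = (m'', f'')"
      by (cases x; cases y; cases z)
    obtain j j' where 1: "m + j = m' + j'" "stage_homotopic (m + j) (stab m j f) (stab m' j' f')"
      using xy unfolding e rel_iff by blast
    obtain i' i'' where 2: "m' + i' = m'' + i''" "stage_homotopic (m' + i') (stab m' i' f') (stab m'' i'' f'')"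
      using yz unfolding e rel_iff by blast
    have st: "(m, f) \<in> stable_maps G V X" "(m', f') \<in> stable_maps G V X" "(m'', f'') \<in> stable_maps G V X"
      using xy yz unfolding e rel_iff by auto
    note p = st[THEN stable_maps_pointed]
    \<comment> \<open>Each homotopy is stabilized further by the amount that the other one spends on
      \<open>f'\<close>; both middle terms are then \<open>f'\<close> stabilized by
      \<open>i' + j'\<close>.\<close>
    have "stage_homotopic (m + (j + i')) (stab m (j + i') f) (stab m' (j' + i') f')"
      by (rule stage_homotopic_stab_add[OF p(1,2) 1])
    moreover have "stage_homotopic (m' + (i' + j')) (stab m' (i' + j') f') (stab m'' (i'' + j') f'')"
      by (rule stage_homotopic_stab_add[OF p(2,3) 2])
    moreover have "m' + (i' + j') = m + (j + i')" "m + (j + i') = m'' + (i'' + j')"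
      using 1(1) 2(1) by linarith+
    ultimately have "stage_homotopic (m + (j + i')) (stab m (j + i') f) (stab m'' (i'' + j') f'')"
      by (metis add.commute stage_homotopic_trans)
    then show "(x, z) \<in> rel"
      using st \<open>m + (j + i') = m'' + (i'' + j')\<close> unfolding e rel_iff by blast
  qed
qed

lemma rel_sym: "(x, y) \<in> rel \<Longrightarrow> (y, x) \<in> rel"
  using equiv_rel unfolding equiv_def by (blast dest: symD)

lemma rel_stab:
  assumes "(m, f) \<in> stable_maps G V X"
  shows "((m, f), (m + j, stab m j f)) \<in> rel"
proof -
  have "stage_homotopic (m + j) (stab m j f) (stab (m + j) 0 (stab m j f))"
    using stab_stable[OF assms, of j] stab_0[OF stab_pointed[OF stable_maps_pointed[OF assms]]]
      stage_homotopic_cong[of "m + j" "stab m j f" "stab m j f" "stab m j f" "stab (m + j) 0 (stab m j f)"]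
    unfolding stable_maps_iff by metis
  then show ?thesis
    unfolding rel_iff using assms stab_stable[OF assms] by (metis add_0_right)
qed

text \<open>If \<open>f\<close> is not a stable map then neither is \<open>f'\<close>, and both
  classes are empty.\<close>

lemma rel_cong:
  assumes "\<And>v. v \<in> topspace (rep_sphere (fst (src m))) \<Longrightarrow> f v = f' v"
  shows "rel `` {(m, f)} = rel `` {(m, f')}"
proof (cases "(m, f) \<in> stable_maps G V X")
  case True
  then have "stage_homotopic m f f'"
    unfolding stable_maps_iff using stage_homotopic_cong[of m f f f f'] assms by blast
  then show ?thesis
    using equiv_class_eq[OF equiv_rel stage_homotopic_rel] by blast
next
  case False
  then have "(m, f') \<notin> stable_maps G V X"
    using stable_maps_cong[of m f f'] assms by blast
  with False show ?thesis by (auto simp: rel_iff)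
qed

text \<open>Stably homotopic maps become homotopic at every large stage, so the relation may be
  tested along any cofinal sequence of stages; below these are the stages at which frames are
  constructed.\<close>

lemma rel_iff_eventually:
  assumes "(m, f) \<in> stable_maps G V X" "(m', f') \<in> stable_maps G V X"
  shows "((m, f), (m', f')) \<in> rel \<longleftrightarrow>
    (\<exists>N. \<forall>L\<ge>N. m \<le> L \<and> m' \<le> L \<and> stage_homotopic L (stab m (L - m) f) (stab m' (L - m') f'))"
    (is "_ \<longleftrightarrow> ?R")
proof
  assume "((m, f), (m', f')) \<in> rel"
  then obtain j j' where j: "m + j = m' + j'" "stage_homotopic (m + j) (stab m j f) (stab m' j' f')"
    unfolding rel_iff by blast
  have "m \<le> L \<and> m' \<le> L \<and> stage_homotopic L (stab m (L - m) f) (stab m' (L - m') f')" if "m + j \<le> L" for L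
  proof -
    have "m + (j + (L - (m + j))) = L" "j + (L - (m + j)) = L - m" "j' + (L - (m + j)) = L - m'"
      using that j(1) by linarith+
    then show ?thesis
      using stage_homotopic_stab_add[OF assms[THEN stable_maps_pointed] j, of "L - (m + j)"] that j(1) by simp
  qed
  then show ?R by blast
next
  assume ?R
  then obtain L where "m \<le> L" "m' \<le> L" "stage_homotopic L (stab m (L - m) f) (stab m' (L - m') f')" by blast
  then have "m + (L - m) = m' + (L - m') \<and> stage_homotopic (m + (L - m)) (stab m (L - m) f) (stab m' (L - m') f')"
    by simp
  then show "((m, f), (m', f')) \<in> rel"
    unfolding rel_iff using assms by blast
qed

section \<open>Pinch sums\<close>

lemma summand_in_range:
  assumes "1 \<le> m"
  shows "fst (fst V) + order G \<le> fst (src m)"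
  using assms mult_le_mono1[of 1 m "order G"] by simp

lemma shifted_in_sphere:
  assumes "1 \<le> m" "Some x \<in> topspace (rep_sphere (fst (src m)))"
  shows "Some (\<lambda>i. if i \<in> {fst (fst V)..<fst (fst V) + order G} then x i - c else x i) \<in> topspace (rep_sphere (fst (src m)))"
proof -
  have "i \<notin> {fst (fst V)..<fst (fst V) + order G}" if "fst (src m) \<le> i" for i
    using that summand_in_range[OF assms(1)] unfolding atLeastLessThan_iff by linarith
  then show ?thesis
    using assms(2) unfolding Some_in_rep_sphere by presburger
qed

lemma pinch_pointed:
  assumes "stage_pointed m f" "stage_pointed m h" "1 \<le> m"
  shows "stage_pointed m (pinch m f h)"
proof -
  let ?d = "fst (fst V)" and ?n = "order G"
  have "pinch m f h v \<in> topspace (level X (fst (tgt m)))" if v: "v \<in> topspace (rep_sphere (fst (src m)))" for v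
  proof (cases v)
    case (Some x)
    have "Some (\<lambda>i. if i \<in> {?d..<?d + ?n} then x i - c else x i) \<in> topspace (rep_sphere (fst (src m)))" for c
      using shifted_in_sphere[OF assms(3)] v unfolding Some .
    then show ?thesis
      using assms(1,2) Some base_pt_in[OF spectrum] by (simp add: pinch_sum_def Let_def stage_pointed_def)
  qed (simp add: pinch_sum_def base_pt_in[OF spectrum])
  then show ?thesis by (simp add: stage_pointed_def pinch_sum_def)
qed

lemma pinch_cong:
  assumes "\<And>v. v \<in> topspace (rep_sphere (fst (src m))) \<Longrightarrow> f v = f' v"
    "\<And>v. v \<in> topspace (rep_sphere (fst (src m))) \<Longrightarrow> h v = h' v" "1 \<le> m"
    "v \<in> topspace (rep_sphere (fst (src m)))"
  shows "pinch m f h v = pinch m f' h' v"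
proof (cases v)
  case (Some x)
  let ?d = "fst (fst V)" and ?n = "order G"
  have "Some (\<lambda>i. if i \<in> {?d..<?d + ?n} then x i - c else x i) \<in> topspace (rep_sphere (fst (src m)))" for c
    using shifted_in_sphere[OF assms(3)] assms(4) unfolding Some .
  then show ?thesis
    using assms(1,2) Some by (simp add: pinch_sum_def Let_def)
qed (simp add: pinch_sum_def)

text \<open>The pinching coordinates belong to the first copy of the regular representation, hence
  to the part kept by \<open>vec_take\<close>; the part handed to the structure map is untouched by
  the shift.\<close>

lemma stab_pinch:
  assumes "1 \<le> m" "v \<in> topspace (rep_sphere (fst (src (m + j))))"
  shows "stab m j (pinch m f h) v = pinch (m + j) (stab m j f) (stab m j h) v"
proof (cases v)
  case None
  then show ?thesis by (simp add: pinch_sum_def stabilize_def algebra_simps)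
next
  case (Some x)
  let ?d = "fst (fst V)" and ?n = "order G" and ?D = "fst (src m)"
  let ?B = "{?d..<?d + ?n}"
  note le = summand_in_range[OF assms(1)]
  have s: "(\<Sum>i\<in>?B. vec_take ?D x i) = (\<Sum>i\<in>?B. x i)"
    by (rule sum.cong) (use le in \<open>auto simp: vec_take_def simp del: fst_rep_sum\<close>)
  have t: "(\<lambda>i. if i \<in> ?B then vec_take ?D x i - c else vec_take ?D x i)
      = vec_take ?D (\<lambda>i. if i \<in> ?B then x i - c else x i)" for c
    using le by (auto simp: vec_take_def fun_eq_iff simp del: fst_rep_sum)
  have dr: "vec_drop ?D (\<lambda>i. if i \<in> ?B then x i - c else x i) = vec_drop ?D x" for c
    using le by (auto simp: vec_drop_def fun_eq_iff simp del: fst_rep_sum)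
  have "x \<in> topspace (Euclidean_space (?D + j * ?n))"
    using assms(2) Some unfolding dim_add by (simp add: Some_in_rep_sphere topspace_Euclidean_space)
  then have w: "Some (vec_drop ?D x) \<in> topspace (rep_sphere (j * ?n))"
    by (simp add: topspace_rep_sphere vec_drop_in)
  show ?thesis
    unfolding Some dim_add
    using structure_map_base[OF spectrum w]
    by (simp only: pinch_sum_def stabilize_def option.case Let_def s t dr split: if_split) simp
qed

text \<open>Stabilizing both representatives changes neither their classes nor, by
  \<open>stab_pinch\<close>, the class of their sum. It is therefore enough to let them range over a
  family \<open>C\<close> that every pair at a common stage reaches after a common
  stabilization.\<close>

lemma RO_mult_cofinal:
  assumes a: "a \<in> stable_maps G V X // rel" and b: "b \<in> stable_maps G V X // rel"
    and C: "\<And>m f h. 1 \<le> m \<Longrightarrow> (m, f) \<in> stable_maps G V X \<Longrightarrow> (m, h) \<in> stable_maps G V X \<Longrightarrow>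
      \<exists>j f' h'. (m + j, f') \<in> C \<and> (m + j, h') \<in> C \<and>
        (\<forall>v \<in> topspace (rep_sphere (fst (src (m + j)))). f' v = stab m j f v \<and> h' v = stab m j h v)"
  shows "a \<otimes>\<^bsub>RO_homotopy_group G V X\<^esub> b =
    \<Union>{rel `` {(m, pinch m f h)} |m f h. 1 \<le> m \<and> (m, f) \<in> a \<inter> C \<and> (m, h) \<in> b \<inter> C}"
proof
  have "z \<in> \<Union>{rel `` {(m, pinch m f h)} |m f h. 1 \<le> m \<and> (m, f) \<in> a \<inter> C \<and> (m, h) \<in> b \<inter> C}"
    if m: "1 \<le> m" and fh: "(m, f) \<in> a" "(m, h) \<in> b" and z: "((m, pinch m f h), z) \<in> rel" for z m f h
  proof -
    have st: "(m, f) \<in> stable_maps G V X" "(m, h) \<in> stable_maps G V X"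
      using fh a b in_quotient_imp_subset[OF equiv_rel] by auto
    obtain j f' h' where j: "(m + j, f') \<in> C" "(m + j, h') \<in> C"
      "\<And>v. v \<in> topspace (rep_sphere (fst (src (m + j)))) \<Longrightarrow> f' v = stab m j f v"
      "\<And>v. v \<in> topspace (rep_sphere (fst (src (m + j)))) \<Longrightarrow> h' v = stab m j h v"
      using C[OF m st] by blast
    \<comment> \<open>The class contains \<open>z\<close>, and \<open>rel\<close> relates only
      stable maps, so the pinch sum is one.\<close>
    have "(m, pinch m f h) \<in> stable_maps G V X"
      using z by (cases z) (auto simp: rel_iff)
    then have "((m, pinch m f h), (m + j, stab m j (pinch m f h))) \<in> rel"
      by (rule rel_stab)
    then have "rel `` {(m, pinch m f h)} = rel `` {(m + j, stab m j (pinch m f h))}"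
      by (rule equiv_class_eq[OF equiv_rel])
    also have "\<dots> = rel `` {(m + j, pinch (m + j) f' h')}"
    proof (rule rel_cong)
      fix v assume v: "v \<in> topspace (rep_sphere (fst (src (m + j))))"
      have "1 \<le> m + j" using m by simp
      then show "stab m j (pinch m f h) v = pinch (m + j) f' h' v"
        using stab_pinch[OF m v] pinch_cong[OF j(3) j(4) _ v] by simp
    qed
    finally have "z \<in> rel `` {(m + j, pinch (m + j) f' h')}"
      using z by blast
    moreover have "rel `` {(m + j, f')} = rel `` {(m, f)}" "rel `` {(m + j, h')} = rel `` {(m, h)}"
      using rel_cong[OF j(3)] rel_cong[OF j(4)] equiv_class_eq[OF equiv_rel rel_stab[OF st(1)], of j]
        equiv_class_eq[OF equiv_rel rel_stab[OF st(2)], of j] by auto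
    then have "((m, f), (m + j, f')) \<in> rel" "((m, h), (m + j, h')) \<in> rel"
      using eq_equiv_class[OF _ equiv_rel] stable_maps_cong[of "m + j" f'] stable_maps_cong[of "m + j" h'] j(3,4)
        stab_stable[OF st(1), of j] stab_stable[OF st(2), of j] rel_sym by metis+
    then have "(m + j, f') \<in> a" "(m + j, h') \<in> b"
      using in_quotient_imp_closed[OF equiv_rel a fh(1)] in_quotient_imp_closed[OF equiv_rel b fh(2)] by auto
    ultimately show ?thesis
      using j(1,2) m trans_le_add1[OF m, of j] by blast
  qed
  then show "a \<otimes>\<^bsub>RO_homotopy_group G V X\<^esub> b \<subseteq>
    \<Union>{rel `` {(m, pinch m f h)} |m f h. 1 \<le> m \<and> (m, f) \<in> a \<inter> C \<and> (m, h) \<in> b \<inter> C}"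
    unfolding RO_homotopy_group_def by fastforce
  show "\<Union>{rel `` {(m, pinch m f h)} |m f h. 1 \<le> m \<and> (m, f) \<in> a \<inter> C \<and> (m, h) \<in> b \<inter> C}
    \<subseteq> a \<otimes>\<^bsub>RO_homotopy_group G V X\<^esub> b"
    unfolding RO_homotopy_group_def by auto
qed

end

text \<open>
  The representative \<open>p x y\<close> of a sum need not lie in \<open>S\<close>; if it does not, its class is empty, and
  so is that of \<open>\<tau> (p x y)\<close>. This makes the continuity of pinch sums irrelevant below.
\<close>

lemma quotient_iso:
  assumes R: "equiv S R" and R': "equiv S' R'"
    and cofinal: "\<And>x. x \<in> S \<Longrightarrow> \<exists>c\<in>C. (x, c) \<in> R"
    and \<tau>: "\<And>x y. x \<in> C \<Longrightarrow> y \<in> C \<Longrightarrow> (\<tau> x, \<tau> y) \<in> R' \<longleftrightarrow> (x, y) \<in> R"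
    and surj: "\<And>y. y \<in> S' \<Longrightarrow> \<exists>c\<in>C. (\<tau> c, y) \<in> R'"
    and H: "carrier H = S // R" and H': "carrier H' = S' // R'"
    and mult: "\<And>a b. a \<in> S // R \<Longrightarrow> b \<in> S // R \<Longrightarrow>
      a \<otimes>\<^bsub>H\<^esub> b = \<Union>{R `` {p x y} |x y. x \<in> a \<inter> C \<and> y \<in> b \<inter> C \<and> D x y}"
    and mult': "\<And>a b. a \<in> S' // R' \<Longrightarrow> b \<in> S' // R' \<Longrightarrow>
      a \<otimes>\<^bsub>H'\<^esub> b = \<Union>{R' `` {\<tau> (p x y)} |x y. x \<in> C \<and> \<tau> x \<in> a \<and> y \<in> C \<and> \<tau> y \<in> b \<and> D x y}"
    and p: "\<And>x y. x \<in> C \<Longrightarrow> y \<in> C \<Longrightarrow> D x y \<Longrightarrow> p x y \<in> C"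
  shows "H \<cong> H'"
proof -
  \<comment> \<open>By \<open>cofinal\<close> each class meets \<open>C\<close>, and by
    \<open>\<tau>\<close> the images of its members in \<open>C\<close> lie in a single
    class.\<close>
  define \<Phi> where "\<Phi> a = R' `` (\<tau> ` (a \<inter> C))" for a
  have sym: "(y, x) \<in> R" if "(x, y) \<in> R" for x y
    using R that by (auto simp: equiv_def dest: symD)
  have trans': "(x, z) \<in> R'" if "(x, y) \<in> R'" "(y, z) \<in> R'" for x y z
    using R' that by (auto simp: equiv_def dest: transD)
  have left': "(x, x) \<in> R'" if "(x, y) \<in> R'" for x y
    using R' that by (auto simp: equiv_def dest: transD symD)
  have in_S: "x \<in> S \<longleftrightarrow> (x, x) \<in> R" for x
    using R by (auto simp: equiv_def refl_on_def)
  have in_S': "x \<in> S' \<longleftrightarrow> (x, x) \<in> R'" for x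
    using R' by (auto simp: equiv_def refl_on_def)
  \<comment> \<open>If \<open>c\<close> is outside \<open>S\<close>, then \<open>(c, c)\<close> is
    not in \<open>R\<close>, so by \<open>\<tau>\<close> both sides are empty; this covers sums that
    are not in \<open>S\<close>.\<close>
  have \<Phi>_class: "\<Phi> (R `` {c}) = R' `` {\<tau> c}" if "c \<in> C" for c
  proof
    show "\<Phi> (R `` {c}) \<subseteq> R' `` {\<tau> c}"
      using \<tau>[OF that] trans' by (auto simp: \<Phi>_def)
    show "R' `` {\<tau> c} \<subseteq> \<Phi> (R `` {c})"
      using \<tau>[OF that that] left' that by (auto simp: \<Phi>_def)
  qed
  have rep: "\<exists>c\<in>C. c \<in> S \<and> a = R `` {c}" if a: "a \<in> S // R" for a
  proof -
    obtain x where x: "x \<in> S" "a = R `` {x}" using a unfolding quotient_def by blast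
    obtain c where c: "c \<in> C" "(x, c) \<in> R" using cofinal[OF x(1)] by blast
    have "a = R `` {c}" unfolding x(2) by (rule equiv_class_eq[OF R c(2)])
    moreover have "c \<in> S" using c(2) R by (auto simp: equiv_def)
    ultimately show ?thesis using c(1) by blast
  qed
  have mem: "x \<in> a \<longleftrightarrow> \<tau> x \<in> \<Phi> a" if a: "a \<in> S // R" and x: "x \<in> C" for a x
  proof -
    obtain c where c: "c \<in> C" "a = R `` {c}" using rep[OF a] by blast
    show ?thesis using \<tau>[OF c(1) x] unfolding c(2) \<Phi>_class[OF c(1)] by blast
  qed
  have \<Phi>_in: "\<Phi> a \<in> S' // R'" if a: "a \<in> S // R" for a
  proof -
    obtain c where c: "c \<in> C" "c \<in> S" "a = R `` {c}" using rep[OF a] by blast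
    then have "\<tau> c \<in> S'" using \<tau>[OF c(1) c(1)] in_S in_S' by blast
    then show ?thesis unfolding c(3) \<Phi>_class[OF c(1)] by (rule quotientI)
  qed
  have "\<Phi> (a \<otimes>\<^bsub>H\<^esub> b) = \<Phi> a \<otimes>\<^bsub>H'\<^esub> \<Phi> b" if a: "a \<in> S // R" and b: "b \<in> S // R" for a b
  proof -
    \<comment> \<open>\<open>\<Phi>\<close> is formed elementwise, so it commutes with the union
      that defines the product.\<close>
    have "\<Phi> (a \<otimes>\<^bsub>H\<^esub> b) = \<Union>{\<Phi> (R `` {p x y}) |x y. x \<in> a \<inter> C \<and> y \<in> b \<inter> C \<and> D x y}"
      unfolding mult[OF a b] by (auto simp: \<Phi>_def) blast+
    also have "\<dots> = \<Union>{R' `` {\<tau> (p x y)} |x y. x \<in> C \<and> \<tau> x \<in> \<Phi> a \<and> y \<in> C \<and> \<tau> y \<in> \<Phi> b \<and> D x y}"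
      using \<Phi>_class p mem[OF a] mem[OF b] by (intro arg_cong[of _ _ Union]) (auto, blast+)
    also have "\<dots> = \<Phi> a \<otimes>\<^bsub>H'\<^esub> \<Phi> b"
      by (rule mult'[OF \<Phi>_in[OF a] \<Phi>_in[OF b], symmetric])
    finally show ?thesis .
  qed
  then have "\<Phi> \<in> hom H H'"
    using \<Phi>_in by (auto simp: hom_def H H')
  moreover have "inj_on \<Phi> (S // R)"
  proof (rule inj_onI)
    fix a b assume ab: "a \<in> S // R" "b \<in> S // R" "\<Phi> a = \<Phi> b"
    obtain c where c: "c \<in> C" "c \<in> S" "a = R `` {c}" using rep[OF ab(1)] by blast
    have "c \<in> b" using mem[OF ab(1) c(1)] mem[OF ab(2) c(1)] ab(3) c in_S by blast
    then show "a = b"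
      using c ab(1,2) quotient_eq_iff[OF R ab(1,2), of c c] in_S by blast
  qed
  moreover have "\<Phi> ` (S // R) = S' // R'"
  proof
    show "\<Phi> ` (S // R) \<subseteq> S' // R'" using \<Phi>_in by blast
    show "S' // R' \<subseteq> \<Phi> ` (S // R)"
    proof
      fix a' assume "a' \<in> S' // R'"
      then obtain y where y: "y \<in> S'" "a' = R' `` {y}" unfolding quotient_def by blast
      obtain c where c: "c \<in> C" "(\<tau> c, y) \<in> R'" using surj[OF y(1)] by blast
      have "R' `` {\<tau> c} = a'" unfolding y(2) by (rule equiv_class_eq[OF R' c(2)])
      moreover have "c \<in> S" using left'[OF c(2)] \<tau>[OF c(1) c(1)] in_S by blast
      ultimately show "a' \<in> \<Phi> ` (S // R)"
        using \<Phi>_class[OF c(1)] quotientI[of c S R] by (metis image_eqI)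
    qed
  qed
  ultimately show ?thesis
    unfolding is_iso_def iso_def bij_betw_def H H' by blast
qed

section \<open>Trivializing the regular representation over the line\<close>

lemma mat_mult_sum:
  "mat_mult (d + e) (mat_sum d A B) (mat_sum d A' B') = mat_sum d (mat_mult d A A') (mat_mult e B B')"
  by (intro ext) (auto simp: mat_mult_def sum_lessThan_add mat_sum_def)

lemma mat_transpose_sum: "mat_transpose (mat_sum d A B) = mat_sum d (mat_transpose A) (mat_transpose B)"
  by (intro ext) (auto simp: mat_transpose_def mat_sum_def)

lemma mat_transpose_id: "mat_transpose (mat_id d) = mat_id d"
  by (intro ext) (auto simp: mat_transpose_def mat_id_def)

lemma rep_multiple_mult:
  assumes "rep_supported V"
  shows "rep_multiple (i * m) V = rep_multiple i (rep_multiple m V)"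
proof (induction i)
  case (Suc i)
  have "rep_multiple (Suc i * m) V = rep_multiple (i * m + m) V" by (simp add: add.commute)
  then show ?case by (simp add: rep_multiple_add[OF assms] Suc)
qed simp

text \<open>A geometric series whose ratio is an n-th root of unity different from 1, by the
  hypothesis on \<open>m\<close>. The offset \<open>s\<close> contributes a common factor; it makes
  room for the time parameter of the frames.\<close>

lemma sum_roots_of_unity:
  assumes "0 < n" "\<not> int n dvd m"
  shows "(\<Sum>l<n. cis (2 * pi * of_int m * (s - real l) / real n)) = 0"
proof -
  let ?q = "cis (- 2 * pi * of_int m / real n)"
  have "cis (2 * pi * of_int m * (s - real l) / real n) = cis (2 * pi * of_int m * s / real n) * ?q ^ l" for l
  proof -
    have "2 * pi * of_int m * (s - real l) / real n = 2 * pi * of_int m * s / real n + real l * (- 2 * pi * of_int m / real n)"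
      by (simp add: diff_divide_distrib algebra_simps)
    then show ?thesis by (simp only: cis_mult Complex.DeMoivre)
  qed
  then have sum: "(\<Sum>l<n. cis (2 * pi * of_int m * (s - real l) / real n)) =
      cis (2 * pi * of_int m * s / real n) * (\<Sum>l<n. ?q ^ l)"
    by (simp add: sum_distrib_left)
  have "?q \<noteq> 1"
  proof
    assume "?q = 1"
    then have "cos (- 2 * pi * of_int m / real n) = 1" by (simp add: complex_eq_iff)
    then obtain z :: int where "- 2 * pi * of_int m / real n = of_int z * 2 * pi"
      unfolding cos_one_2pi_int by blast
    then have "pi * of_int m = pi * (real n * of_int (- z))" using assms(1) by (simp add: field_simps)
    then have "real_of_int m = real n * of_int (- z)" by (simp only: mult_cancel_left pi_neq_zero simp_thms)
    then have "real_of_int m = of_int (int n * (- z))" by simp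
    then have "m = int n * (- z)" by (simp only: of_int_eq_iff)
    then show False using assms(2) by simp
  qed
  moreover have "?q ^ n = 1"
  proof -
    have "?q ^ n = cis (real n * (- 2 * pi * of_int m / real n))" by (rule Complex.DeMoivre)
    also have "real n * (- 2 * pi * of_int m / real n) = 2 * pi * of_int (- m)" using assms(1) by simp
    also have "cis \<dots> = 1" by (rule cis_multiple_2pi) simp
    finally show ?thesis .
  qed
  ultimately have "(\<Sum>l<n. ?q ^ l) = 0" by (simp add: geometric_sum)
  then show ?thesis using sum by simp
qed

lemma cos_sin_shift:
  fixes k z :: int
  assumes "0 < n"
  shows "cos (2 * pi * of_int k * (s + of_int (int n * z)) / real n) = cos (2 * pi * of_int k * s / real n)"
    and "sin (2 * pi * of_int k * (s + of_int (int n * z)) / real n) = sin (2 * pi * of_int k * s / real n)"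
proof -
  have "2 * pi * of_int k * (s + of_int (int n * z)) / real n = 2 * pi * of_int k * s / real n + 2 * pi * of_int (k * z)"
    using assms by (simp add: field_simps)
  then have "cis (2 * pi * of_int k * (s + of_int (int n * z)) / real n) =
      cis (2 * pi * of_int k * s / real n) * cis (2 * pi * of_int (k * z))"
    by (simp only: cis_mult)
  also have "cis (2 * pi * of_int (k * z)) = 1" by (rule cis_multiple_2pi) simp
  finally have "cis (2 * pi * of_int k * (s + of_int (int n * z)) / real n) = cis (2 * pi * of_int k * s / real n)"
    by simp
  then show "cos (2 * pi * of_int k * (s + of_int (int n * z)) / real n) = cos (2 * pi * of_int k * s / real n)"
    and "sin (2 * pi * of_int k * (s + of_int (int n * z)) / real n) = sin (2 * pi * of_int k * s / real n)"
    by (simp_all add: complex_eq_iff)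
qed

text \<open>
  The discrete Fourier transform, rotated in the \<open>k\<close>-th frequency at speed \<open>k\<close>, as a matrix on
  \<open>\<complex>\<^sup>n = \<real>\<^sup>n \<oplus> \<real>\<^sup>n\<close>; the basis vector \<open>a\<close> of the regular representation is \<open>\<gamma>\<close> to the power \<open>e a\<close>. The
  column of frequency \<open>0\<close> is the normalized sum of the basis vectors, along which the pinch map
  is formed.
\<close>

definition fourier_matrix :: "nat \<Rightarrow> (nat \<Rightarrow> nat) \<Rightarrow> real \<Rightarrow> rmat" where
  "fourier_matrix n e t = (\<lambda>i j. if i < n + n \<and> j < n + n then
     (let \<theta> = 2 * pi * of_int (int (if j < n then j else j - n)) * (t - real (e (if i < n then i else i - n))) / real n in
       (if i < n then if j < n then cos \<theta> else - sin \<theta>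
        else if j < n then sin \<theta> else cos \<theta>) / sqrt (real n)) else 0)"

text \<open>Orthogonality of characters modulo n, used twice: for two columns the exponents
  \<open>e a\<close> run through all residues, for two rows the frequencies do, and then
  \<open>t\<close> cancels. The rows give the claim about the transpose.\<close>

lemma fourier_matrix_orthogonal:
  assumes n: "0 < n" and e: "bij_betw e {..<n} {..<n}"
  shows "fourier_matrix n e t \<in> carrier (orthogonal_group (n + n))"
    and "mat_transpose (fourier_matrix n e t) \<in> carrier (orthogonal_group (n + n))"
proof -
  let ?M = "fourier_matrix n e t"
  define \<theta> where "\<theta> a j = 2 * pi * of_int (int j) * (t - real (e a)) / real n" for a j
  have block: "i < n \<Longrightarrow> j < n \<Longrightarrow> ?M i j = cos (\<theta> i j) / sqrt (real n)"
    "i < n \<Longrightarrow> j < n \<Longrightarrow> ?M i (n + j) = - sin (\<theta> i j) / sqrt (real n)"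
    "i < n \<Longrightarrow> j < n \<Longrightarrow> ?M (n + i) j = sin (\<theta> i j) / sqrt (real n)"
    "i < n \<Longrightarrow> j < n \<Longrightarrow> ?M (n + i) (n + j) = cos (\<theta> i j) / sqrt (real n)" for i j
    by (simp_all add: fourier_matrix_def \<theta>_def)
  have diag: "(\<Sum>l<n. 1 / real n) = 1" using n by simp
  have sq: "x / sqrt (real n) * (y / sqrt (real n)) = x * y / real n" for x y :: real
    using n by simp
  have cols: "(\<Sum>a<n. cos (\<theta> a i - \<theta> a j)) = (if i = j then real n else 0)"
    "(\<Sum>a<n. sin (\<theta> a i - \<theta> a j)) = 0" if "i < n" "j < n" for i j
  proof -
    have "(\<Sum>a<n. cis (\<theta> a i - \<theta> a j)) = (\<Sum>l<n. cis (2 * pi * of_int (int i - int j) * (t - real l) / real n))"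
    proof -
      have "(\<Sum>l<n. cis (2 * pi * of_int (int i - int j) * (t - real l) / real n))
        = (\<Sum>a<n. cis (2 * pi * of_int (int i - int j) * (t - real (e a)) / real n))"
        by (rule sum.reindex_bij_betw[OF e, symmetric])
      also have "\<dots> = (\<Sum>a<n. cis (\<theta> a i - \<theta> a j))"
        by (rule sum.cong) (auto simp: \<theta>_def diff_divide_distrib[symmetric] algebra_simps)
      finally show ?thesis by simp
    qed
    also have "\<dots> = (if i = j then of_nat n else 0)"
    proof (cases "i = j")
      case False
      have "\<not> int n dvd int i - int j"
      proof
        assume "int n dvd int i - int j"
        then have "\<bar>int n\<bar> \<le> \<bar>int i - int j\<bar>" using False by (intro dvd_imp_le_int) auto
        then show False using that by linarith
      qed
      then show ?thesis using sum_roots_of_unity[OF n, of "int i - int j" t] False by simp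
    qed simp
    finally have c: "(\<Sum>a<n. cis (\<theta> a i - \<theta> a j)) = (if i = j then of_nat n else 0)" .
    show "(\<Sum>a<n. cos (\<theta> a i - \<theta> a j)) = (if i = j then real n else 0)"
      using arg_cong[OF c, of Re] by simp
    show "(\<Sum>a<n. sin (\<theta> a i - \<theta> a j)) = 0"
      using arg_cong[OF c, of Im] by simp
  qed
  have rows: "(\<Sum>k<n. cos (\<theta> a k - \<theta> b k)) = (if a = b then real n else 0)"
    "(\<Sum>k<n. sin (\<theta> a k - \<theta> b k)) = 0" if "a < n" "b < n" for a b
  proof -
    have "(\<Sum>k<n. cis (\<theta> a k - \<theta> b k)) = (\<Sum>l<n. cis (2 * pi * of_int (int (e a) - int (e b)) * (0 - real l) / real n))"
      by (rule sum.cong) (auto simp: \<theta>_def diff_divide_distrib[symmetric] algebra_simps)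
    also have "\<dots> = (if a = b then of_nat n else 0)"
    proof (cases "a = b")
      case False
      have "e a < n" "e b < n" "e a \<noteq> e b"
        using e that False by (auto simp: bij_betw_def inj_on_def)
      then have "\<not> int n dvd int (e a) - int (e b)"
        using dvd_imp_le_int[of "int (e a) - int (e b)" "int n"] by linarith
      then show ?thesis using sum_roots_of_unity[OF n, of "int (e a) - int (e b)" 0] False by simp
    qed simp
    finally have c: "(\<Sum>k<n. cis (\<theta> a k - \<theta> b k)) = (if a = b then of_nat n else 0)" .
    show "(\<Sum>k<n. cos (\<theta> a k - \<theta> b k)) = (if a = b then real n else 0)"
      using arg_cong[OF c, of Re] by simp
    show "(\<Sum>k<n. sin (\<theta> a k - \<theta> b k)) = 0"
      using arg_cong[OF c, of Im] by simp
  qed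
  have split: "i < n \<or> (\<exists>i'<n. i = n + i')" if "i < n + n" for i
    using that by (metis add_diff_inverse_nat add_less_cancel_left)
  \<comment> \<open>The real and imaginary halves of an inner product are merged term by term with
    an addition formula: equal blocks give the cosine of a difference, mixed blocks its sine with
    one sign or the other.\<close>
  have pair: "(\<Sum>a<n. f a) + (\<Sum>a<n. g a) = (\<Sum>a<n. h a) / real n"
    if "\<And>a. a < n \<Longrightarrow> f a + g a = h a / real n" for f g h :: "nat \<Rightarrow> real"
    using that by (simp add: sum.distrib[symmetric] sum_divide_distrib)
  have col: "(\<Sum>l<n. ?M l i * ?M l j) + (\<Sum>l<n. ?M (n + l) i * ?M (n + l) j) = (if i = j then 1 else 0)"
    "(\<Sum>l<n. ?M l i * ?M l (n + j)) + (\<Sum>l<n. ?M (n + l) i * ?M (n + l) (n + j)) = 0"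
    "(\<Sum>l<n. ?M l (n + i) * ?M l j) + (\<Sum>l<n. ?M (n + l) (n + i) * ?M (n + l) j) = 0"
    "(\<Sum>l<n. ?M l (n + i) * ?M l (n + j)) + (\<Sum>l<n. ?M (n + l) (n + i) * ?M (n + l) (n + j)) = (if i = j then 1 else 0)"
    if ij: "i < n" "j < n" for i j
    using ij n cols[OF ij] cols[OF ij(2,1)]
    by (subst pair[of _ _ "\<lambda>a. cos (\<theta> a i - \<theta> a j)"] pair[of _ _ "\<lambda>a. sin (\<theta> a i - \<theta> a j)"]
        pair[of _ _ "\<lambda>a. sin (\<theta> a j - \<theta> a i)"];
        simp add: block sq cos_diff sin_diff add_divide_distrib diff_divide_distrib mult.commute; fail)+
  have row: "(\<Sum>l<n. ?M i l * ?M j l) + (\<Sum>l<n. ?M i (n + l) * ?M j (n + l)) = (if i = j then 1 else 0)"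
    "(\<Sum>l<n. ?M i l * ?M (n + j) l) + (\<Sum>l<n. ?M i (n + l) * ?M (n + j) (n + l)) = 0"
    "(\<Sum>l<n. ?M (n + i) l * ?M j l) + (\<Sum>l<n. ?M (n + i) (n + l) * ?M j (n + l)) = 0"
    "(\<Sum>l<n. ?M (n + i) l * ?M (n + j) l) + (\<Sum>l<n. ?M (n + i) (n + l) * ?M (n + j) (n + l)) = (if i = j then 1 else 0)"
    if ij: "i < n" "j < n" for i j
    using ij n rows[OF ij] rows[OF ij(2,1)]
    by (subst pair[of _ _ "\<lambda>l. cos (\<theta> i l - \<theta> j l)"] pair[of _ _ "\<lambda>l. sin (\<theta> i l - \<theta> j l)"]
        pair[of _ _ "\<lambda>l. sin (\<theta> j l - \<theta> i l)"];
        simp add: block sq cos_diff sin_diff add_divide_distrib diff_divide_distrib mult.commute; fail)+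
  have "(\<Sum>l<n + n. ?M l i * ?M l j) = (if i = j then 1 else 0)" if "i < n + n" "j < n + n" for i j
    unfolding sum_lessThan_add using split[OF that(1)] split[OF that(2)] col by auto
  moreover have "(\<Sum>l<n + n. ?M i l * ?M j l) = (if i = j then 1 else 0)" if "i < n + n" "j < n + n" for i j
    unfolding sum_lessThan_add using split[OF that(1)] split[OF that(2)] row by auto
  moreover have "?M i j = 0" if "n + n \<le> i \<or> n + n \<le> j" for i j
    using that by (auto simp: fourier_matrix_def)
  ultimately show "?M \<in> carrier (orthogonal_group (n + n))" "mat_transpose ?M \<in> carrier (orthogonal_group (n + n))"
    unfolding orthogonal_group_carrier mat_transpose_def by auto
qed


section \<open>Cyclic groups and frames of their representations\<close>

locale cyclic_generator = group G for G :: "('g, 'b) monoid_scheme" (structure) +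
  fixes \<gamma> :: 'g
  assumes generator: "\<gamma> \<in> carrier G" "generate G {\<gamma>} = carrier G"
    and order_pos: "0 < order G"
begin

lemma finite_carrier: "finite (carrier G)"
  using order_pos by (simp add: order_def card_gt_0_iff)

lemma pow_in [simp]: "\<gamma> [^] (z::int) \<in> carrier G"
  using generator(1) by simp

lemma ord_generator: "ord \<gamma> = order G"
  using generate_pow_card[OF generator(1)] generator(2) by (simp add: order_def)

lemma pow_eq_iff: "\<gamma> [^] (i::int) = \<gamma> [^] (j::int) \<longleftrightarrow> int (order G) dvd i - j"
  using int_pow_eq[OF generator(1), of j i] ord_generator by auto

lemma carrier_pow:
  assumes "g \<in> carrier G"
  obtains z :: int where "g = \<gamma> [^] z"
  using assms generator(2) generate_pow[OF generator(1)] by auto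

definition exponent :: "'g \<Rightarrow> nat" where
  "exponent g = (LEAST j::nat. \<gamma> [^] j = g)"

lemma pow_exponent:
  assumes "g \<in> carrier G"
  shows "\<gamma> [^] exponent g = g"
proof -
  obtain z :: int where z: "g = \<gamma> [^] z" using assms by (rule carrier_pow)
  have "\<gamma> [^] z = \<gamma> [^] (z mod int (order G))"
    unfolding pow_eq_iff by (simp add: minus_mod_eq_mult_div)
  also have "z mod int (order G) = int (nat (z mod int (order G)))"
    using order_pos by simp
  finally have "\<gamma> [^] nat (z mod int (order G)) = g" unfolding z int_pow_int by simp
  then show ?thesis unfolding exponent_def by (rule LeastI)
qed

lemma exponent_less:
  assumes "g \<in> carrier G"
  shows "exponent g < order G"
proof -
  have "\<gamma> [^] (int (exponent g mod order G)) = \<gamma> [^] int (exponent g)"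
    unfolding pow_eq_iff by (simp add: zmod_int mod_eq_dvd_iff[symmetric])
  then have "\<gamma> [^] (exponent g mod order G) = g"
    using pow_exponent[OF assms] by (simp add: int_pow_int)
  then have "exponent g \<le> exponent g mod order G"
    unfolding exponent_def by (rule Least_le)
  then show ?thesis using order_pos mod_less_divisor[of "order G" "exponent g"] by linarith
qed

lemma exponent_eq_pow:
  assumes "g \<in> carrier G" "g = \<gamma> [^] (z::int)"
  shows "int (order G) dvd int (exponent g) - z"
  using pow_exponent[OF assms(1)] assms(2) pow_eq_iff[of "int (exponent g)" z] by (simp add: int_pow_int)

abbreviation "enum_exponent a \<equiv> exponent (group_enum G a)"

text \<open>Translates the unspecified basis order chosen by \<open>group_enum\<close> into residues
  modulo the order, which is what orthogonality of the Fourier matrix requires.\<close>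

lemma bij_enum_exponent: "bij_betw enum_exponent {..<order G} {..<order G}"
proof -
  note e = bij_betw_group_enum[OF finite_carrier]
  have c: "group_enum G a \<in> carrier G" if "a < order G" for a
    using e that by (auto simp: bij_betw_def)
  have "inj_on enum_exponent {..<order G}"
  proof (rule inj_onI)
    fix a b assume ab: "a \<in> {..<order G}" "b \<in> {..<order G}" "enum_exponent a = enum_exponent b"
    then have "group_enum G a = group_enum G b" using pow_exponent[OF c] by (metis lessThan_iff)
    then show "a = b" using e ab(1,2) by (auto simp: bij_betw_def inj_on_def)
  qed
  moreover have "enum_exponent ` {..<order G} \<subseteq> {..<order G}"
    using exponent_less[OF c] by auto
  ultimately show ?thesis
    using endo_inj_surj[of "{..<order G}" enum_exponent] by (simp add: bij_betw_def)
qed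

text \<open>
  The orthogonal matrices \<open>A t\<close> trivialize the bundle over \<open>\<real>/\<int>\<close> with fibre \<open>V\<close> and monodromy \<open>\<gamma>\<close>.
\<close>

definition framed :: "'g rep \<Rightarrow> real rep \<Rightarrow> bool" where
  "framed V A \<longleftrightarrow> fst A = fst V \<and>
     (\<forall>t. snd A t \<in> carrier (orthogonal_group (fst V))) \<and>
     (\<forall>t. mat_transpose (snd A t) \<in> carrier (orthogonal_group (fst V))) \<and>
     (\<forall>i j. continuous_on UNIV (\<lambda>t. snd A t i j)) \<and>
     (\<forall>t. \<forall>z::int. snd A (t + of_int z) = mat_mult (fst V) (snd V (\<gamma> [^] z)) (snd A t)) \<and>
     (\<forall>t. \<forall>z::int. snd A (t + of_int (int (order G) * z)) = snd A t)"

lemma framed_sum: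
  assumes "framed V A" "framed W B"
  shows "framed (rep_sum V W) (rep_sum A B)"
proof -
  have "continuous_on UNIV (\<lambda>t. mat_sum (fst V) (snd A t) (snd B t) i j)" for i j
    using assms by (cases "i < fst V"; cases "j < fst V") (auto simp: mat_sum_def framed_def)
  then show ?thesis
    using assms by (auto simp: framed_def mat_sum_in mat_mult_sum mat_transpose_sum)
qed

lemma framed_trivial: "framed (trivial_rep d) (trivial_rep d)"
proof -
  have "mat_mult d (mat_id d) (mat_id d) = mat_id d"
    by (rule mat_mult_id_left) (simp add: mat_id_def)
  then show ?thesis by (simp add: framed_def mat_id_in mat_transpose_id)
qed

lemma framed_multiple: "framed V A \<Longrightarrow> framed (rep_multiple m V) (rep_multiple m A)"
  by (induction m) (auto intro: framed_sum framed_trivial)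

definition fourier_frame :: "real rep" where
  "fourier_frame = (order G + order G, fourier_matrix (order G) enum_exponent)"

lemma fst_fourier_frame [simp]: "fst fourier_frame = order G + order G"
  by (simp add: fourier_frame_def)

text \<open>Row \<open>a\<close> at time \<open>t + z\<close> depends on \<open>t + z - e a\<close>,
  where \<open>e\<close> is \<open>enum_exponent\<close>. If the basis element of \<open>a\<close>
  is \<open>\<gamma>^z\<close> times that of \<open>b\<close>, then \<open>e a\<close> is
  \<open>z + e b\<close> modulo the order, so this is row \<open>b\<close> at time \<open>t\<close>,
  which is also what the permutation matrix of \<open>\<gamma>^z\<close> puts in place
  \<open>a\<close>. Speed equals frequency so that a unit of time has the effect of one step of the
  index.\<close>

lemma fourier_matrix_translate:
  "fourier_matrix (order G) enum_exponent (t + of_int z) =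
    mat_mult (order G + order G) (snd (rep_sum (regular_rep G) (regular_rep G)) (\<gamma> [^] z))
      (fourier_matrix (order G) enum_exponent t)"
proof (intro ext)
  let ?n = "order G" and ?M = "fourier_matrix (order G) enum_exponent" and ?g = "\<gamma> [^] z"
  let ?R = "snd (regular_rep G) ?g"
  note e = bij_betw_group_enum[OF finite_carrier]
  have split: "i < ?n \<or> (\<exists>i'<?n. i = ?n + i') \<or> ?n + ?n \<le> i" for i
    by presburger
  have \<theta>: "cos (2 * pi * of_int k * (t + of_int z - real (enum_exponent a)) / real ?n) =
      cos (2 * pi * of_int k * (t - real (enum_exponent b)) / real ?n)"
    "sin (2 * pi * of_int k * (t + of_int z - real (enum_exponent a)) / real ?n) =
      sin (2 * pi * of_int k * (t - real (enum_exponent b)) / real ?n)"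
    if ab: "a < ?n" "b < ?n" "group_enum G a = ?g \<otimes> group_enum G b" for a b :: nat and k :: int
  proof -
    have c: "group_enum G a \<in> carrier G" "group_enum G b \<in> carrier G"
      using bij_betwE[OF e] ab(1,2) by auto
    have "group_enum G a = \<gamma> [^] (z + int (enum_exponent b))"
      using ab(3) pow_exponent[OF c(2)] generator(1) by (simp add: int_pow_mult int_pow_int)
    then have "int ?n dvd int (enum_exponent a) - (z + int (enum_exponent b))"
      using exponent_eq_pow[OF c(1)] by blast
    then obtain w where w: "int (enum_exponent a) - (z + int (enum_exponent b)) = int ?n * w" by (auto elim: dvdE)
    then have "real_of_int (int (enum_exponent a) - (z + int (enum_exponent b))) = of_int (int ?n * w)" by simp
    then have "t + of_int z - real (enum_exponent a) = (t - real (enum_exponent b)) + of_int (int ?n * (- w))"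
      by simp
    then show "cos (2 * pi * of_int k * (t + of_int z - real (enum_exponent a)) / real ?n) =
        cos (2 * pi * of_int k * (t - real (enum_exponent b)) / real ?n)"
      "sin (2 * pi * of_int k * (t + of_int z - real (enum_exponent a)) / real ?n) =
        sin (2 * pi * of_int k * (t - real (enum_exponent b)) / real ?n)"
      by (simp_all only: cos_sin_shift[OF order_pos])
  qed
  \<comment> \<open>Row \<open>a\<close> of the permutation matrix has its single 1 in the column
    \<open>b\<close> that the generator power moves to \<open>a\<close>.\<close>
  have shift: "\<exists>b<?n. (\<forall>l<?n. ?R a l = (if l = b then 1 else 0)) \<and> group_enum G a = ?g \<otimes> group_enum G b"
    if a: "a < ?n" for a
  proof -
    have ac: "group_enum G a \<in> carrier G" using e a by (auto simp: bij_betw_def)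
    have "inv ?g \<otimes> group_enum G a \<in> group_enum G ` {..<?n}"
      using e ac by (auto simp: bij_betw_def)
    then obtain b where b: "b < ?n" "group_enum G b = inv ?g \<otimes> group_enum G a" by force
    have "group_enum G a = ?g \<otimes> group_enum G l \<longleftrightarrow> l = b" if l: "l < ?n" for l
    proof -
      have lc: "group_enum G l \<in> carrier G" using e l by (auto simp: bij_betw_def)
      have "group_enum G a = ?g \<otimes> group_enum G l \<longleftrightarrow> group_enum G l = inv ?g \<otimes> group_enum G a"
        using inv_solve_left[OF lc pow_in ac] by blast
      also have "\<dots> \<longleftrightarrow> l = b"
        using e l b by (auto simp: bij_betw_def inj_on_def)
      finally show ?thesis .
    qed
    then show ?thesis using a b(1) by (auto simp: regular_rep_def)
  qed
  fix i j
  show "?M (t + of_int z) i j = mat_mult (?n + ?n) (snd (rep_sum (regular_rep G) (regular_rep G)) ?g) (?M t) i j"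
    using split[of i]
  proof (elim disjE exE conjE)
    assume i: "i < ?n"
    obtain b where b: "b < ?n" "\<And>l. l < ?n \<Longrightarrow> ?R i l = (if l = b then 1 else 0)" "group_enum G i = ?g \<otimes> group_enum G b"
      using shift[OF i] by blast
    have "mat_mult (?n + ?n) (snd (rep_sum (regular_rep G) (regular_rep G)) ?g) (?M t) i j
        = (\<Sum>l<?n. ?R i l * ?M t l j)"
      using i by (simp add: mat_mult_def sum_lessThan_add mat_sum_def)
    also have "\<dots> = (\<Sum>l<?n. if l = b then ?M t l j else 0)"
      by (rule sum.cong) (simp_all add: b(2))
    finally have "mat_mult (?n + ?n) (snd (rep_sum (regular_rep G) (regular_rep G)) ?g) (?M t) i j = ?M t b j"
      using b(1) by simp
    then show ?thesis
      using i b(1) \<theta>[OF i b(1,3)] by (simp add: fourier_matrix_def Let_def del: of_int_of_nat_eq of_int_diff)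
  next
    fix i' assume i: "i' < ?n" "i = ?n + i'"
    obtain b where b: "b < ?n" "\<And>l. l < ?n \<Longrightarrow> ?R i' l = (if l = b then 1 else 0)" "group_enum G i' = ?g \<otimes> group_enum G b"
      using shift[OF i(1)] by blast
    have "mat_mult (?n + ?n) (snd (rep_sum (regular_rep G) (regular_rep G)) ?g) (?M t) i j
        = (\<Sum>l<?n. ?R i' l * ?M t (?n + l) j)"
      using i by (simp add: mat_mult_def sum_lessThan_add mat_sum_def)
    also have "\<dots> = (\<Sum>l<?n. if l = b then ?M t (?n + l) j else 0)"
      by (rule sum.cong) (simp_all add: b(2))
    finally have "mat_mult (?n + ?n) (snd (rep_sum (regular_rep G) (regular_rep G)) ?g) (?M t) i j = ?M t (?n + b) j"
      using b(1) by simp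
    then show ?thesis
      using i b(1) \<theta>[OF i(1) b(1,3)] by (simp add: fourier_matrix_def Let_def del: of_int_of_nat_eq of_int_diff)
  next
    assume "?n + ?n \<le> i"
    then have "\<not> i < ?n" "\<not> i < ?n + ?n" "\<not> i - ?n < ?n" by linarith+
    then have "?M (t + of_int z) i j = 0" "snd (rep_sum (regular_rep G) (regular_rep G)) ?g i l = 0" for l
      by (simp_all add: mat_sum_def fourier_matrix_def regular_rep_def)
    then show ?thesis by (simp only: mat_mult_def mult_zero_left sum.neutral_const)
  qed
qed

lemma fourier_matrix_periodic:
  "fourier_matrix (order G) e (t + of_int (int (order G) * z)) = fourier_matrix (order G) e t"
proof -
  have "t + of_int (int (order G) * z) - real a = (t - real a) + of_int (int (order G) * z)" for a by simp
  then show ?thesis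
    unfolding fourier_matrix_def by (simp only: Let_def cos_sin_shift[OF order_pos])
qed

lemma framed_fourier: "framed (rep_multiple 2 (regular_rep G)) fourier_frame"
proof -
  have "rep_multiple 2 (regular_rep G) = rep_multiple (1 + 1) (regular_rep G)" by (simp only: one_add_one)
  also have "\<dots> = rep_sum (rep_multiple 1 (regular_rep G)) (rep_multiple 1 (regular_rep G))"
    by (rule rep_multiple_add[OF rep_supported_regular])
  also have "rep_multiple 1 (regular_rep G) = regular_rep G"
    using rep_supported_regular[of G]
    by (cases "regular_rep G") (auto simp: rep_sum_def trivial_rep_def mat_sum_def fun_eq_iff)
  finally have "rep_multiple 2 (regular_rep G) = rep_sum (regular_rep G) (regular_rep G)" .
  moreover have "continuous_on UNIV (\<lambda>t. fourier_matrix (order G) e t i j)" for e i j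
    unfolding fourier_matrix_def Let_def
    by (cases "i < order G"; cases "j < order G"; cases "i < order G + order G"; cases "j < order G + order G")
      (simp_all, (intro continuous_intros; simp add: order_pos)+)
  ultimately show ?thesis
    using fourier_matrix_orthogonal[OF order_pos bij_enum_exponent] fourier_matrix_translate fourier_matrix_periodic
    unfolding framed_def fourier_frame_def by simp
qed

text \<open>One Fourier block covers two copies of the regular representation, so \<open>i\<close>
  blocks frame stage \<open>2 * i\<close>; the trivial summand of dimension \<open>d\<close> keeps a
  constant frame.\<close>

definition frame :: "nat \<Rightarrow> nat \<Rightarrow> real rep" where
  "frame d i = rep_sum (trivial_rep d) (rep_multiple i fourier_frame)"

lemma framed_frame: "framed (stage_rep G (trivial_rep d) (2 * i)) (frame d i)"
  unfolding frame_def mult.commute[of 2 i] rep_multiple_mult[OF rep_supported_regular]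
  by (intro framed_sum framed_trivial framed_multiple framed_fourier)

lemma fourier_frame_supported: "rep_supported fourier_frame"
  by (auto simp: rep_supported_def fourier_frame_def fourier_matrix_def)

lemma frame_add: "frame d (i + l) = rep_sum (frame d i) (rep_multiple l fourier_frame)"
  by (simp add: frame_def rep_multiple_add[OF fourier_frame_supported] rep_sum_assoc)

text \<open>The phase of frequency 0 vanishes at all times, and \<open>d\<close> is the first index
  after the trivial summand. Hence the frame carries, for every \<open>t\<close>, the coordinate
  pinched for the trivial group to the direction pinched for \<open>G\<close>.\<close>

lemma frame_column:
  assumes "1 \<le> i"
  shows "snd (frame d i) t j d = (if j \<in> {d..<d + order G} then 1 / sqrt (real (order G)) else 0)"
proof -
  have 0: "snd fourier_frame t j 0 = (if j < order G then 1 / sqrt (real (order G)) else 0)" for j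
    using order_pos by (simp add: fourier_frame_def fourier_matrix_def)
  have "snd (rep_multiple i fourier_frame) t j 0 = snd fourier_frame t j 0" for j
    using assms
  proof (induction i rule: nat_induct_at_least)
    case base
    then show ?case by (simp add: mat_sum_def)
  next
    case (Suc i)
    \<comment> \<open>Column 0, and the rows in which it is nonzero, lie within the blocks already
      present, so a further block changes nothing.\<close>
    have "0 < i * (order G + order G)" using Suc(1) order_pos by simp
    moreover have "order G \<le> i * (order G + order G)" using Suc(1) by (cases i) auto
    ultimately show ?case using Suc(2) by (simp add: mat_sum_def 0)
  qed
  then show ?thesis
    by (auto simp: frame_def mat_sum_def 0)
qed

end

section \<open>Untwisting maps over the circle\<close>

lemma trivial_virtual_rep_simps [simp]:
  "fst (trivial_virtual_rep k) = trivial_rep (nat k)" "snd (trivial_virtual_rep k) = trivial_rep (nat (- k))"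
  by (simp_all add: trivial_virtual_rep_def)

lemma order_singleton_group [simp]: "order (singleton_group a) = 1"
  by (simp add: order_def)

lemma mat_sum_id: "mat_sum d (mat_id d) (mat_id e) = mat_id (d + e)"
  by (intro ext) (auto simp: mat_sum_def mat_id_def)

lemma stage_rep_singleton_group:
  "snd (stage_rep (singleton_group ()) (trivial_rep d) m) u = mat_id (fst (stage_rep (singleton_group ()) (trivial_rep d) m))"
proof -
  have "snd (regular_rep (singleton_group ())) u = mat_id 1"
    by (auto simp: regular_rep_def mat_id_def fun_eq_iff)
  then have "snd (rep_multiple m (regular_rep (singleton_group ()))) u = mat_id m"
    by (induction m) (simp_all add: mat_sum_id)
  then show ?thesis by (simp add: mat_sum_id)
qed

lemma cis_eq_imp_int:
  assumes "cis (2 * pi * s / real n) = cis (2 * pi * t / real n)" "0 < n"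
  obtains z :: int where "s = t + of_int (int n * z)"
proof -
  have "sin (2 * pi * s / real n) = sin (2 * pi * t / real n) \<and> cos (2 * pi * s / real n) = cos (2 * pi * t / real n)"
    using assms(1) by (simp add: complex_eq_iff)
  then obtain z :: int where z: "2 * pi * s / real n = 2 * pi * t / real n + 2 * pi * of_int z"
    unfolding sin_cos_eq_iff by auto
  have "2 * pi * s = 2 * pi * (t + real n * of_int z)"
    using arg_cong[OF z, of "\<lambda>x. x * real n"] assms(2) by (simp add: algebra_simps)
  then have "s = t + of_int (int n * z)" by simp
  then show thesis by (rule that)
qed

section \<open>The two stable systems attached to \<open>E\<close>\<close>

locale cyclic_spectrum = cyclic_generator G \<gamma> for G :: "('g, 'b) monoid_scheme" (structure) and \<gamma> +
  fixes E :: "('g, 'a) gspectrum" and k :: int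
  assumes E: "orthogonal_gspectrum G E"
begin

lemmas ES = gspectrum_spectrum[OF E]

text \<open>The least exponent and \<open>z\<close> differ by a multiple of the order, which amounts
  to whole turns.\<close>

lemma lambda1_pow:
  "lambda1 G \<gamma> (\<gamma> [^] (z::int)) s = cis (2 * pi * of_int z / real (order G)) * s"
proof -
  obtain w where "int (exponent (\<gamma> [^] z)) - z = int (order G) * w"
    using exponent_eq_pow[OF pow_in refl, of z] by (auto elim: dvdE)
  then have "int (exponent (\<gamma> [^] z)) = z + int (order G) * w" by simp
  then have "real_of_int (int (exponent (\<gamma> [^] z))) = of_int (z + int (order G) * w)" by (rule arg_cong)
  then have "2 * pi * real (exponent (\<gamma> [^] z)) / real (order G)
      = 2 * pi * of_int z / real (order G) + 2 * pi * of_int w"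
    using order_pos by (simp add: field_simps)
  then have "cis (2 * pi * real (exponent (\<gamma> [^] z)) / real (order G))
      = cis (2 * pi * of_int z / real (order G)) * cis (2 * pi * of_int w)"
    by (simp only: cis_mult)
  also have "cis (2 * pi * of_int w) = 1" by (rule cis_multiple_2pi) simp
  finally show ?thesis by (simp add: lambda1_def exponent_def)
qed

lemma circle_space: "locally_compact_space (top_of_set (sphere (0::complex) 1))" "Hausdorff_space (top_of_set (sphere (0::complex) 1))"
  by (auto intro!: compact_imp_locally_compact_space Hausdorff_space_subtopology simp: compact_space_subtopology)

lemma line_space: "locally_compact_space euclideanreal" "Hausdorff_space euclideanreal"
  by (simp_all add: locally_compact_space_euclidean)

lemma gspectrum_hnZ: "orthogonal_gspectrum G (spectrum_hnZ G \<gamma> E)"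
  unfolding spectrum_hnZ_def
proof (rule orthogonal_gspectrum_function_spectrum[OF is_group E circle_space])
  fix g assume g: "g \<in> carrier G"
  obtain z :: int where z: "g = \<gamma> [^] z" using g by (rule carrier_pow)
  show "continuous_map (top_of_set (sphere 0 1)) (top_of_set (sphere 0 1)) (lambda1 G \<gamma> g)"
    unfolding lambda1_pow z by (auto intro!: continuous_intros simp: norm_mult)
  fix h and s :: complex assume h: "h \<in> carrier G"
  obtain w :: int where w: "h = \<gamma> [^] w" using h by (rule carrier_pow)
  have "g \<otimes> h = \<gamma> [^] (z + w)" using generator(1) by (simp add: z w int_pow_mult)
  then show "lambda1 G \<gamma> (g \<otimes> h) s = lambda1 G \<gamma> g (lambda1 G \<gamma> h s)"
    by (simp add: z w lambda1_pow cis_mult add_divide_distrib distrib_left mult.assoc[symmetric] del: mult.assoc)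
next
  fix s :: complex
  show "lambda1 G \<gamma> \<one> s = s" using lambda1_pow[of 0 s] by simp
qed

lemma gspectrum_hZ: "orthogonal_gspectrum (singleton_group ()) (with_trivial_action (spectrum_hZ G \<gamma> E))"
proof -
  have "orthogonal_gspectrum integer_group (pullback_action (\<lambda>z::int. \<gamma> [^] z) E)"
    using hom_integer_group_pow[OF generator(1)]
    by (intro orthogonal_gspectrum_pullback_action[OF E]) auto
  then show ?thesis
    unfolding spectrum_hZ_def homotopy_fixed_points_Z_def
    by (intro orthogonal_gspectrum_with_trivial_action orthogonal_spectrum_fixed_points
        orthogonal_gspectrum_function_spectrum line_space) (auto intro!: continuous_intros)
qed

text \<open>\<open>T\<close> is the nonequivariant side, whose regular representation is the line;
  \<open>C\<close> below is the equivariant side.\<close>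

sublocale T: RO_graded "singleton_group ()" "with_trivial_action (spectrum_hZ G \<gamma> E)" "trivial_virtual_rep k"
  by (intro RO_graded.intro RO_graded_axioms.intro gspectrum_hZ) (auto simp: mat_id_in)

sublocale C: RO_graded G "spectrum_hnZ G \<gamma> E" "trivial_virtual_rep k"
  by (intro RO_graded.intro RO_graded_axioms.intro gspectrum_hnZ is_group finite_carrier) (auto simp: mat_id_in)

abbreviation "hZ \<equiv> with_trivial_action (spectrum_hZ G \<gamma> E)"
abbreviation "hnZ \<equiv> spectrum_hnZ G \<gamma> E"

text \<open>A stage of \<open>T\<close> adds one dimension and a stage of \<open>C\<close> adds
  \<open>order G\<close>, so stage \<open>i * (order G + order G)\<close> of \<open>T\<close> and
  stage \<open>2 * i\<close> of \<open>C\<close> have the same source and target dimensions. These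
  are the matched stages.\<close>

definition "sdim i = nat k + i * (order G + order G)"
definition "tdim i = nat (- k) + i * (order G + order G)"
definition "sframe i = snd (frame (nat k) i)"
definition "tframe i = snd (frame (nat (- k)) i)"

lemma stage_dims:
  "fst (T.src (i * (order G + order G))) = sdim i" "fst (T.tgt (i * (order G + order G))) = tdim i"
  "fst (C.src (2 * i)) = sdim i" "fst (C.tgt (2 * i)) = tdim i"
  by (simp_all add: sdim_def tdim_def)

lemma source_frame: "framed (C.src (2 * i)) (sdim i, sframe i)"
  using framed_frame[of "nat k" i] unfolding sframe_def
  by (simp add: sdim_def frame_def framed_def)

lemma target_frame: "framed (C.tgt (2 * i)) (tdim i, tframe i)"
  using framed_frame[of "nat (- k)" i] unfolding tframe_def
  by (simp add: tdim_def frame_def framed_def)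

lemma framedD:
  assumes "framed V (d, A)"
  shows "A t \<in> carrier (orthogonal_group d)" "mat_transpose (A t) \<in> carrier (orthogonal_group d)"
    "A (t + of_int z) = mat_mult d (snd V (\<gamma> [^] (z::int))) (A t)" "A (t + of_int (int (order G) * z)) = A t"
  using assms unfolding framed_def by auto

lemma framed_continuous:
  assumes "framed V (d, A)" "continuous_map X euclideanreal s"
  shows "continuous_map X (orthogonal_topology d) (\<lambda>x. A (s x))"
    "continuous_map X (orthogonal_topology d) (\<lambda>x. mat_transpose (A (s x)))"
proof -
  have "continuous_map euclideanreal euclideanreal (\<lambda>t. A t i j)" for i j
    using assms(1) by (simp add: framed_def)
  then have c: "continuous_map X euclideanreal (\<lambda>x. A (s x) i j)" for i j
    using continuous_map_compose[OF assms(2), of euclideanreal "\<lambda>t. A t i j"] unfolding o_def by blast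
  show "continuous_map X (orthogonal_topology d) (\<lambda>x. A (s x))"
    by (rule continuous_map_into_orthogonal) (use framedD(1)[OF assms(1)] c in auto)
  show "continuous_map X (orthogonal_topology d) (\<lambda>x. mat_transpose (A (s x)))"
    by (rule continuous_map_into_orthogonal) (use framedD(2)[OF assms(1)] c in \<open>auto simp: mat_transpose_def\<close>)
qed

lemma sphere_act_inverse:
  assumes "A \<in> carrier (orthogonal_group d)" "v \<in> topspace (rep_sphere d)"
  shows "sphere_act d (mat_transpose A) (sphere_act d A v) = v"
  using mat_mult_transpose[OF assms(1)] sphere_act_id[OF assms(2)] by (simp flip: sphere_act_mult)

text \<open>Being fixed under conjugation reads \<open>p t = \<gamma>^z p (t - z)\<close>;
  substituting \<open>t + z\<close> for \<open>t\<close> presents the homotopy fixed points as paths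
  whose monodromy is the generator.\<close>

lemma hZ_level:
  "p \<in> topspace (level hZ e) \<longleftrightarrow> continuous_map euclideanreal (level E e) p \<and>
    (\<forall>z t. p (t + of_int z) = group_act E e (\<gamma> [^] (z::int)) (p t))"
proof -
  have "(\<forall>z::int. (\<lambda>s. group_act E e (\<gamma> [^] z) (p (s - of_int z))) = p) \<longleftrightarrow>
      (\<forall>z t. p (t + of_int z) = group_act E e (\<gamma> [^] (z::int)) (p t))"
    unfolding fun_eq_iff by (metis add_diff_cancel_right' diff_add_cancel)
  then show ?thesis
    by (auto simp: spectrum_hZ_def homotopy_fixed_points_Z_def topspace_mapping_space restrict_UNIV)
qed

lemma hZ_base: "base_pt hZ e = (\<lambda>t. base_pt E e)"
  by (simp add: spectrum_hZ_def homotopy_fixed_points_Z_def restrict_UNIV)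

lemma hZ_apply_in: "p \<in> topspace (level hZ e) \<Longrightarrow> p t \<in> topspace (level E e)"
  unfolding hZ_level by (auto simp: continuous_map_def)

lemma hZ_continuous_curry:
  assumes "\<And>x. x \<in> topspace Z \<Longrightarrow> f x \<in> topspace (level hZ e)"
    and "continuous_map (prod_topology Z euclideanreal) (level E e) (\<lambda>(x, t). f x t)"
  shows "continuous_map Z (level hZ e) f"
proof -
  have "continuous_map Z (mapping_space euclideanreal (level E e)) f"
    by (rule continuous_map_mapping_space_curry) (use assms(2) in auto)
  then show ?thesis
    using assms(1)
    by (auto simp: spectrum_hZ_def homotopy_fixed_points_Z_def continuous_map_in_subtopology)
qed

lemma hZ_continuous_apply:
  assumes "continuous_map Z (level hZ e) f" "continuous_map Z euclideanreal s"
  shows "continuous_map Z (level E e) (\<lambda>z. f z (s z))"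
proof (rule continuous_map_mapping_space_apply[OF line_space _ assms(2)])
  show "continuous_map Z (mapping_space euclideanreal (level E e)) f"
    using assms(1) by (auto simp: spectrum_hZ_def homotopy_fixed_points_Z_def continuous_map_in_subtopology)
qed

lemma hnZ_level: "level hnZ e = mapping_space (top_of_set (sphere 0 1)) (level E e)"
  by (simp add: spectrum_hnZ_def)

lemma hnZ_base: "base_pt hnZ e = (\<lambda>s\<in>sphere 0 1. base_pt E e)"
  by (simp add: spectrum_hnZ_def)

lemma hnZ_apply_in: "p \<in> topspace (level hnZ e) \<Longrightarrow> s \<in> sphere 0 1 \<Longrightarrow> p s \<in> topspace (level E e)"
  unfolding hnZ_level by (rule mapping_space_apply_in) auto

lemma hnZ_act:
  "orth_act hnZ e W (group_act hnZ e g p) =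
    (\<lambda>s\<in>sphere 0 1. orth_act E e W (group_act E e g (p (lambda1 G \<gamma> (inv g) s))))"
  by (auto simp: spectrum_hnZ_def fun_eq_iff)

lemma pow_order_multiple: "\<gamma> [^] (int (order G) * z) = \<one>"
  using pow_eq_iff[of "int (order G) * z" 0] by simp

text \<open>Inverse of the untwisting formula: source and target frames conjugate the part of
  \<open>f\<close> at time \<open>t\<close>, with the transpose as inverse on the source. The result
  is still a function on the line.\<close>

definition twist :: "nat \<Rightarrow> (sphere_pt \<Rightarrow> real \<Rightarrow> 'a) \<Rightarrow> sphere_pt \<Rightarrow> real \<Rightarrow> 'a" where
  "twist i f v t = orth_act E (tdim i) (tframe i t) (f (sphere_act (sdim i) (mat_transpose (sframe i t)) v) t)"

text \<open>A section of the covering \<open>t \<mapsto> cis (2 * pi * t / n)\<close>, with a jump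
  at the negative real axis. The jump is invisible in \<open>descend\<close> because twisted maps
  have period \<open>order G\<close>.\<close>

definition angle :: "complex \<Rightarrow> real" where
  "angle s = real (order G) * Arg s / (2 * pi)"

definition descend :: "nat \<Rightarrow> (sphere_pt \<Rightarrow> real \<Rightarrow> 'a) \<Rightarrow> sphere_pt \<Rightarrow> complex \<Rightarrow> 'a" where
  "descend i f v = (\<lambda>s\<in>sphere 0 1. twist i f v (angle s))"

definition untwist :: "nat \<Rightarrow> (sphere_pt \<Rightarrow> complex \<Rightarrow> 'a) \<Rightarrow> sphere_pt \<Rightarrow> real \<Rightarrow> 'a" where
  "untwist i h v t = orth_act E (tdim i) (mat_transpose (tframe i t))
     (h (sphere_act (sdim i) (sframe i t) v) (cis (2 * pi * t / real (order G))))"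

lemmas sframe = framedD[OF source_frame] and tframe = framedD[OF target_frame]

lemma angle: "s \<in> sphere 0 1 \<Longrightarrow> cis (2 * pi * angle s / real (order G)) = s"
  using order_pos cis_Arg[of s] by (force simp: angle_def sgn_eq)

text \<open>Over a full period \<open>f\<close> picks up the generator to the power
  \<open>order G\<close>, which is the identity, and the frames return to themselves.\<close>

lemma twist_periodic:
  assumes "T.stage_pointed (i * (order G + order G)) f"
  shows "twist i f v (t + of_int (int (order G) * z)) = twist i f v t"
proof -
  let ?w = "sphere_act (sdim i) (mat_transpose (sframe i t)) v"
  have p: "f ?w \<in> topspace (level hZ (tdim i))"
    using assms sphere_act_in[OF sframe(2)] unfolding T.stage_pointed_def stage_dims by blast
  then have "f ?w (t + of_int (int (order G) * z)) = group_act E (tdim i) \<one> (f ?w t)"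
    unfolding hZ_level pow_order_multiple[symmetric, of z] by blast
  then show ?thesis
    using group_act_one[OF E hZ_apply_in[OF p]] unfolding twist_def sframe(4) tframe(4) by simp
qed

lemma twist_cis:
  assumes "T.stage_pointed (i * (order G + order G)) f"
    and "cis (2 * pi * s / real (order G)) = cis (2 * pi * t / real (order G))"
  shows "twist i f v s = twist i f v t"
  using cis_eq_imp_int[OF assms(2) order_pos] twist_periodic[OF assms(1)] by metis

lemma descend_cis:
  assumes "T.stage_pointed (i * (order G + order G)) f"
  shows "descend i f v (cis (2 * pi * t / real (order G))) = twist i f v t"
proof -
  have "cis (2 * pi * t / real (order G)) \<in> sphere 0 1" by simp
  then show ?thesis
    unfolding descend_def by (simp add: twist_cis[OF assms angle])
qed

text \<open>Moving time by \<open>z\<close> multiplies the source frame by the matrix of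
  \<open>\<gamma>^z\<close>, which cancels the action on \<open>v\<close>; the target frame
  contributes the matrix on the right, and \<open>f\<close> the group action. This is equivariance
  over the circle, seen on the line.\<close>

lemma twist_translate:
  fixes z :: int
  assumes f: "T.stage_pointed (i * (order G + order G)) f" and v: "v \<in> topspace (rep_sphere (sdim i))"
  shows "twist i f (sphere_act (sdim i) (snd (C.src (2 * i)) (\<gamma> [^] z)) v) (t + of_int z) =
    orth_act E (tdim i) (snd (C.tgt (2 * i)) (\<gamma> [^] z)) (group_act E (tdim i) (\<gamma> [^] z) (twist i f v t))"
proof -
  let ?V = "snd (C.src (2 * i)) (\<gamma> [^] z)" and ?W = "snd (C.tgt (2 * i)) (\<gamma> [^] z)"
  have V: "?V \<in> carrier (orthogonal_group (sdim i))" and W: "?W \<in> carrier (orthogonal_group (tdim i))"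
    using funcset_mem[OF C.src_matrices[of "2 * i"] pow_in[of z]] funcset_mem[OF C.tgt_matrices[of "2 * i"] pow_in[of z]]
    unfolding stage_dims .
  let ?w = "sphere_act (sdim i) (mat_transpose (sframe i t)) v"
  have p: "f ?w \<in> topspace (level hZ (tdim i))"
    using f sphere_act_in[OF sframe(2)] unfolding T.stage_pointed_def stage_dims by blast
  have dims: "fst (C.src (2 * i)) = sdim i" "fst (C.tgt (2 * i)) = tdim i" by (fact stage_dims)+
  have "sphere_act (sdim i) (mat_transpose (sframe i (t + of_int z))) (sphere_act (sdim i) ?V v) = ?w"
    unfolding sframe(3)[of i t z] mat_transpose_mult sphere_act_mult sphere_act_inverse[OF V v] ..
  moreover have "f ?w (t + of_int z) = group_act E (tdim i) (\<gamma> [^] z) (f ?w t)"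
    using p unfolding hZ_level by blast
  ultimately have "twist i f (sphere_act (sdim i) ?V v) (t + of_int z) =
      orth_act E (tdim i) (mat_mult (tdim i) ?W (tframe i t)) (group_act E (tdim i) (\<gamma> [^] z) (f ?w t))"
    unfolding twist_def tframe(3)[of i t z] by simp
  also have "\<dots> = orth_act E (tdim i) ?W (orth_act E (tdim i) (tframe i t) (group_act E (tdim i) (\<gamma> [^] z) (f ?w t)))"
    by (rule orth_act_mult[OF ES W tframe(1) group_act_in[OF E pow_in hZ_apply_in[OF p]]])
  also have "orth_act E (tdim i) (tframe i t) (group_act E (tdim i) (\<gamma> [^] z) (f ?w t)) =
      group_act E (tdim i) (\<gamma> [^] z) (orth_act E (tdim i) (tframe i t) (f ?w t))"
    by (rule group_act_orth_act[OF E pow_in tframe(1) hZ_apply_in[OF p], symmetric])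
  finally show ?thesis unfolding twist_def .
qed

lemma untwist_descend:
  assumes f: "T.stage_pointed (i * (order G + order G)) f" and v: "v \<in> topspace (rep_sphere (sdim i))"
  shows "untwist i (descend i f) v = f v"
proof
  fix t
  have p: "f v \<in> topspace (level hZ (tdim i))"
    using f v unfolding T.stage_pointed_def stage_dims by blast
  have "untwist i (descend i f) v t = orth_act E (tdim i) (mat_transpose (tframe i t))
      (orth_act E (tdim i) (tframe i t) (f v t))"
    unfolding untwist_def descend_cis[OF f] twist_def sphere_act_inverse[OF sframe(1) v] ..
  then show "untwist i (descend i f) v t = f v t"
    using orth_act_inverse(1)[OF ES tframe(1,2) hZ_apply_in[OF p]] by simp
qed

lemma descend_untwist:
  assumes h: "C.stage_pointed (2 * i) h" and v: "v \<in> topspace (rep_sphere (sdim i))"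
  shows "descend i (untwist i h) v = h v"
proof -
  have p: "h v \<in> topspace (level hnZ (tdim i))"
    using h v unfolding C.stage_pointed_def stage_dims by blast
  have "twist i (untwist i h) v (angle s) = h v s" if s: "s \<in> sphere 0 1" for s
    using sphere_act_inverse[OF sframe(2) v, of "angle s"] orth_act_inverse(2)[OF ES tframe(1,2) hnZ_apply_in[OF p s]]
    unfolding twist_def untwist_def angle[OF s] by simp
  then show ?thesis
    using p mapping_space_eqI[of "h v" "top_of_set (sphere 0 1)"] unfolding descend_def hnZ_level by simp
qed

end

lemma mat_mult_id_right:
  assumes "\<And>i j. d \<le> j \<Longrightarrow> A i j = 0"
  shows "mat_mult d A (mat_id d) = A"
proof -
  have "mat_mult d (mat_id d) (mat_transpose A) = mat_transpose A"
    by (rule mat_mult_id_left) (use assms in \<open>simp add: mat_transpose_def\<close>)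
  then have "mat_transpose (mat_mult d A (mat_id d)) = mat_transpose A"
    by (simp add: mat_transpose_mult mat_transpose_id)
  then show ?thesis by (metis mat_transpose_transpose)
qed

section \<open>The isomorphism\<close>

context cyclic_spectrum
begin

abbreviation "period \<equiv> order G + order G"

text \<open>The stages of the trivial group act by identity matrices, so only the base point
  condition remains.\<close>

lemma T_equivariant:
  assumes "\<And>v. v \<in> topspace (rep_sphere (fst (T.src m))) \<Longrightarrow> f v \<in> topspace (level hZ (fst (T.tgt m)))"
  shows "equivariant_pointed (singleton_group ()) hZ (T.src m) (T.tgt m) f \<longleftrightarrow> f None = base_pt hZ (fst (T.tgt m))"
  unfolding equivariant_pointed_def trivial_virtual_rep_simps stage_rep_singleton_group
  using assms orth_act_id[OF T.spectrum] sphere_act_id by auto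

lemma lambda1_inv_cis:
  "lambda1 G \<gamma> (inv (\<gamma> [^] (z::int))) (cis (2 * pi * t / real (order G))) =
    cis (2 * pi * (t - of_int z) / real (order G))"
proof -
  have "inv (\<gamma> [^] z) = \<gamma> [^] (- z)" using generator(1) by (simp add: int_pow_neg)
  then show ?thesis by (simp add: lambda1_pow cis_mult diff_divide_distrib algebra_simps)
qed

lemma descend_None:
  assumes "f None = base_pt hZ (tdim i)"
  shows "descend i f None = base_pt hnZ (tdim i)"
  unfolding descend_def twist_def hnZ_base sphere_act_simps assms hZ_base orth_act_base[OF ES tframe(1)] ..

lemma descend_equivariant:
  assumes f: "T.stage_pointed (i * period) f"
  shows "equivariant_pointed G hnZ (C.src (2 * i)) (C.tgt (2 * i)) (descend i f)"
  unfolding equivariant_pointed_def stage_dims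
proof (intro conjI ballI)
  show "descend i f None = base_pt hnZ (tdim i)"
    using f unfolding T.stage_pointed_def stage_dims by (blast intro: descend_None)
  fix g v assume g: "g \<in> carrier G" and v: "v \<in> topspace (rep_sphere (sdim i))"
  obtain z :: int where z: "g = \<gamma> [^] z" using g by (rule carrier_pow)
  have "descend i f (sphere_act (sdim i) (snd (C.src (2 * i)) g) v) s =
      orth_act E (tdim i) (snd (C.tgt (2 * i)) g) (group_act E (tdim i) g (descend i f v (lambda1 G \<gamma> (inv g) s)))"
    if s: "s \<in> sphere 0 1" for s
  proof -
    \<comment> \<open>A time lying over the point to which the inverse of \<open>g\<close> moves
      \<open>s\<close>. It may differ from the value of \<open>angle\<close> there, which
      \<open>descend_cis\<close> allows.\<close>
    let ?t = "angle s - of_int z"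
    have "lambda1 G \<gamma> (inv g) s = cis (2 * pi * ?t / real (order G))"
      using lambda1_inv_cis[of z "angle s"] unfolding angle[OF s] z .
    then have "descend i f v (lambda1 G \<gamma> (inv g) s) = twist i f v ?t"
      by (simp only: descend_cis[OF f])
    moreover have "descend i f (sphere_act (sdim i) (snd (C.src (2 * i)) g) v) s =
        twist i f (sphere_act (sdim i) (snd (C.src (2 * i)) g) v) (?t + of_int z)"
      using s by (simp add: descend_def)
    ultimately show ?thesis
      using twist_translate[OF f v, of z ?t] unfolding z by (simp only:)
  qed
  then show "descend i f (sphere_act (sdim i) (snd (C.src (2 * i)) g) v) =
      orth_act hnZ (tdim i) (snd (C.tgt (2 * i)) g) (group_act hnZ (tdim i) g (descend i f v))"
    unfolding hnZ_act by (auto simp: descend_def fun_eq_iff)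
qed

lemma descend_cong:
  assumes "\<And>v. v \<in> topspace (rep_sphere (sdim i)) \<Longrightarrow> f v = f' v"
  shows "descend i f u = descend i f' u"
  unfolding descend_def twist_def using assms[OF sphere_act_in[OF sframe(2)]] by simp

lemma untwist_cong:
  assumes "\<And>v. v \<in> topspace (rep_sphere (sdim i)) \<Longrightarrow> f v = f' v"
  shows "untwist i f u = untwist i f' u"
  unfolding untwist_def using assms[OF sphere_act_in[OF sframe(1)]] by auto

text \<open>\<open>Arg\<close> is at most pi in absolute value, so \<open>angle\<close> takes values
  in the interval, which therefore covers the circle. A compact interval is taken in place of the
  line to make the covering proper, as \<open>continuous_map_prod_descend\<close> requires.\<close>

lemma circle_quotient:
  defines "K \<equiv> {- real (order G)..real (order G)}" and "q \<equiv> \<lambda>t. cis (2 * pi * t / real (order G))"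
  shows "compact_space (top_of_set K)" "continuous_map (top_of_set K) (top_of_set (sphere 0 1)) q"
    "q ` topspace (top_of_set K) = topspace (top_of_set (sphere 0 1))"
proof -
  show "compact_space (top_of_set K)" by (simp add: K_def compact_space_subtopology)
  show "continuous_map (top_of_set K) (top_of_set (sphere 0 1)) q"
    using order_pos by (auto simp: q_def intro!: continuous_intros)
  have "s \<in> q ` K" if s: "s \<in> sphere 0 1" for s
  proof -
    have "\<bar>Arg s\<bar> \<le> pi" using Arg_bounded[of s] by linarith
    then have "\<bar>Arg s\<bar> / (2 * pi) \<le> 1" using pi_gt_zero by (simp add: divide_le_eq)
    moreover have "\<bar>angle s\<bar> = real (order G) * (\<bar>Arg s\<bar> / (2 * pi))"
      by (simp add: angle_def abs_mult)
    ultimately have "\<bar>angle s\<bar> \<le> real (order G)" by (simp only: mult_left_le of_nat_0_le_iff)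
    then have "angle s \<in> K" by (auto simp: K_def)
    then show ?thesis using angle[OF s] by (force simp: q_def)
  qed
  then show "q ` topspace (top_of_set K) = topspace (top_of_set (sphere 0 1))"
    by (auto simp: q_def)
qed

text \<open>Continuity cannot be read off the formula, since \<open>angle\<close> jumps. The twisted
  homotopy is continuous in time over a compact interval and periodic, so it passes to the
  circle.\<close>

lemma descend_homotopic:
  assumes "T.stage_homotopic (i * period) f g"
  shows "C.stage_homotopic (2 * i) (descend i f) (descend i g)"
proof -
  let ?I = "top_of_set {0..1::real}" and ?S = "rep_sphere (sdim i)"
  let ?Q = "top_of_set (sphere (0::complex) 1)" and ?K = "top_of_set {- real (order G)..real (order G)}"
  obtain h where h: "continuous_map (prod_topology ?I ?S) (level hZ (tdim i)) h"
      "\<And>v. v \<in> topspace ?S \<Longrightarrow> h (0, v) = f v" "\<And>v. v \<in> topspace ?S \<Longrightarrow> h (1, v) = g v"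
      "\<And>u. u \<in> {0..1} \<Longrightarrow> equivariant_pointed (singleton_group ()) hZ (T.src (i * period)) (T.tgt (i * period)) (\<lambda>v. h (u, v))"
    using assms unfolding ghomotopic_iff[OF T.src_matrices] stage_dims by blast
  have p: "T.stage_pointed (i * period) (\<lambda>v. h (u, v))" if "u \<in> {0..1}" for u
    using h(4)[OF that] continuous_map_image_subset_topspace[OF h(1)] that
    unfolding T.stage_pointed_def equivariant_pointed_def stage_dims by auto
  let ?tw = "\<lambda>x t. twist i (\<lambda>w. h (fst x, w)) (snd x) t"
  let ?Z = "prod_topology (prod_topology ?I ?S) ?K"
  have ct: "continuous_map ?Z euclideanreal snd"
    using continuous_map_snd[of "prod_topology ?I ?S" ?K] by (rule continuous_map_into_fulltopology)
  have "continuous_map ?Z (prod_topology ?I ?S)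
      (\<lambda>z. (fst (fst z), sphere_act (sdim i) (mat_transpose (sframe i (snd z))) (snd (fst z))))"
    using continuous_map_compose[OF continuous_map_fst continuous_map_fst, of ?I ?S ?K]
      continuous_map_compose[OF continuous_map_fst continuous_map_snd, of ?I ?S ?K]
    by (intro continuous_map_pairedI continuous_map_sphere_act framed_continuous(2)[OF source_frame ct])
       (simp_all add: o_def)
  from continuous_map_compose[OF this h(1)]
  have "continuous_map ?Z (level E (tdim i))
      (\<lambda>z. h (fst (fst z), sphere_act (sdim i) (mat_transpose (sframe i (snd z))) (snd (fst z))) (snd z))"
    by (intro hZ_continuous_apply ct) (simp add: o_def)
  then have c: "continuous_map ?Z (level E (tdim i)) (\<lambda>z. ?tw (fst z) (snd z))"
    unfolding twist_def by (rule continuous_map_orth_act[OF ES framed_continuous(1)[OF target_frame ct]])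
  have "continuous_map (prod_topology (prod_topology ?I ?S) ?Q) (level E (tdim i)) (\<lambda>(x, s). ?tw x (angle s))"
  proof (rule continuous_map_prod_descend[OF circle_quotient(1) circle_space(2) circle_quotient(2,3)])
    show "continuous_map ?Z (level E (tdim i)) (\<lambda>(x, t). (\<lambda>(x, s). ?tw x (angle s)) (x, cis (2 * pi * t / real (order G))))"
    proof (rule continuous_map_eq[OF c])
      fix z assume z: "z \<in> topspace ?Z"
      have "cis (2 * pi * snd z / real (order G)) \<in> sphere 0 1" by simp
      from twist_cis[OF p angle[OF this]] z
      show "?tw (fst z) (snd z) = (case z of (x, t) \<Rightarrow> (\<lambda>(x, s). ?tw x (angle s)) (x, cis (2 * pi * t / real (order G))))"
        by auto
    qed
  qed
  from continuous_map_mapping_space_restrict[OF this]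
  have cont: "continuous_map (prod_topology ?I ?S) (level hnZ (tdim i)) (\<lambda>(u, v). descend i (\<lambda>w. h (u, w)) v)"
    unfolding hnZ_level descend_def by (simp add: case_prod_beta')
  show ?thesis
    unfolding ghomotopic_iff[OF C.src_matrices] stage_dims
  proof (intro exI[of _ "\<lambda>(u, v). descend i (\<lambda>w. h (u, w)) v"] conjI cont ballI)
    fix v assume "v \<in> topspace ?S"
    show "(\<lambda>(u, v). descend i (\<lambda>w. h (u, w)) v) (0, v) = descend i f v"
      "(\<lambda>(u, v). descend i (\<lambda>w. h (u, w)) v) (1, v) = descend i g v"
      using descend_cong[OF h(2)] descend_cong[OF h(3)] by auto
  next
    fix u :: real assume u: "u \<in> {0..1}"
    show "equivariant_pointed G hnZ (C.src (2 * i)) (C.tgt (2 * i)) (\<lambda>v. (\<lambda>(u, v). descend i (\<lambda>w. h (u, w)) v) (u, v))"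
      using descend_equivariant[OF p[OF u]] by simp
  qed
qed

text \<open>Equivariance of \<open>h\<close> converts the monodromy of the source frame into the
  target matrix and the group action; the target matrix is then cancelled by the monodromy of the
  transposed target frame.\<close>

lemma untwist_translate:
  fixes z :: int
  assumes h: "equivariant_pointed G hnZ (C.src (2 * i)) (C.tgt (2 * i)) h" "C.stage_pointed (2 * i) h"
    and v: "v \<in> topspace (rep_sphere (sdim i))"
  shows "untwist i h v (t + of_int z) = group_act E (tdim i) (\<gamma> [^] z) (untwist i h v t)"
proof -
  let ?V = "snd (C.src (2 * i)) (\<gamma> [^] z)" and ?W = "snd (C.tgt (2 * i)) (\<gamma> [^] z)"
  let ?s = "\<lambda>t. cis (2 * pi * t / real (order G))" and ?w = "sphere_act (sdim i) (sframe i t) v"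
  let ?B = "\<lambda>t. mat_transpose (tframe i t)"
  have W: "?W \<in> carrier (orthogonal_group (tdim i))"
    using funcset_mem[OF C.tgt_matrices[of "2 * i"] pow_in[of z]] unfolding stage_dims .
  have w: "?w \<in> topspace (rep_sphere (sdim i))" by (rule sphere_act_in[OF sframe(1)])
  have y: "h ?w (?s t) \<in> topspace (level E (tdim i))"
    using h(2) w unfolding C.stage_pointed_def stage_dims by (intro hnZ_apply_in) auto
  have "h (sphere_act (sdim i) (sframe i (t + of_int z)) v) = h (sphere_act (sdim i) ?V ?w)"
    unfolding sframe(3)[of i t z] sphere_act_mult ..
  also have "\<dots> = orth_act hnZ (tdim i) ?W (group_act hnZ (tdim i) (\<gamma> [^] z) (h ?w))"
    using h(1) w pow_in unfolding equivariant_pointed_def stage_dims by blast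
  finally have "h (sphere_act (sdim i) (sframe i (t + of_int z)) v) (?s (t + of_int z)) =
      orth_act E (tdim i) ?W (group_act E (tdim i) (\<gamma> [^] z) (h ?w (?s t)))"
    unfolding hnZ_act using lambda1_inv_cis[of z "t + of_int z"] by simp
  then have "untwist i h v (t + of_int z) = orth_act E (tdim i) (mat_mult (tdim i) (?B (t + of_int z)) ?W)
      (group_act E (tdim i) (\<gamma> [^] z) (h ?w (?s t)))"
    unfolding untwist_def
    using orth_act_mult[OF ES tframe(2) W group_act_in[OF E pow_in y]] by simp
  \<comment> \<open>The transposed frame at time \<open>t + z\<close> is the one at time
    \<open>t\<close> followed on the right by the transpose of \<open>?W\<close>.\<close>
  also have "mat_mult (tdim i) (?B (t + of_int z)) ?W = ?B t"
    unfolding tframe(3)[of i t z] mat_transpose_mult mat_mult_assoc mat_mult_transpose[OF W]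
    by (rule mat_mult_id_right) (use orthogonal_vanishes[OF tframe(2)] in auto)
  also have "orth_act E (tdim i) (?B t) (group_act E (tdim i) (\<gamma> [^] z) (h ?w (?s t))) =
      group_act E (tdim i) (\<gamma> [^] z) (orth_act E (tdim i) (?B t) (h ?w (?s t)))"
    by (rule group_act_orth_act[OF E pow_in tframe(2) y, symmetric])
  finally show ?thesis unfolding untwist_def .
qed

text \<open>The circle is pulled back to the line along a continuous map, so continuity follows by
  evaluation and currying. That the values lie in the fixed points is
  \<open>untwist_translate\<close>.\<close>

lemma untwist_homotopic:
  assumes "C.stage_homotopic (2 * i) f g"
  shows "T.stage_homotopic (i * period) (untwist i f) (untwist i g)"
proof -
  let ?I = "top_of_set {0..1::real}" and ?S = "rep_sphere (sdim i)"
  let ?Q = "top_of_set (sphere (0::complex) 1)"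
  obtain h where h: "continuous_map (prod_topology ?I ?S) (level hnZ (tdim i)) h"
      "\<And>v. v \<in> topspace ?S \<Longrightarrow> h (0, v) = f v" "\<And>v. v \<in> topspace ?S \<Longrightarrow> h (1, v) = g v"
      "\<And>u. u \<in> {0..1} \<Longrightarrow> equivariant_pointed G hnZ (C.src (2 * i)) (C.tgt (2 * i)) (\<lambda>v. h (u, v))"
    using assms unfolding ghomotopic_iff[OF C.src_matrices] stage_dims by blast
  have p: "C.stage_pointed (2 * i) (\<lambda>v. h (u, v))" if "u \<in> {0..1}" for u
    using h(4)[OF that] continuous_map_image_subset_topspace[OF h(1)] that
    unfolding C.stage_pointed_def equivariant_pointed_def stage_dims by auto
  let ?Z = "prod_topology (prod_topology ?I ?S) euclideanreal"
  let ?s = "\<lambda>t. cis (2 * pi * t / real (order G))"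
  let ?ut = "\<lambda>(u, v). untwist i (\<lambda>w. h (u, w)) v"
  have ct: "continuous_map ?Z euclideanreal snd" by (rule continuous_map_snd)
  have "continuous_map euclideanreal ?Q ?s"
    unfolding continuous_map_in_subtopology using order_pos by (auto intro!: continuous_intros)
  from continuous_map_compose[OF ct this] have cs: "continuous_map ?Z ?Q (\<lambda>z. ?s (snd z))"
    by (simp add: o_def)
  have "continuous_map ?Z (prod_topology ?I ?S)
      (\<lambda>z. (fst (fst z), sphere_act (sdim i) (sframe i (snd z)) (snd (fst z))))"
    using continuous_map_compose[OF continuous_map_fst continuous_map_fst, of ?I ?S euclideanreal]
      continuous_map_compose[OF continuous_map_fst continuous_map_snd, of ?I ?S euclideanreal]
    by (intro continuous_map_pairedI continuous_map_sphere_act framed_continuous(1)[OF source_frame ct])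
       (simp_all add: o_def)
  from continuous_map_compose[OF this h(1)]
  have "continuous_map ?Z (mapping_space ?Q (level E (tdim i)))
      (\<lambda>z. h (fst (fst z), sphere_act (sdim i) (sframe i (snd z)) (snd (fst z))))"
    unfolding hnZ_level by (simp add: o_def)
  from continuous_map_mapping_space_apply[OF circle_space this cs]
  have "continuous_map ?Z (level E (tdim i))
      (\<lambda>z. h (fst (fst z), sphere_act (sdim i) (sframe i (snd z)) (snd (fst z))) (?s (snd z)))" .
  from continuous_map_orth_act[OF ES framed_continuous(2)[OF target_frame ct] this]
  have c: "continuous_map ?Z (level E (tdim i)) (\<lambda>(x, t). ?ut x t)"
    by (simp add: untwist_def case_prod_beta')
  have mem: "?ut x \<in> topspace (level hZ (tdim i))" if x: "x \<in> topspace (prod_topology ?I ?S)" for x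
  proof -
    obtain u v where uv: "x = (u, v)" "u \<in> {0..1}" "v \<in> topspace ?S" using x by auto
    have "continuous_map euclideanreal ?Z (\<lambda>t. (x, t))"
      using x by (intro continuous_map_pairedI) auto
    from continuous_map_compose[OF this c] have "continuous_map euclideanreal (level E (tdim i)) (?ut x)"
      by (simp add: o_def)
    then show ?thesis
      using untwist_translate[OF h(4) p uv(3), OF uv(2,2)] unfolding hZ_level uv(1) by simp
  qed
  have cont: "continuous_map (prod_topology ?I ?S) (level hZ (tdim i)) ?ut"
    by (rule hZ_continuous_curry[OF mem c])
  show ?thesis
    unfolding ghomotopic_iff[OF T.src_matrices] stage_dims
  proof (intro exI[of _ ?ut] conjI cont ballI)
    fix v assume "v \<in> topspace ?S"
    show "?ut (0, v) = untwist i f v" "?ut (1, v) = untwist i g v"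
      using untwist_cong[OF h(2)] untwist_cong[OF h(3)] by auto
  next
    fix u :: real assume u: "u \<in> {0..1}"
    have m: "?ut (u, v) \<in> topspace (level hZ (fst (T.tgt (i * period))))"
      if "v \<in> topspace (rep_sphere (fst (T.src (i * period))))" for v
      using mem[of "(u, v)"] that u unfolding stage_dims by simp
    have "h (u, None) = base_pt hnZ (tdim i)"
      using h(4)[OF u] unfolding equivariant_pointed_def stage_dims by blast
    then have "?ut (u, None) = base_pt hZ (tdim i)"
      unfolding hZ_base using orth_act_base[OF ES tframe(2)] by (auto simp: untwist_def hnZ_base fun_eq_iff)
    then show "equivariant_pointed (singleton_group ()) hZ (T.src (i * period)) (T.tgt (i * period)) (\<lambda>v. ?ut (u, v))"
      using T_equivariant[of "i * period" "\<lambda>v. ?ut (u, v)", OF m] unfolding stage_dims by simp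
  qed
qed

text \<open>\<open>untwist\<close> undoes \<open>descend\<close> on pointed functions, and both
  preserve homotopies. With \<open>g = f\<close> the equivalence says that
  \<open>descend i f\<close> is a stable map exactly when \<open>f\<close> is.\<close>

lemma stage_homotopic_descend_iff:
  assumes "T.stage_pointed (i * period) f" "T.stage_pointed (i * period) g"
  shows "C.stage_homotopic (2 * i) (descend i f) (descend i g) \<longleftrightarrow> T.stage_homotopic (i * period) f g"
proof
  assume "C.stage_homotopic (2 * i) (descend i f) (descend i g)"
  from untwist_homotopic[OF this] show "T.stage_homotopic (i * period) f g"
    using T.stage_homotopic_cong[of "i * period" "untwist i (descend i f)" f "untwist i (descend i g)" g]
      untwist_descend[OF assms(1)] untwist_descend[OF assms(2)] unfolding stage_dims by blast
qed (rule descend_homotopic)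

text \<open>The frames of stage \<open>i + l\<close> are those of stage \<open>i\<close> plus one
  and the same block on the new coordinates of source and target. Since structure maps are
  equivariant, this block acts on the added sphere by a matrix and by its inverse, and drops
  out.\<close>

lemma descend_stab:
  assumes f: "(i * period, f) \<in> stable_maps (singleton_group ()) (trivial_virtual_rep k) hZ"
    and v: "v \<in> topspace (rep_sphere (sdim (i + l)))"
  shows "descend (i + l) (T.stab (i * period) (l * period) f) v = C.stab (2 * i) (2 * l) (descend i f) v"
proof -
  let ?N = "l * period" and ?R = "snd (rep_multiple l fourier_frame)"
  have sd: "sdim (i + l) = sdim i + ?N" and td: "tdim (i + l) = tdim i + ?N"
    by (simp_all add: sdim_def tdim_def algebra_simps)
  have sf: "sframe (i + l) t = mat_sum (sdim i) (sframe i t) (?R t)"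
    and tf: "tframe (i + l) t = mat_sum (tdim i) (tframe i t) (?R t)" for t
    unfolding sframe_def tframe_def frame_add snd_rep_sum by (simp_all add: frame_def sdim_def tdim_def)
  have R: "?R t \<in> carrier (orthogonal_group ?N)" "mat_transpose (?R t) \<in> carrier (orthogonal_group ?N)" for t
  proof -
    have "fst (rep_multiple l (rep_multiple 2 (regular_rep G))) = ?N" by simp
    then show "?R t \<in> carrier (orthogonal_group ?N)" "mat_transpose (?R t) \<in> carrier (orthogonal_group ?N)"
      using framed_multiple[OF framed_fourier, of l] unfolding framed_def by metis+
  qed
  have N: "2 * l * order G = ?N" by simp
  obtain u w where u: "u \<in> topspace (rep_sphere (sdim i))" and w: "w \<in> topspace (rep_sphere ?N)"
      and uw: "v = sphere_smash (sdim i) u w"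
    using v unfolding sd by (rule sphere_smash_cases)
  have p: "T.stage_pointed (i * period) f" by (rule T.stable_maps_pointed[OF f])
  have "C.stage_homotopic (2 * i) (descend i f) (descend i f)"
    using f unfolding T.stable_maps_iff by (rule descend_homotopic)
  then have q: "C.stage_pointed (2 * i) (descend i f)"
    using C.stable_maps_iff C.stable_maps_pointed by blast
  have "C.stab (2 * i) (2 * l) (descend i f) v = structure_map hnZ (tdim i) ?N (descend i f u) w"
    unfolding uw stage_dims N
    using q u w unfolding C.stage_pointed_def stage_dims by (intro stabilize_smash[OF C.spectrum]) blast+
  also have "\<dots> = (\<lambda>s\<in>sphere 0 1. structure_map E (tdim i) ?N (descend i f u s) w)"
    by (simp add: spectrum_hnZ_def)
  also have "\<dots> = descend (i + l) (T.stab (i * period) ?N f) v"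
    unfolding descend_def[of "i + l"]
  proof (rule restrict_ext)
    fix s :: complex assume s: "s \<in> sphere 0 1"
    let ?t = "angle s"
    let ?u = "sphere_act (sdim i) (mat_transpose (sframe i ?t)) u" and ?w = "sphere_act ?N (mat_transpose (?R ?t)) w"
    have u': "?u \<in> topspace (rep_sphere (sdim i))" and w': "?w \<in> topspace (rep_sphere ?N)"
      by (rule sphere_act_in[OF sframe(2)], rule sphere_act_in[OF R(2)])
    have fu: "f ?u \<in> topspace (level hZ (tdim i))" and f0: "f None = base_pt hZ (tdim i)"
      using p u' unfolding T.stage_pointed_def stage_dims by blast+
    have "T.stab (i * period) ?N f (sphere_smash (sdim i) ?u ?w) = structure_map hZ (tdim i) ?N (f ?u) ?w"
      unfolding stage_dims order_singleton_group mult_1_right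
      by (rule stabilize_smash[OF T.spectrum f0 fu u' w'])
    also have "\<dots> = (\<lambda>t. structure_map E (tdim i) ?N (f ?u t) ?w)"
      by (simp add: spectrum_hZ_def homotopy_fixed_points_Z_def restrict_UNIV)
    finally have st: "T.stab (i * period) ?N f (sphere_smash (sdim i) ?u ?w) ?t = structure_map E (tdim i) ?N (f ?u ?t) ?w"
      by simp
    have "twist (i + l) (T.stab (i * period) ?N f) v ?t = orth_act E (tdim i + ?N) (mat_sum (tdim i) (tframe i ?t) (?R ?t))
        (structure_map E (tdim i) ?N (f ?u ?t) ?w)"
      unfolding twist_def sd td sf tf uw mat_transpose_sum sphere_act_smash st ..
    also have "\<dots> = structure_map E (tdim i) ?N (orth_act E (tdim i) (tframe i ?t) (f ?u ?t)) (sphere_act ?N (?R ?t) ?w)"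
      by (rule structure_map_equivariant[OF ES tframe(1) R(1) hZ_apply_in[OF fu] w', symmetric])
    \<comment> \<open>On the added coordinates the target frame undoes the transposed source
      frame.\<close>
    also have "sphere_act ?N (?R ?t) ?w = w"
      using sphere_act_inverse[OF R(2) w] by simp
    finally show "structure_map E (tdim i) ?N (descend i f u s) w = twist (i + l) (T.stab (i * period) ?N f) v ?t"
      using s by (simp add: descend_def twist_def)
  qed
  finally show ?thesis ..
qed

text \<open>Let \<open>u\<close> be the sum of the basis vectors of the first copy of the regular
  representation. Column \<open>d\<close> of the frame is \<open>u / sqrt n\<close> and the columns
  are orthonormal, so the transpose sends \<open>u\<close> to \<open>sqrt n\<close> times the basis
  vector of index \<open>d\<close>. Pairing with \<open>u\<close> gives the first claim, translation
  by \<open>c * u\<close> the second.\<close>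

lemma pinch_frame:
  fixes t :: real
  assumes i: "1 \<le> i"
  defines "d \<equiv> nat k" and "n \<equiv> order G" and "y \<equiv> \<lambda>x. mat_vec (sdim i) (mat_transpose (sframe i t)) x"
  shows "(\<Sum>j\<in>{d..<d + n}. x j) = sqrt (real n) * y x d"
    and "y (\<lambda>j. if j \<in> {d..<d + n} then x j - c else x j) j = (if j = d then y x j - sqrt (real n) * c else y x j)"
proof -
  let ?A = "sframe i t" and ?D = "sdim i" and ?B = "{d..<d + n}"
  have n: "0 < sqrt (real n)" using order_pos by (simp add: n_def)
  have col: "?A l d = (if l \<in> ?B then 1 / sqrt (real n) else 0)" for l
    using frame_column[OF i, of d t l] unfolding sframe_def d_def n_def .
  have le: "d + n \<le> ?D"
    using i by (cases i) (auto simp: sdim_def d_def n_def)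
  have y: "y x j = (\<Sum>l<?D. ?A l j * x l)" for x j
    by (simp add: y_def mat_vec_def mat_transpose_def)
  have sub: "(\<Sum>l<?D. if l \<in> ?B then f l else 0) = (\<Sum>l\<in>?B. f l)" for f :: "nat \<Rightarrow> real"
    using le by (subst sum.inter_restrict[symmetric]) (auto intro!: sum.cong)
  have "y x d = (\<Sum>l<?D. if l \<in> ?B then x l / sqrt (real n) else 0)"
    unfolding y col by (rule sum.cong) auto
  also have "\<dots> = (\<Sum>l\<in>?B. x l) / sqrt (real n)"
    unfolding sub by (rule sum_divide_distrib[symmetric])
  finally show "(\<Sum>j\<in>?B. x j) = sqrt (real n) * y x d" using n by simp
  have "(\<Sum>l<?D. if l \<in> ?B then ?A l j else 0) = (if j = d then sqrt (real n) else 0)"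
  proof (cases "j < ?D")
    case True
    have "(\<Sum>l<?D. if l \<in> ?B then ?A l j else 0) = (\<Sum>l<?D. sqrt (real n) * (?A l d * ?A l j))"
      unfolding col using n by (intro sum.cong) auto
    also have "\<dots> = sqrt (real n) * (\<Sum>l<?D. ?A l d * ?A l j)"
      by (rule sum_distrib_left[symmetric])
    also have "(\<Sum>l<?D. ?A l d * ?A l j) = (if d = j then 1 else 0)"
      using sframe(1)[of i t] True le order_pos unfolding orthogonal_group_carrier n_def by simp
    finally show ?thesis by auto
  next
    case False
    then have "?A l j = 0" for l using orthogonal_vanishes[OF sframe(1)] by (simp add: not_less)
    then have "(\<Sum>l<?D. if l \<in> ?B then ?A l j else 0) = 0" by (intro sum.neutral) auto
    then show ?thesis using False le order_pos unfolding n_def by auto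
  qed
  moreover have "y (\<lambda>j. if j \<in> ?B then x j - c else x j) j = y x j - c * (\<Sum>l<?D. if l \<in> ?B then ?A l j else 0)"
    unfolding y sum_distrib_left sum_subtractf[symmetric] by (rule sum.cong) (auto simp: algebra_simps)
  ultimately show "y (\<lambda>j. if j \<in> ?B then x j - c else x j) j = (if j = d then y x j - sqrt (real n) * c else y x j)"
    by simp
qed

text \<open>With \<open>s\<close> the pairing of \<open>x\<close> with \<open>u\<close> and
  \<open>y\<close> the frame coordinates of \<open>x\<close>, \<open>s = sqrt n * y d\<close>, and
  the shift by \<open>u / s\<close> becomes a shift by \<open>sqrt n / s = 1 / y d\<close> in
  coordinate \<open>d\<close>. The factors \<open>sqrt n\<close> cancel and the signs agree, so one
  pinch turns into the other as an equality of functions, not merely up to homotopy.\<close>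

lemma twist_pinch:
  assumes i: "1 \<le> i"
  shows "twist i (T.pinch (i * period) f h) v t =
    pinch_sum (nat k) (order G) (base_pt E (tdim i)) (\<lambda>v. twist i f v t) (\<lambda>v. twist i h v t) v"
proof (cases v)
  case None
  then show ?thesis
    using orth_act_base[OF ES tframe(1)]
    by (simp only: twist_def sphere_act_simps pinch_sum_def option.case stage_dims hZ_base)
next
  case (Some x)
  let ?n = "order G" and ?d = "nat k"
  let ?y = "\<lambda>x. mat_vec (sdim i) (mat_transpose (sframe i t)) x"
  define s where "s = (\<Sum>j\<in>{?d..<?d + ?n}. x j)"
  let ?x = "\<lambda>j. if j \<in> {?d..<?d + ?n} then x j - 1 / s else x j"
  have n: "0 < sqrt (real ?n)" using order_pos by simp
  have s: "s = sqrt (real ?n) * ?y x ?d"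
    unfolding s_def by (rule pinch_frame(1)[OF i])
  have sign: "s < 0 \<longleftrightarrow> ?y x ?d < 0" "0 < s \<longleftrightarrow> 0 < ?y x ?d"
    using n unfolding s by (auto simp: mult_less_0_iff zero_less_mult_iff)
  have "sqrt (real ?n) * (1 / s) = 1 / ?y x ?d"
    using n unfolding s by simp
  then have yx: "?y ?x = (\<lambda>j. if j \<in> {?d..<?d + 1} then ?y x j - 1 / ?y x ?d else ?y x j)"
    using pinch_frame(2)[OF i, where c = "1 / s"] by (auto simp: fun_eq_iff)
  have T: "T.pinch (i * period) f h (Some (?y x)) =
      (if s < 0 then f (Some (?y ?x)) else if 0 < s then h (Some (?y ?x)) else base_pt hZ (tdim i))"
    unfolding pinch_sum_def option.case order_singleton_group stage_dims yx sign
    by (simp add: Let_def)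
  show ?thesis
    unfolding Some twist_def sphere_act_simps T
    unfolding pinch_sum_def option.case s_def[symmetric] Let_def sphere_act_simps hZ_base
    using orth_act_base[OF ES tframe(1)] by simp
qed

lemma descend_pinch:
  assumes i: "1 \<le> i"
  shows "descend i (T.pinch (i * period) f h) v = C.pinch (2 * i) (descend i f) (descend i h) v"
  unfolding descend_def twist_pinch[OF i]
  unfolding stage_dims hnZ_base pinch_sum_def
  by (auto simp: fun_eq_iff Let_def split: option.split)

section \<open>Comparison of the colimits\<close>

lemma descend_pointed:
  assumes "(i * period, f) \<in> stable_maps (singleton_group ()) (trivial_virtual_rep k) hZ"
  shows "(2 * i, descend i f) \<in> stable_maps G (trivial_virtual_rep k) hnZ"
  using assms unfolding T.stable_maps_iff C.stable_maps_iff by (rule descend_homotopic)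

lemma stable_descend_iff:
  assumes "T.stage_pointed (i * period) f"
  shows "(2 * i, descend i f) \<in> stable_maps G (trivial_virtual_rep k) hnZ \<longleftrightarrow>
    (i * period, f) \<in> stable_maps (singleton_group ()) (trivial_virtual_rep k) hZ"
  unfolding T.stable_maps_iff C.stable_maps_iff by (rule stage_homotopic_descend_iff[OF assms assms])

text \<open>Both relations can be tested at late matched stages \<open>2 * q\<close> and
  \<open>q * period\<close>, where \<open>descend\<close> commutes with stabilization and reflects
  homotopies. If one of the functions is not a stable map, neither side holds.\<close>

lemma rel_descend_iff:
  assumes f: "T.stage_pointed (i * period) f" and g: "T.stage_pointed (l * period) g"
  shows "((2 * i, descend i f), (2 * l, descend l g)) \<in> C.rel \<longleftrightarrow> ((i * period, f), (l * period, g)) \<in> T.rel"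
proof (cases "(i * period, f) \<in> stable_maps (singleton_group ()) (trivial_virtual_rep k) hZ \<and>
    (l * period, g) \<in> stable_maps (singleton_group ()) (trivial_virtual_rep k) hZ")
  case False
  then show ?thesis
    unfolding T.rel_iff C.rel_iff stable_descend_iff[OF f] stable_descend_iff[OF g] by blast
next
  case True
  note st = conjunct1[OF True] conjunct2[OF True]
  note st' = descend_pointed[OF st(1)] descend_pointed[OF st(2)]
  have stage: "C.stage_homotopic (2 * q) (C.stab (2 * i) (2 * q - 2 * i) (descend i f)) (C.stab (2 * l) (2 * q - 2 * l) (descend l g))
    \<longleftrightarrow> T.stage_homotopic (q * period) (T.stab (i * period) (q * period - i * period) f)
        (T.stab (l * period) (q * period - l * period) g)" if q: "i \<le> q" "l \<le> q" for q
  proof -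
    have eq: "C.stab (2 * j) (2 * q - 2 * j) (descend j f) v =
        descend q (T.stab (j * period) (q * period - j * period) f) v"
      if "j \<le> q" "(j * period, f) \<in> stable_maps (singleton_group ()) (trivial_virtual_rep k) hZ"
        "v \<in> topspace (rep_sphere (fst (C.src (2 * q))))" for j f v
      using descend_stab[OF that(2), of v "q - j"] that(1,3) unfolding stage_dims
      by (simp add: diff_mult_distrib diff_mult_distrib2)
    have pt: "T.stage_pointed (q * period) (T.stab (j * period) (q * period - j * period) f)"
      if "j \<le> q" "T.stage_pointed (j * period) f" for j f
    proof -
      have "j * period + (q * period - j * period) = q * period"
        using that(1) by (intro le_add_diff_inverse mult_le_mono1)
      then show ?thesis using T.stab_pointed[OF that(2), of "q * period - j * period"] by simp
    qed
    show ?thesis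
      unfolding stage_homotopic_descend_iff[OF pt[OF q(1) f] pt[OF q(2) g], symmetric]
      by (rule C.stage_homotopic_cong) (use eq[OF q(1) st(1)] eq[OF q(2) st(2)] in auto)
  qed
  have pos: "0 < period" using order_pos by simp
  show ?thesis
  proof
    assume "((2 * i, descend i f), (2 * l, descend l g)) \<in> C.rel"
    then obtain N where N: "\<And>L. N \<le> L \<Longrightarrow> 2 * i \<le> L \<and> 2 * l \<le> L \<and>
        C.stage_homotopic L (C.stab (2 * i) (L - 2 * i) (descend i f)) (C.stab (2 * l) (L - 2 * l) (descend l g))"
      unfolding C.rel_iff_eventually[OF st'] by blast
    \<comment> \<open>This choice is at least \<open>i\<close> and \<open>l\<close>, and twice it is
      at least \<open>N\<close>.\<close>
    let ?q = "N + i + l"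
    have "T.stage_homotopic (?q * period) (T.stab (i * period) (?q * period - i * period) f)
        (T.stab (l * period) (?q * period - l * period) g)"
      using N[of "2 * ?q"] stage[of ?q] by simp
    moreover have "i * period + (?q * period - i * period) = ?q * period" "l * period + (?q * period - l * period) = ?q * period"
      by (intro le_add_diff_inverse mult_le_mono1; simp)+
    ultimately show "((i * period, f), (l * period, g)) \<in> T.rel"
      unfolding T.rel_iff using st by metis
  next
    assume "((i * period, f), (l * period, g)) \<in> T.rel"
    then obtain N where N: "\<And>L. N \<le> L \<Longrightarrow> i * period \<le> L \<and> l * period \<le> L \<and>
        T.stage_homotopic L (T.stab (i * period) (L - i * period) f) (T.stab (l * period) (L - l * period) g)"
      unfolding T.rel_iff_eventually[OF st] by blast
    let ?q = "N + i + l"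
    have "N \<le> ?q * period" using pos by (metis add.assoc le_add1 mult_le_mono nat_mult_1_right One_nat_def Suc_leI)
    then have "C.stage_homotopic (2 * ?q) (C.stab (2 * i) (2 * ?q - 2 * i) (descend i f)) (C.stab (2 * l) (2 * ?q - 2 * l) (descend l g))"
      using N[of "?q * period"] stage[of ?q] by simp
    moreover have "2 * i + (2 * ?q - 2 * i) = 2 * ?q" "2 * l + (2 * ?q - 2 * l) = 2 * ?q" by simp_all
    ultimately show "((2 * i, descend i f), (2 * l, descend l g)) \<in> C.rel"
      unfolding C.rel_iff using st' by metis
  qed
qed

text \<open>Stage \<open>m\<close> may be odd, where frames can fail to exist; stabilizing by
  \<open>m\<close> reaches the even stage \<open>2 * m\<close>, which is matched with stage
  \<open>m * period\<close> of the other side.\<close>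

lemma descend_surj:
  assumes h: "(m, h) \<in> stable_maps G (trivial_virtual_rep k) hnZ"
  shows "\<exists>f. T.stage_pointed (m * period) f \<and>
    (\<forall>v\<in>topspace (rep_sphere (fst (C.src (m + m)))). descend m f v = C.stab m m h v)"
proof (intro exI[of _ "untwist m (C.stab m m h)"] conjI ballI)
  let ?h = "C.stab m m h"
  have st: "(2 * m, ?h) \<in> stable_maps G (trivial_virtual_rep k) hnZ"
    using C.stab_stable[OF h, of m] by (simp add: mult_2)
  then have "(m * period, untwist m ?h) \<in> stable_maps (singleton_group ()) (trivial_virtual_rep k) hZ"
    unfolding T.stable_maps_iff C.stable_maps_iff by (rule untwist_homotopic)
  then show "T.stage_pointed (m * period) (untwist m ?h)" by (rule T.stable_maps_pointed)
  fix v assume "v \<in> topspace (rep_sphere (fst (C.src (m + m))))"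
  then show "descend m (untwist m ?h) v = ?h v"
    unfolding mult_2[symmetric] stage_dims by (rule descend_untwist[OF C.stable_maps_pointed[OF st]])
qed

lemma homotopy_groups_iso: "homotopy_group k (spectrum_hZ G \<gamma> E) \<cong> RO_homotopy_group G (trivial_virtual_rep k) hnZ"
proof -
  define S where "S = {(i * period, f) |i f. T.stage_pointed (i * period) f}"
  define \<tau> where "\<tau> x = (2 * (fst x div period), descend (fst x div period) (snd x))" for x :: "nat \<times> (sphere_pt \<Rightarrow> real \<Rightarrow> 'a)"
  have pos: "0 < period" using order_pos by simp
  have \<tau>: "\<tau> (i * period, f) = (2 * i, descend i f)" for i f
    using pos by (simp add: \<tau>_def)
  have surj: "\<exists>f. (m * period, f) \<in> S \<and> (m + m, descend m f) = \<tau> (m * period, f) \<and>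
      (\<forall>v\<in>topspace (rep_sphere (fst (C.src (m + m)))). descend m f v = C.stab m m h v)"
    if "(m, h) \<in> stable_maps G (trivial_virtual_rep k) hnZ" for m h
    using descend_surj[OF that] unfolding \<tau> by (auto simp: S_def)
  have stages: "m \<le> m * period" for m using pos by simp
  show ?thesis
    unfolding homotopy_group_def
  \<comment> \<open>\<open>D\<close> restricts to pairs at one common stage of index at least 1,
    where a copy of the regular representation is present to pinch along.\<close>
  proof (rule quotient_iso[OF T.equiv_rel C.equiv_rel, where C = S and \<tau> = \<tau> and
        D = "\<lambda>x y. fst x = fst y \<and> 1 \<le> fst x" and p = "\<lambda>x y. (fst x, T.pinch (fst x) (snd x) (snd y))"])
    show "\<exists>c\<in>S. (x, c) \<in> T.rel" if x: "x \<in> stable_maps (singleton_group ()) (trivial_virtual_rep k) hZ" for x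
    proof -
      obtain m f where mf: "x = (m, f)" by (cases x)
      \<comment> \<open>An arbitrary stage \<open>m\<close> is pushed forward to
        \<open>m * period\<close>, a stage that has a partner on the equivariant side.\<close>
      have "m + (m * period - m) = m * period" using stages[of m] by simp
      then have "(m * period, T.stab m (m * period - m) f) \<in> S" "((m, f), (m * period, T.stab m (m * period - m) f)) \<in> T.rel"
        using T.stab_pointed[OF T.stable_maps_pointed, of m f "m * period - m"] T.rel_stab[of m f "m * period - m"] x
        unfolding mf S_def by auto
      then show ?thesis unfolding mf by blast
    qed
    show "(\<tau> x, \<tau> y) \<in> C.rel \<longleftrightarrow> (x, y) \<in> T.rel" if "x \<in> S" "y \<in> S" for x y
      using that rel_descend_iff by (auto simp: S_def \<tau>)
    show "\<exists>c\<in>S. (\<tau> c, y) \<in> C.rel" if y: "y \<in> stable_maps G (trivial_virtual_rep k) hnZ" for y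
    proof -
      obtain m h where mh: "y = (m, h)" by (cases y)
      obtain f where f: "(m * period, f) \<in> S" "(m + m, descend m f) = \<tau> (m * period, f)"
          "\<And>v. v\<in>topspace (rep_sphere (fst (C.src (m + m)))) \<Longrightarrow> descend m f v = C.stab m m h v"
        using surj[of m h] y unfolding mh by blast
      have r: "((m, h), (m + m, C.stab m m h)) \<in> C.rel" using C.rel_stab y unfolding mh by blast
      then have "y \<in> C.rel `` {(m + m, C.stab m m h)}" unfolding mh using C.rel_sym by blast
      also have "C.rel `` {(m + m, C.stab m m h)} = C.rel `` {(m + m, descend m f)}"
        by (rule C.rel_cong) (simp add: f(3))
      finally show ?thesis using f(1,2) by auto
    qed
    show "carrier (RO_homotopy_group (singleton_group ()) (trivial_virtual_rep k) hZ) =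
        stable_maps (singleton_group ()) (trivial_virtual_rep k) hZ // T.rel"
      "carrier (RO_homotopy_group G (trivial_virtual_rep k) hnZ) = stable_maps G (trivial_virtual_rep k) hnZ // C.rel"
      by (simp_all add: RO_homotopy_group_def)
    fix x y assume "x \<in> S" "y \<in> S" "fst x = fst y \<and> 1 \<le> fst x"
    then show "(fst x, T.pinch (fst x) (snd x) (snd y)) \<in> S"
      using T.pinch_pointed by (auto simp: S_def)
  next
    fix a b assume ab: "a \<in> stable_maps (singleton_group ()) (trivial_virtual_rep k) hZ // T.rel"
      "b \<in> stable_maps (singleton_group ()) (trivial_virtual_rep k) hZ // T.rel"
    have "a \<otimes>\<^bsub>RO_homotopy_group (singleton_group ()) (trivial_virtual_rep k) hZ\<^esub> b =
        \<Union>{T.rel `` {(m, T.pinch m f h)} |m f h. 1 \<le> m \<and> (m, f) \<in> a \<inter> S \<and> (m, h) \<in> b \<inter> S}"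
    proof (rule T.RO_mult_cofinal[OF ab])
      fix m f h assume m: "(m, f) \<in> stable_maps (singleton_group ()) (trivial_virtual_rep k) hZ"
        "(m, h) \<in> stable_maps (singleton_group ()) (trivial_virtual_rep k) hZ"
      have e: "m + (m * period - m) = m * period" using stages[of m] by simp
      show "\<exists>j f' h'. (m + j, f') \<in> S \<and> (m + j, h') \<in> S \<and>
          (\<forall>v\<in>topspace (rep_sphere (fst (T.src (m + j)))). f' v = T.stab m j f v \<and> h' v = T.stab m j h v)"
        using T.stab_pointed[OF T.stable_maps_pointed[OF m(1)], of "m * period - m"]
          T.stab_pointed[OF T.stable_maps_pointed[OF m(2)], of "m * period - m"] e
        by (intro exI[of _ "m * period - m"] exI[of _ "T.stab m (m * period - m) f"]
            exI[of _ "T.stab m (m * period - m) h"]) (auto simp: S_def)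
    qed
    also have "\<dots> = \<Union>{T.rel `` {(fst x, T.pinch (fst x) (snd x) (snd y))} |x y.
        x \<in> a \<inter> S \<and> y \<in> b \<inter> S \<and> fst x = fst y \<and> 1 \<le> fst x}"
      by (rule arg_cong[of _ _ Union]) force
    finally show "a \<otimes>\<^bsub>RO_homotopy_group (singleton_group ()) (trivial_virtual_rep k) hZ\<^esub> b =
        \<Union>{T.rel `` {(fst x, T.pinch (fst x) (snd x) (snd y))} |x y.
          x \<in> a \<inter> S \<and> y \<in> b \<inter> S \<and> fst x = fst y \<and> 1 \<le> fst x}" .
  next
    fix a b assume ab: "a \<in> stable_maps G (trivial_virtual_rep k) hnZ // C.rel"
      "b \<in> stable_maps G (trivial_virtual_rep k) hnZ // C.rel"
    have "a \<otimes>\<^bsub>RO_homotopy_group G (trivial_virtual_rep k) hnZ\<^esub> b =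
        \<Union>{C.rel `` {(m, C.pinch m f h)} |m f h. 1 \<le> m \<and> (m, f) \<in> a \<inter> \<tau> ` S \<and> (m, h) \<in> b \<inter> \<tau> ` S}"
    proof (rule C.RO_mult_cofinal[OF ab])
      fix m f h assume m: "(m, f) \<in> stable_maps G (trivial_virtual_rep k) hnZ"
        "(m, h) \<in> stable_maps G (trivial_virtual_rep k) hnZ"
      show "\<exists>j f' h'. (m + j, f') \<in> \<tau> ` S \<and> (m + j, h') \<in> \<tau> ` S \<and>
          (\<forall>v\<in>topspace (rep_sphere (fst (C.src (m + j)))). f' v = C.stab m j f v \<and> h' v = C.stab m j h v)"
        using surj[OF m(1)] surj[OF m(2)] by (metis image_eqI)
    qed
    also have "\<dots> = \<Union>{C.rel `` {\<tau> (fst x, T.pinch (fst x) (snd x) (snd y))} |x y.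
        x \<in> S \<and> \<tau> x \<in> a \<and> y \<in> S \<and> \<tau> y \<in> b \<and> fst x = fst y \<and> 1 \<le> fst x}" (is "\<Union>?L = \<Union>?R")
    proof (rule arg_cong[of _ _ Union])
      \<comment> \<open>\<open>descend_pinch\<close> equates the two pinch sums at every point, so
        their classes agree even when these are empty.\<close>
      have cls: "C.rel `` {\<tau> (i * period, T.pinch (i * period) f h)} = C.rel `` {(2 * i, C.pinch (2 * i) (descend i f) (descend i h))}"
        if "1 \<le> i" for i f h
        unfolding \<tau> by (rule C.rel_cong) (rule descend_pinch[OF that])
      show "?L = ?R"
      proof (intro equalityI subsetI)
        fix Z assume "Z \<in> ?L"
        then obtain m f h x y where Z: "Z = C.rel `` {(m, C.pinch m f h)}" "1 \<le> m"
            "(m, f) \<in> a" "(m, h) \<in> b" "(m, f) = \<tau> x" "(m, h) = \<tau> y" "x \<in> S" "y \<in> S" by blast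
        then obtain i f' l h' where x: "x = (i * period, f')" "y = (l * period, h')" by (auto simp: S_def)
        have e: "m = 2 * i" "f = descend i f'" "l = i" "h = descend i h'"
          using Z(5,6) unfolding x \<tau> by auto
        have i: "1 \<le> i" using Z(2) e(1) by simp
        have "Z = C.rel `` {\<tau> (fst x, T.pinch (fst x) (snd x) (snd y))}"
          unfolding Z(1) x fst_conv snd_conv cls[OF i] e ..
        moreover have "fst x = fst y" "1 \<le> fst x"
          using e(3) i stages[of i] unfolding x by auto
        moreover have "\<tau> x \<in> a" "\<tau> y \<in> b" using Z(3-6) by simp_all
        ultimately show "Z \<in> ?R" using Z(7,8) by blast
      next
        fix Z assume "Z \<in> ?R"
        then obtain x y where Z: "Z = C.rel `` {\<tau> (fst x, T.pinch (fst x) (snd x) (snd y))}"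
            "x \<in> S" "\<tau> x \<in> a" "y \<in> S" "\<tau> y \<in> b" "fst x = fst y" "1 \<le> fst x" by blast
        then obtain i f l h where x: "x = (i * period, f)" "y = (l * period, h)" by (auto simp: S_def)
        have l: "l = i" using Z(6) pos unfolding x by simp
        have i: "1 \<le> i" using Z(7) unfolding x by (cases i) auto
        have "Z = C.rel `` {(2 * i, C.pinch (2 * i) (descend i f) (descend i h))}"
          using cls[OF i] unfolding Z(1) x by simp
        moreover have "(2 * i, descend i f) \<in> a \<inter> \<tau> ` S" "(2 * i, descend i h) \<in> b \<inter> \<tau> ` S"
          using Z(2-5) unfolding x l \<tau> by (metis IntI \<tau> image_eqI)+
        moreover have "1 \<le> 2 * i" using i by simp
        ultimately show "Z \<in> ?L" by blast
      qed
    qed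
    finally show "a \<otimes>\<^bsub>RO_homotopy_group G (trivial_virtual_rep k) hnZ\<^esub> b =
        \<Union>{C.rel `` {\<tau> (fst x, T.pinch (fst x) (snd x) (snd y))} |x y.
          x \<in> S \<and> \<tau> x \<in> a \<and> y \<in> S \<and> \<tau> y \<in> b \<and> fst x = fst y \<and> 1 \<le> fst x}" .
  qed
qed

end

theorem corollary1p3:
  fixes G :: "('g, 'b) monoid_scheme" and \<gamma> :: 'g and n :: nat
    and E :: "('g, 'a) gspectrum"
  assumes "1 \<le> n"
    and "group G" and "order G = n" and "\<gamma> \<in> carrier G" and "generate G {\<gamma>} = carrier G"
    and "orthogonal_gspectrum G E"
  shows "\<forall>k::int. homotopy_group k (spectrum_hZ G \<gamma> E) \<cong>
           RO_homotopy_group G (trivial_virtual_rep k) (spectrum_hnZ G \<gamma> E)"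
proof
  fix k :: int
  interpret cyclic_spectrum G \<gamma> E k
    using assms
    by (auto intro!: cyclic_spectrum.intro cyclic_generator.intro cyclic_generator_axioms.intro
        cyclic_spectrum_axioms.intro)
  show "homotopy_group k (spectrum_hZ G \<gamma> E) \<cong>
      RO_homotopy_group G (trivial_virtual_rep k) (spectrum_hnZ G \<gamma> E)"
    by (rule homotopy_groups_iso)
qed

end
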